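(* Let $\mathcal B=(B_g)_{g\in G}$ be a Fell bundle over a discrete Abelian group $G$ and let $A:=B_e$. (1) $A$ detects ideals in $\mathrm{C}^*(\mathcal B)$ if and only if $\Gamma(\mathcal B)=\widehat G$. (2) $A$ separates ideals in $\mathrm{C}^*(\mathcal B)$ if and only if $\tilde\Gamma(\mathcal B)=\widehat G$.
   Context: Ideals are closed and two-sided. A Fell bundle $\mathcal B=(B_g)_{g\in G}$ over a discrete group $G$ consists of Banach spaces $B_g$ with bilinear associative multiplications $B_g\times B_h\to B_{gh}$ and conjugate-linear antimultiplicative involutions $B_g\to B_{g^{-1}}$ such that $\|ab\|\le\|a\|\|b\|$, $\|a^*a\|=\|a\|^2$, and for each $a\in B_g$ there is $c\in B_e$ with $a^*a=c^*c$; the unit fibre $B_e$ is a $\mathrm{C}^*$-algebra. $\mathrm{C}^*(\mathcal B)$ is the completion of the $*$-algebra $\bigoplus_gB_g$ in its maximal $\mathrm{C}^*$-norm. For Abelian $G$, the dual action $\beta$ of $\widehat G$ on $\mathrm{C}^*(\mathcal B)$ is $\beta_\chi(x)=\chi(g)x$ for $x\in B_g$. The Connes spectrum is $\Gamma(\mathcal B):=\{z\in\widehat G:I\cap\beta_z(I)\neq0$ for each non-zero ideal $I$ in $\mathrm{C}^*(\mathcal B)\}$, and the strong Connes spectrum is $\tilde\Gamma(\mathcal B):=\{z\in\widehat G:\beta_z(I)\subseteq I$ for any ideal $I$ in $\mathrm{C}^*(\mathcal B)\}$. A $\mathrm{C}^*$-subalgebra $A\subseteq B$ detects ideals in $B$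 if $J\cap A=0$ implies $J=0$ for each ideal $J$ in $B$; it separates ideals in $B$ if $I\cap A=J\cap A$ implies $I=J$ for all ideals $I,J$ in $B$. *)

theory Defs
  imports Complex_Main
begin

section \<open>Complex *-algebras, C*-seminorms and completions\<close>

record 'a star_algebra =
  alg_carrier :: "'a set"
  alg_zero :: 'a
  alg_add :: "'a \<Rightarrow> 'a \<Rightarrow> 'a"
  alg_scale :: "complex \<Rightarrow> 'a \<Rightarrow> 'a"
  alg_mult :: "'a \<Rightarrow> 'a \<Rightarrow> 'a"
  alg_star :: "'a \<Rightarrow> 'a"

record 'a normed_star_algebra = "'a star_algebra" +
  alg_norm :: "'a \<Rightarrow> real"

definition alg_diff :: "('a, 'z) star_algebra_scheme \<Rightarrow> 'a \<Rightarrow> 'a \<Rightarrow> 'a" where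
  "alg_diff D x y = alg_add D x (alg_scale D (-1) y)"

definition cstar_seminorm :: "('a, 'z) star_algebra_scheme \<Rightarrow> ('a \<Rightarrow> real) \<Rightarrow> bool" where
  "cstar_seminorm D p \<longleftrightarrow>
     (\<forall>x\<in>alg_carrier D. 0 \<le> p x) \<and>
     (\<forall>x\<in>alg_carrier D. \<forall>y\<in>alg_carrier D. p (alg_add D x y) \<le> p x + p y) \<and>
     (\<forall>c. \<forall>x\<in>alg_carrier D. p (alg_scale D c x) = cmod c * p x) \<and>
     (\<forall>x\<in>alg_carrier D. \<forall>y\<in>alg_carrier D. p (alg_mult D x y) \<le> p x * p y) \<and>
     (\<forall>x\<in>alg_carrier D. p (alg_mult D (alg_star D x) x) = (p x)\<^sup>2)"

text \<open>The pointwise supremum of all C*-seminorms. On the section algebra of a Fell bundle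
  this supremum is finite, because every C*-seminorm is bounded by the sum of the fibre norms; it is
  a norm, because the regular representation is injective. So there it is the maximal C*-norm.\<close>

definition max_cstar_norm :: "('a, 'z) star_algebra_scheme \<Rightarrow> 'a \<Rightarrow> real" where
  "max_cstar_norm D x = (SUP p \<in> {p. cstar_seminorm D p}. p x)"

definition cauchy_seqs :: "('a, 'z) normed_star_algebra_scheme \<Rightarrow> (nat \<Rightarrow> 'a) set" where
  "cauchy_seqs D = {X. (\<forall>n. X n \<in> alg_carrier D) \<and>
     (\<forall>\<epsilon>>0. \<exists>N. \<forall>m\<ge>N. \<forall>n\<ge>N. alg_norm D (alg_diff D (X m) (X n)) < \<epsilon>)}"

definition null_rel ::
  "('a, 'z) normed_star_algebra_scheme \<Rightarrow> ((nat \<Rightarrow> 'a) \<times> (nat \<Rightarrow> 'a)) set" where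
  "null_rel D = {(X, Y). X \<in> cauchy_seqs D \<and> Y \<in> cauchy_seqs D \<and>
     (\<lambda>n. alg_norm D (alg_diff D (X n) (Y n))) \<longlonglongrightarrow> 0}"

definition completion_embed ::
  "('a, 'z) normed_star_algebra_scheme \<Rightarrow> 'a \<Rightarrow> (nat \<Rightarrow> 'a) set" where
  "completion_embed D x = null_rel D `` {\<lambda>n. x}"

text \<open>The extensions of uniformly continuous unary operations, and of binary operations that are
  uniformly continuous on bounded sets, to the completion; as usual for quotients by an equivalence
  relation, the union runs over all representatives, whose results agree.\<close>

definition completion_map ::
  "('a, 'z) normed_star_algebra_scheme \<Rightarrow> ('a \<Rightarrow> 'a) \<Rightarrow> (nat \<Rightarrow> 'a) set \<Rightarrow> (nat \<Rightarrow> 'a) set" where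
  "completion_map D \<phi> U = (\<Union>X\<in>U. null_rel D `` {\<lambda>n. \<phi> (X n)})"

definition completion_map2 ::
  "('a, 'z) normed_star_algebra_scheme \<Rightarrow> ('a \<Rightarrow> 'a \<Rightarrow> 'a) \<Rightarrow>
     (nat \<Rightarrow> 'a) set \<Rightarrow> (nat \<Rightarrow> 'a) set \<Rightarrow> (nat \<Rightarrow> 'a) set" where
  "completion_map2 D \<phi> U V = (\<Union>X\<in>U. \<Union>Y\<in>V. null_rel D `` {\<lambda>n. \<phi> (X n) (Y n)})"

definition completion ::
  "('a, 'z) normed_star_algebra_scheme \<Rightarrow> (nat \<Rightarrow> 'a) set normed_star_algebra" where
  "completion D =
     \<lparr>alg_carrier = cauchy_seqs D // null_rel D,
      alg_zero = completion_embed D (alg_zero D),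
      alg_add = completion_map2 D (alg_add D),
      alg_scale = (\<lambda>c. completion_map D (alg_scale D c)),
      alg_mult = completion_map2 D (alg_mult D),
      alg_star = completion_map D (alg_star D),
      alg_norm = (\<lambda>U. lim (\<lambda>n. alg_norm D ((SOME X. X \<in> U) n)))\<rparr>"

section \<open>Ideals\<close>

definition closed_ideal :: "('a, 'z) normed_star_algebra_scheme \<Rightarrow> 'a set \<Rightarrow> bool" where
  "closed_ideal C I \<longleftrightarrow>
     I \<subseteq> alg_carrier C \<and> alg_zero C \<in> I \<and>
     (\<forall>x\<in>I. \<forall>y\<in>I. alg_add C x y \<in> I) \<and>
     (\<forall>c. \<forall>x\<in>I. alg_scale C c x \<in> I) \<and>
     (\<forall>a\<in>alg_carrier C. \<forall>x\<in>I. alg_mult C a x \<in> I \<and> alg_mult C x a \<in> I) \<and>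
     (\<forall>X. \<forall>l\<in>alg_carrier C.
        (\<forall>n. X n \<in> I) \<and> (\<lambda>n. alg_norm C (alg_diff C (X n) l)) \<longlonglongrightarrow> 0 \<longrightarrow> l \<in> I)"

definition detects_ideals :: "('a, 'z) normed_star_algebra_scheme \<Rightarrow> 'a set \<Rightarrow> bool" where
  "detects_ideals C A \<longleftrightarrow>
     (\<forall>J. closed_ideal C J \<longrightarrow> J \<inter> A = {alg_zero C} \<longrightarrow> J = {alg_zero C})"

definition separates_ideals :: "('a, 'z) normed_star_algebra_scheme \<Rightarrow> 'a set \<Rightarrow> bool" where
  "separates_ideals C A \<longleftrightarrow>
     (\<forall>I J. closed_ideal C I \<longrightarrow> closed_ideal C J \<longrightarrow> I \<inter> A = J \<inter> A \<longrightarrow> I = J)"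

section \<open>Fell bundles over discrete groups\<close>

text \<open>Groups are written additively, also when they are not commutative. The fibres are linear
  subspaces of one ambient complex vector space, each with a complete norm of its own. This is no
  restriction: any family of Banach spaces embeds linearly into its algebraic direct sum. Fibres may
  overlap, or even coincide, as sets; therefore norm, multiplication and involution carry the group
  elements that index the fibres as arguments.\<close>

record ('g, 'b) fell_data =
  smul :: "complex \<Rightarrow> 'b \<Rightarrow> 'b"
  fibre :: "'g \<Rightarrow> 'b set"
  fnorm :: "'g \<Rightarrow> 'b \<Rightarrow> real"
  fmult :: "'g \<Rightarrow> 'g \<Rightarrow> 'b \<Rightarrow> 'b \<Rightarrow> 'b"
  fstar :: "'g \<Rightarrow> 'b \<Rightarrow> 'b"

locale fell_bundle =
  fixes \<B> :: "('g::group_add, 'b::ab_group_add) fell_data"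
  assumes vector_space: "vector_space (smul \<B>)"
    and subspace: "module.subspace (smul \<B>) (fibre \<B> g)"
    and norm_eq_0_iff: "a \<in> fibre \<B> g \<Longrightarrow> fnorm \<B> g a = 0 \<longleftrightarrow> a = 0"
    and norm_triangle: "\<lbrakk>a \<in> fibre \<B> g; b \<in> fibre \<B> g\<rbrakk> \<Longrightarrow>
          fnorm \<B> g (a + b) \<le> fnorm \<B> g a + fnorm \<B> g b"
    and norm_smul: "a \<in> fibre \<B> g \<Longrightarrow> fnorm \<B> g (smul \<B> c a) = cmod c * fnorm \<B> g a"
    and complete: "\<lbrakk>\<And>n. X n \<in> fibre \<B> g;
          \<And>\<epsilon>. \<epsilon> > 0 \<Longrightarrow> \<exists>N. \<forall>m\<ge>N. \<forall>n\<ge>N. fnorm \<B> g (X m - X n) < \<epsilon>\<rbrakk> \<Longrightarrow>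
          \<exists>l\<in>fibre \<B> g. (\<lambda>n. fnorm \<B> g (X n - l)) \<longlonglongrightarrow> 0"
    and mult_closed: "\<lbrakk>a \<in> fibre \<B> g; b \<in> fibre \<B> h\<rbrakk> \<Longrightarrow> fmult \<B> g h a b \<in> fibre \<B> (g + h)"
    and mult_add_left: "\<lbrakk>a \<in> fibre \<B> g; a' \<in> fibre \<B> g; b \<in> fibre \<B> h\<rbrakk> \<Longrightarrow>
          fmult \<B> g h (a + a') b = fmult \<B> g h a b + fmult \<B> g h a' b"
    and mult_add_right: "\<lbrakk>a \<in> fibre \<B> g; b \<in> fibre \<B> h; b' \<in> fibre \<B> h\<rbrakk> \<Longrightarrow>
          fmult \<B> g h a (b + b') = fmult \<B> g h a b + fmult \<B> g h a b'"
    and mult_smul_left: "\<lbrakk>a \<in> fibre \<B> g; b \<in> fibre \<B> h\<rbrakk> \<Longrightarrow>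
          fmult \<B> g h (smul \<B> c a) b = smul \<B> c (fmult \<B> g h a b)"
    and mult_smul_right: "\<lbrakk>a \<in> fibre \<B> g; b \<in> fibre \<B> h\<rbrakk> \<Longrightarrow>
          fmult \<B> g h a (smul \<B> c b) = smul \<B> c (fmult \<B> g h a b)"
    and mult_assoc: "\<lbrakk>a \<in> fibre \<B> g; b \<in> fibre \<B> h; d \<in> fibre \<B> k\<rbrakk> \<Longrightarrow>
          fmult \<B> (g + h) k (fmult \<B> g h a b) d = fmult \<B> g (h + k) a (fmult \<B> h k b d)"
    and star_closed: "a \<in> fibre \<B> g \<Longrightarrow> fstar \<B> g a \<in> fibre \<B> (- g)"
    and star_add: "\<lbrakk>a \<in> fibre \<B> g; b \<in> fibre \<B> g\<rbrakk> \<Longrightarrow>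
          fstar \<B> g (a + b) = fstar \<B> g a + fstar \<B> g b"
    and star_smul: "a \<in> fibre \<B> g \<Longrightarrow> fstar \<B> g (smul \<B> c a) = smul \<B> (cnj c) (fstar \<B> g a)"
    and star_mult: "\<lbrakk>a \<in> fibre \<B> g; b \<in> fibre \<B> h\<rbrakk> \<Longrightarrow>
          fstar \<B> (g + h) (fmult \<B> g h a b) = fmult \<B> (- h) (- g) (fstar \<B> h b) (fstar \<B> g a)"
    and star_star: "a \<in> fibre \<B> g \<Longrightarrow> fstar \<B> (- g) (fstar \<B> g a) = a"
    and norm_mult: "\<lbrakk>a \<in> fibre \<B> g; b \<in> fibre \<B> h\<rbrakk> \<Longrightarrow>
          fnorm \<B> (g + h) (fmult \<B> g h a b) \<le> fnorm \<B> g a * fnorm \<B> h b"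
    and cstar_identity: "a \<in> fibre \<B> g \<Longrightarrow>
          fnorm \<B> 0 (fmult \<B> (- g) g (fstar \<B> g a) a) = (fnorm \<B> g a)\<^sup>2"
    and positivity: "a \<in> fibre \<B> g \<Longrightarrow>
          \<exists>c\<in>fibre \<B> 0. fmult \<B> (- g) g (fstar \<B> g a) a = fmult \<B> 0 0 (fstar \<B> 0 c) c"

text \<open>The direct sum of the fibres, as finitely supported sections. The product is the convolution
  \<open>(f * h) k = (\<Sum>g. f g \<cdot> h (g\<^sup>-\<^sup>1 k))\<close>.\<close>

definition section_star_algebra ::
  "('g::group_add, 'b::ab_group_add) fell_data \<Rightarrow> ('g \<Rightarrow> 'b) star_algebra" where
  "section_star_algebra \<B> =
     \<lparr>alg_carrier = {f. (\<forall>g. f g \<in> fibre \<B> g) \<and> finite {g. f g \<noteq> 0}},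
      alg_zero = (\<lambda>g. 0),
      alg_add = (\<lambda>f h g. f g + h g),
      alg_scale = (\<lambda>c f g. smul \<B> c (f g)),
      alg_mult = (\<lambda>f h k. \<Sum>g | f g \<noteq> 0. fmult \<B> g (- g + k) (f g) (h (- g + k))),
      alg_star = (\<lambda>f g. fstar \<B> (- g) (f (- g)))\<rparr>"

definition section_algebra ::
  "('g::group_add, 'b::ab_group_add) fell_data \<Rightarrow> ('g \<Rightarrow> 'b) normed_star_algebra" where
  "section_algebra \<B> = star_algebra.extend (section_star_algebra \<B>)
     (normed_star_algebra.fields (max_cstar_norm (section_star_algebra \<B>)))"

definition fell_cstar ::
  "('g::group_add, 'b::ab_group_add) fell_data \<Rightarrow> (nat \<Rightarrow> 'g \<Rightarrow> 'b) set normed_star_algebra" where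
  "fell_cstar \<B> = completion (section_algebra \<B>)"

text \<open>The copy of the unit fibre inside \<open>fell_cstar \<B>\<close>.\<close>

definition unit_fibre ::
  "('g::group_add, 'b::ab_group_add) fell_data \<Rightarrow> (nat \<Rightarrow> 'g \<Rightarrow> 'b) set set" where
  "unit_fibre \<B> =
     (\<lambda>a. completion_embed (section_algebra \<B>) (\<lambda>g. if g = 0 then a else 0)) ` fibre \<B> 0"

section \<open>Dual action and Connes spectra\<close>

definition dual_group :: "('g::ab_group_add \<Rightarrow> complex) set" where
  "dual_group = {\<chi>. (\<forall>g. cmod (\<chi> g) = 1) \<and> (\<forall>g h. \<chi> (g + h) = \<chi> g * \<chi> h)}"

definition dual_action ::
  "('g::ab_group_add, 'b::ab_group_add) fell_data \<Rightarrow> ('g \<Rightarrow> complex) \<Rightarrow>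
     (nat \<Rightarrow> 'g \<Rightarrow> 'b) set \<Rightarrow> (nat \<Rightarrow> 'g \<Rightarrow> 'b) set" where
  "dual_action \<B> \<chi> = completion_map (section_algebra \<B>) (\<lambda>f g. smul \<B> (\<chi> g) (f g))"

definition connes_spectrum ::
  "('g::ab_group_add, 'b::ab_group_add) fell_data \<Rightarrow> ('g \<Rightarrow> complex) set" where
  "connes_spectrum \<B> = {\<chi>\<in>dual_group.
     \<forall>I. closed_ideal (fell_cstar \<B>) I \<longrightarrow> I \<noteq> {alg_zero (fell_cstar \<B>)} \<longrightarrow>
         I \<inter> dual_action \<B> \<chi> ` I \<noteq> {alg_zero (fell_cstar \<B>)}}"

definition strong_connes_spectrum ::
  "('g::ab_group_add, 'b::ab_group_add) fell_data \<Rightarrow> ('g \<Rightarrow> complex) set" where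
  "strong_connes_spectrum \<B> = {\<chi>\<in>dual_group.
     \<forall>I. closed_ideal (fell_cstar \<B>) I \<longrightarrow> dual_action \<B> \<chi> ` I \<subseteq> I}"

end

theory Submission
  imports Defs "HOL-Analysis.Weierstrass_Theorems" "HOL-Computational_Algebra.Polynomial"
begin

text \<open>
  Let \<open>A\<close> be the unit fibre and \<open>C\<close> the C*-algebra of the bundle. Everything rests on one statement,
  \<open>invariant_ideal_le\<close>: if \<open>I\<close> is a closed ideal that is invariant under the dual action and
  \<open>I \<inter> A \<subseteq> J\<close>, then \<open>I \<subseteq> J\<close>. Averaging \<open>x \<in> I\<close> over the dual group against a character yields its
  spectral component \<open>x\<^sub>g \<in> I\<close>. The product \<open>x\<^sub>g\<^sup>* x\<^sub>g\<close> lies in \<open>I \<inter> A \<subseteq> J\<close>, hence \<open>x\<^sub>g \<in> J\<close>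
  (\<open>star_mult_self_in_ideal\<close>); and \<open>x\<close> is a limit of linear combinations of its components, by
  Fejer summation along almost invariant finite subsets of the group (\<open>coefficients_in_ideal\<close>). So
  \<open>x \<in> J\<close>.

  The dual action fixes \<open>A\<close> pointwise, so \<open>I\<close> and its translates have the same intersection with \<open>A\<close>.
  This gives both implications from detection or separation to the statements on the spectra, and
  \<open>invariant_ideal_le\<close> gives the converse for the strong Connes spectrum. For the Connes spectrum, let
  \<open>J\<close> be nonzero. The intersection of all its translates is invariant, so it suffices to see that it is
  nonzero. Choose a nonzero self-adjoint \<open>a \<in> J\<close> and, by functional calculus, elements \<open>w\<close> and \<open>c \<noteq> 0\<close> with
  \<open>w a c = c\<close> (\<open>local_inverse\<close>). Then \<open>c\<close> belongs to every closed ideal that comes close enough to \<open>a\<close>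
  (\<open>local_unit_in_close_ideal\<close>), in particular to the translates of \<open>J\<close> by characters near \<open>1\<close>. The dual
  group is totally bounded, so all translates of \<open>J\<close> contain one of finitely many translates of a
  nonzero ideal (\<open>finitely_many_translates\<close>); and if the Connes spectrum is everything, finitely many
  translates of a nonzero ideal have nonzero intersection.

  No Haar measure and no spectral theory are used. Averages over the dual group are replaced by the
  closed cone of positive definite functions, whose members act on \<open>C\<close> as multipliers of controlled
  norm. The functional calculus of a self-adjoint element is reduced to an inequality for seminorms on
  real polynomials (\<open>N_le_sup\<close>), which follows from the C*-identity and Chebyshev expansions. It
  also yields that *-homomorphisms from C*-algebras are contractive and have closed range; with the
  former the maximal C*-norm is finite, with the latter \<open>A\<close> is closed in \<open>C\<close>.
\<close>

section \<open>Seminorms on real polynomials that behave like C*-norms\<close>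

text \<open>The properties of the operator seminorm of \<open>q(a)\<close> on a C*-algebra, as a function of the polynomial
  \<open>q\<close>, for a self-adjoint \<open>a\<close> with \<open>\<parallel>a\<parallel> \<le> 1\<close>. All estimates on the polynomial functional calculus follow
  from them.\<close>

locale poly_seminorm =
  fixes N :: "real poly \<Rightarrow> real"
  assumes N_nonneg: "0 \<le> N p"
    and N_add: "N (p + q) \<le> N p + N q"
    and N_smult: "N (smult c p) \<le> \<bar>c\<bar> * N p"
    and N_mult: "N (p * q) \<le> N p * N q"
    and N_square: "(N p)\<^sup>2 \<le> N (p\<^sup>2)"
    and N_sum_squares: "N (p\<^sup>2) \<le> N (p\<^sup>2 + q\<^sup>2)"
    and N_one: "N 1 \<le> 1"
    and N_X: "N [:0, 1:] \<le> 1"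
begin

lemma N_zero: "N 0 = 0"
  using N_smult[of 0 0] N_nonneg[of 0] by simp

lemma N_minus: "N (- p) \<le> N p"
  using N_smult[of "-1" p] by simp

lemma N_diff: "N (p - q) \<le> N p + N q"
  using N_add[of p "- q"] N_minus[of q] by simp

lemma N_sum: "N (\<Sum>i\<in>S. f i) \<le> (\<Sum>i\<in>S. N (f i))"
proof (cases "finite S")
  case True
  then show ?thesis
  proof (induction S)
    case empty
    then show ?case by (simp add: N_zero)
  next
    case (insert i S)
    have "N (\<Sum>i\<in>insert i S. f i) \<le> N (f i) + N (\<Sum>i\<in>S. f i)"
      using insert by (simp add: N_add)
    with insert show ?case by simp
  qed
qed (simp add: N_zero)

lemma N_power: "N (p ^ n) \<le> N p ^ n"
proof (induction n)
  case 0
  then show ?case using N_one by simp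
next
  case (Suc n)
  have "N (p ^ Suc n) \<le> N p * N (p ^ n)" using N_mult by simp
  also have "\<dots> \<le> N p * N p ^ n" using Suc N_nonneg by (intro mult_left_mono) auto
  finally show ?case by simp
qed

lemma N_power_two_power: "N p ^ (2 ^ k) \<le> N (p ^ (2 ^ k))"
proof (induction k)
  case (Suc k)
  have "N p ^ (2 ^ Suc k) = (N p ^ (2 ^ k))\<^sup>2"
    by (simp add: power_mult [symmetric] mult.commute)
  also have "\<dots> \<le> (N (p ^ (2 ^ k)))\<^sup>2"
    using Suc N_nonneg by (intro power_mono) auto
  also have "\<dots> \<le> N ((p ^ (2 ^ k))\<^sup>2)" by (rule N_square)
  also have "\<dots> = N (p ^ (2 ^ Suc k))"
    by (simp add: power_mult [symmetric] mult.commute)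
  finally show ?case .
qed simp

end

text \<open>The recursion for \<open>1 - sqrt (1 - t\<^sup>2)\<close>: if \<open>w = (t\<^sup>2 + w\<^sup>2) / 2\<close> then
  \<open>(1 - w)\<^sup>2 = 1 - t\<^sup>2\<close>. The scalar recursion at \<open>t = 1\<close> controls the polynomial one in every
  submultiplicative seminorm with \<open>N t \<le> 1\<close>, because the recursion has nonnegative coefficients.\<close>

primrec sqrt_poly :: "nat \<Rightarrow> real poly" where
  "sqrt_poly 0 = 0"
| "sqrt_poly (Suc n) = smult (1/2) ([:0, 1:]\<^sup>2 + (sqrt_poly n)\<^sup>2)"

primrec sqrt_bound :: "nat \<Rightarrow> real" where
  "sqrt_bound 0 = 0"
| "sqrt_bound (Suc n) = (1 + (sqrt_bound n)\<^sup>2) / 2"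

lemma sqrt_bound_range: "0 \<le> sqrt_bound n \<and> sqrt_bound n \<le> 1"
proof (induction n)
  case (Suc n)
  then have "(sqrt_bound n)\<^sup>2 \<le> 1" by (simp add: power_le_one)
  then show ?case by simp
qed simp

lemma sqrt_bound_incr: "sqrt_bound n \<le> sqrt_bound (Suc n)"
  using sum_squares_bound[of "sqrt_bound n" 1] by simp

lemma sqrt_bound_step: "(\<lambda>n. sqrt_bound (Suc n) - sqrt_bound n) \<longlonglongrightarrow> 0"
proof -
  have inc: "incseq sqrt_bound" by (rule incseq_SucI) (rule sqrt_bound_incr)
  obtain l where l: "sqrt_bound \<longlonglongrightarrow> l"
    using incseq_convergent[OF inc, of 1] sqrt_bound_range by blast
  have "(\<lambda>n. sqrt_bound (Suc n) - sqrt_bound n) \<longlonglongrightarrow> l - l"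
    by (intro tendsto_diff LIMSEQ_Suc l)
  then show ?thesis by simp
qed

text \<open>Real and imaginary part of \<open>(t + i s)\<^sup>n\<close>.\<close>

primrec re_im_power :: "real poly \<Rightarrow> nat \<Rightarrow> real poly \<times> real poly" where
  "re_im_power s 0 = (1, 0)"
| "re_im_power s (Suc n) =
     (let (a, b) = re_im_power s n in ([:0, 1:] * a - s * b, s * a + [:0, 1:] * b))"

lemma re_im_power_norm:
  "(fst (re_im_power s n))\<^sup>2 + (snd (re_im_power s n))\<^sup>2 = ([:0, 1:]\<^sup>2 + s\<^sup>2) ^ n"
proof (induction n)
  case (Suc n)
  obtain a b where ab: "re_im_power s n = (a, b)" by fastforce
  define x :: "real poly" where "x = [:0, 1:]"
  have "(x * a - s * b)\<^sup>2 + (s * a + x * b)\<^sup>2 = (x\<^sup>2 + s\<^sup>2) * (a\<^sup>2 + b\<^sup>2)" by algebra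
  also have "\<dots> = (x\<^sup>2 + s\<^sup>2) ^ Suc n" using Suc ab unfolding x_def[symmetric] by simp
  finally show ?case using ab by (simp add: Let_def x_def)
qed simp

lemma re_im_power_rec:
  "fst (re_im_power s (Suc (Suc n))) =
     [:0, 2:] * fst (re_im_power s (Suc n)) - ([:0, 1:]\<^sup>2 + s\<^sup>2) * fst (re_im_power s n)"
proof -
  obtain a b where ab: "re_im_power s n = (a, b)" by fastforce
  define x :: "real poly" where "x = [:0, 1:]"
  have x2: "[:0, 2:] = 2 * x" unfolding x_def by (simp add: numeral_poly)
  have "fst (re_im_power s (Suc (Suc n))) = x * (x * a - s * b) - s * (s * a + x * b)"
    using ab by (simp add: Let_def x_def del: mult_pCons_left mult_pCons_right)
  also have "\<dots> = 2 * x * (x * a - s * b) - (x\<^sup>2 + s\<^sup>2) * a" by algebra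
  also have "\<dots> = [:0, 2:] * fst (re_im_power s (Suc n)) - ([:0, 1:]\<^sup>2 + s\<^sup>2) * fst (re_im_power s n)"
    using ab unfolding x2 x_def[symmetric]
    by (simp add: Let_def x_def del: mult_pCons_left mult_pCons_right)
  finally show ?thesis .
qed

text \<open>The Chebyshev polynomials of the first kind.\<close>

fun chebyshev :: "nat \<Rightarrow> real poly" where
  "chebyshev 0 = 1"
| "chebyshev (Suc 0) = [:0, 1:]"
| "chebyshev (Suc (Suc n)) = [:0, 2:] * chebyshev (Suc n) - chebyshev n"

lemma poly_chebyshev: "poly (chebyshev n) (cos \<theta>) = cos (real n * \<theta>)"
proof (induction n rule: chebyshev.induct)
  case (3 n)
  have "cos (real (Suc (Suc n)) * \<theta>) = cos (real (Suc n) * \<theta> + \<theta>)"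
    by (simp add: algebra_simps)
  moreover have "cos (real n * \<theta>) = cos (real (Suc n) * \<theta> - \<theta>)"
    by (simp add: algebra_simps)
  ultimately have "cos (real (Suc (Suc n)) * \<theta>) = 2 * cos \<theta> * cos (real (Suc n) * \<theta>) - cos (real n * \<theta>)"
    by (simp only: cos_add cos_diff) simp
  with 3 show ?case by simp
qed simp_all

lemma chebyshev_mult_X:
  "[:0, 1:] * chebyshev (Suc n) = smult (1/2) (chebyshev (Suc (Suc n))) + smult (1/2) (chebyshev n)"
  by (simp add: smult_diff_right)

lemma chebyshev_expansion:
  assumes "degree q \<le> d"
  shows "\<exists>\<alpha>. q = (\<Sum>k\<le>d. smult (\<alpha> k) (chebyshev k))"
  using assms
proof (induction d arbitrary: q)
  case 0
  then obtain c where "q = [:c:]" using degree_eq_zeroE[of q] by auto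
  then have "q = (\<Sum>k\<le>0. smult ((\<lambda>_. c) k) (chebyshev k))" by simp
  then show ?case by (intro exI)
next
  case (Suc d)
  obtain c r where q: "q = pCons c r" by (cases q)
  have "degree r \<le> d" using Suc.prems q by (cases "r = 0") auto
  then obtain \<alpha> where r: "r = (\<Sum>k\<le>d. smult (\<alpha> k) (chebyshev k))"
    using Suc.IH by blast
  define V where "V = {p. \<exists>\<alpha>. p = (\<Sum>k\<le>Suc d. smult (\<alpha> k) (chebyshev k))}"
  have V_add: "p + p' \<in> V" if "p \<in> V" "p' \<in> V" for p p'
  proof -
    from that obtain \<alpha> \<beta> where "p = (\<Sum>k\<le>Suc d. smult (\<alpha> k) (chebyshev k))"
      "p' = (\<Sum>k\<le>Suc d. smult (\<beta> k) (chebyshev k))" unfolding V_def by blast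
    then have "p + p' = (\<Sum>k\<le>Suc d. smult ((\<lambda>k. \<alpha> k + \<beta> k) k) (chebyshev k))"
      by (simp add: smult_add_left sum.distrib)
    then show ?thesis unfolding V_def mem_Collect_eq by (intro exI)
  qed
  have V_cheb: "smult c (chebyshev k) \<in> V" if "k \<le> Suc d" for c k
  proof -
    have "smult c (chebyshev k) = (\<Sum>j\<le>Suc d. if j = k then smult c (chebyshev k) else 0)"
      using that by (simp add: sum.delta)
    also have "\<dots> = (\<Sum>j\<le>Suc d. smult ((\<lambda>j. if j = k then c else 0) j) (chebyshev j))"
      by (rule sum.cong) auto
    finally show ?thesis unfolding V_def mem_Collect_eq by (intro exI)
  qed
  have V_sum: "(\<Sum>k\<in>S. f k) \<in> V" if "finite S" "\<And>k. k \<in> S \<Longrightarrow> f k \<in> V" for S :: "nat set" and f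
    using that
  proof (induction S)
    case empty
    then show ?case using V_cheb[of 0 0] by simp
  qed (simp add: V_add)
  have "[:0, 1:] * smult c (chebyshev k) \<in> V" if "k \<le> d" for c k
  proof (cases k)
    case 0
    then show ?thesis using V_cheb[of 1 c] that by simp
  next
    case (Suc m)
    have "[:0, 1:] * smult c (chebyshev k) = smult c ([:0, 1:] * chebyshev (Suc m))"
      using Suc by simp
    also have "\<dots> = smult (c/2) (chebyshev (Suc (Suc m))) + smult (c/2) (chebyshev m)"
      unfolding chebyshev_mult_X by (simp add: smult_add_right)
    also have "\<dots> \<in> V" using Suc that by (intro V_add V_cheb) auto
    finally show ?thesis .
  qed
  then have "[:0, 1:] * r \<in> V"
    unfolding r sum_distrib_left by (intro V_sum) auto
  moreover have "[:c:] \<in> V" using V_cheb[of 0 c] by simp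
  moreover have "q = [:c:] + [:0, 1:] * r" using q by simp
  ultimately have "q \<in> V" by (simp only: V_add)
  then show ?case unfolding V_def by blast
qed

lemma sum_cos_roots_of_unity:
  assumes "\<not> int M dvd k" "M > 0"
  shows "(\<Sum>j<M. cos (2 * pi * real j * real_of_int k / real M)) = 0"
proof -
  define z where "z = cis (2 * pi * real_of_int k / real M)"
  have zM: "z ^ M = 1"
  proof -
    have "z ^ M = cis (real M * (2 * pi * real_of_int k / real M))"
      unfolding z_def by (rule Complex.DeMoivre)
    also have "real M * (2 * pi * real_of_int k / real M) = 2 * pi * real_of_int k"
      using assms by simp
    finally show ?thesis by (simp add: cis_multiple_2pi)
  qed
  have z1: "z \<noteq> 1"
  proof
    assume "z = 1"
    then have "cos (2 * pi * real_of_int k / real M) = 1"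
      unfolding z_def by (metis cis.simps(1) one_complex.simps(1))
    then obtain n :: int where "2 * pi * real_of_int k / real M = real_of_int n * 2 * pi"
      using cos_one_2pi_int by blast
    then have "real_of_int k = real_of_int n * real M" using assms by (simp add: field_simps)
    then have "k = n * int M" by (metis of_int_eq_iff of_int_mult of_int_of_nat_eq)
    with assms show False by simp
  qed
  have "(\<Sum>j<M. z ^ j) = 0" using z1 zM by (simp add: geometric_sum)
  then have "0 = (\<Sum>j<M. Re (z ^ j))" by (metis Re_sum zero_complex.simps(1))
  also have "\<dots> = (\<Sum>j<M. cos (2 * pi * real j * real_of_int k / real M))"
    unfolding z_def Complex.DeMoivre by (simp add: algebra_simps)
  finally show ?thesis by simp
qed

lemma chebyshev_coefficient_bound:
  assumes q: "q = (\<Sum>k\<le>d. smult (\<alpha> k) (chebyshev k))"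
    and B: "\<And>t. \<bar>t\<bar> \<le> 1 \<Longrightarrow> \<bar>poly q t\<bar> \<le> B" and l: "l \<le> d"
  shows "\<bar>\<alpha> l\<bar> \<le> 2 * B"
proof -
  \<comment> \<open>More than \<open>2 d\<close> sample points, so that the cosines of frequency at most \<open>d\<close> are orthogonal.\<close>
  define M where "M = 2 * d + 1"
  define \<theta> where "\<theta> j = 2 * pi * real j / real M" for j :: nat
  have Mpos: "M > 0" unfolding M_def by simp
  have B0: "B \<ge> 0" using B[of 0] by simp
  have prod: "cos (real k * \<theta> j) * cos (real l * \<theta> j) =
      (cos (2 * pi * real j * real_of_int (int k - int l) / real M)
       + cos (2 * pi * real j * real_of_int (int k + int l) / real M)) / 2" for k j
    unfolding cos_times_cos \<theta>_def by (simp add: algebra_simps diff_divide_distrib add_divide_distrib)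
  have orth: "(\<Sum>j<M. cos (real k * \<theta> j) * cos (real l * \<theta> j)) =
      (if k = l then (if l = 0 then real M else real M / 2) else 0)" if k: "k \<le> d" for k
  proof -
    have 1: "(\<Sum>j<M. cos (2 * pi * real j * real_of_int (int k - int l) / real M)) =
        (if k = l then real M else 0)"
    proof (cases "k = l")
      case False
      have "\<not> int M dvd (int k - int l)"
        using zdvd_not_zless[of "\<bar>int k - int l\<bar>" "int M"] False k l unfolding M_def by auto
      from sum_cos_roots_of_unity[OF this Mpos] show ?thesis using False by simp
    qed simp
    have 2: "(\<Sum>j<M. cos (2 * pi * real j * real_of_int (int k + int l) / real M)) =
        (if k = 0 \<and> l = 0 then real M else 0)"
    proof (cases "k = 0 \<and> l = 0")
      case False
      have "\<not> int M dvd (int k + int l)"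
        using zdvd_not_zless[of "int k + int l" "int M"] False k l unfolding M_def by auto
      from sum_cos_roots_of_unity[OF this Mpos] show ?thesis by (simp only: False if_False)
    qed simp
    show ?thesis
      unfolding prod sum_divide_distrib[symmetric] sum.distrib 1 2 by auto
  qed
  have "(\<Sum>j<M. poly q (cos (\<theta> j)) * cos (real l * \<theta> j)) =
      (\<Sum>j<M. \<Sum>k\<le>d. \<alpha> k * (cos (real k * \<theta> j) * cos (real l * \<theta> j)))"
    by (simp add: q poly_sum poly_chebyshev sum_distrib_right mult.assoc)
  also have "\<dots> = (\<Sum>k\<le>d. \<alpha> k * (\<Sum>j<M. cos (real k * \<theta> j) * cos (real l * \<theta> j)))"
    by (subst sum.swap) (simp add: sum_distrib_left)
  also have "\<dots> = (\<Sum>k\<le>d. if k = l then \<alpha> l * (if l = 0 then real M else real M / 2) else 0)"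
    by (rule sum.cong) (auto simp: orth)
  also have "\<dots> = \<alpha> l * (if l = 0 then real M else real M / 2)"
    using l by simp
  finally have eq: "\<alpha> l * (if l = 0 then real M else real M / 2) =
      (\<Sum>j<M. poly q (cos (\<theta> j)) * cos (real l * \<theta> j))" by simp
  have "\<bar>\<Sum>j<M. poly q (cos (\<theta> j)) * cos (real l * \<theta> j)\<bar> \<le> (\<Sum>j<M. B)"
  proof (rule order_trans[OF sum_abs sum_mono])
    fix j
    have "\<bar>poly q (cos (\<theta> j))\<bar> * \<bar>cos (real l * \<theta> j)\<bar> \<le> B * 1"
      using B0 by (intro mult_mono B abs_cos_le_one) auto
    then show "\<bar>poly q (cos (\<theta> j)) * cos (real l * \<theta> j)\<bar> \<le> B" by (simp add: abs_mult)
  qed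
  then have *: "\<bar>\<alpha> l * (if l = 0 then real M else real M / 2)\<bar> \<le> real M * B"
    unfolding eq by simp
  have "\<bar>\<alpha> l\<bar> * (real M / 2) \<le> \<bar>\<alpha> l * (if l = 0 then real M else real M / 2)\<bar>"
    unfolding abs_mult by (intro mult_left_mono) auto
  also note *
  finally show ?thesis using Mpos by (simp add: field_simps)
qed

context poly_seminorm
begin

lemma N_X_square: "N ([:0, 1:]\<^sup>2) \<le> 1"
  using N_power[of "[:0,1:]" 2] power_mono[OF N_X N_nonneg, of 2] by simp

lemma N_sqrt_poly: "N (sqrt_poly n) \<le> sqrt_bound n"
proof (induction n)
  case 0
  then show ?case by (simp add: N_zero)
next
  case (Suc n)
  have "N ((sqrt_poly n)\<^sup>2) \<le> (sqrt_bound n)\<^sup>2"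
    using N_power[of "sqrt_poly n" 2] power_mono[OF Suc N_nonneg, of 2] by simp
  then have "N ([:0, 1:]\<^sup>2 + (sqrt_poly n)\<^sup>2) \<le> 1 + (sqrt_bound n)\<^sup>2"
    using N_add[of "[:0, 1:]\<^sup>2" "(sqrt_poly n)\<^sup>2"] N_X_square by simp
  then show ?case
    using N_smult[of "1/2" "[:0, 1:]\<^sup>2 + (sqrt_poly n)\<^sup>2"] by simp
qed

lemma N_sqrt_poly_step:
  "N (sqrt_poly (Suc n) - sqrt_poly n) \<le> sqrt_bound (Suc n) - sqrt_bound n"
proof (induction n)
  case 0
  show ?case using N_sqrt_poly[of "Suc 0"] by simp
next
  case (Suc n)
  define u where "u = sqrt_poly (Suc n)"
  define v where "v = sqrt_poly n"
  define x where "x = sqrt_bound (Suc n)"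
  define y where "y = sqrt_bound n"
  have "sqrt_poly (Suc (Suc n)) - sqrt_poly (Suc n) = smult (1/2) (u\<^sup>2 - v\<^sup>2)"
    unfolding u_def v_def sqrt_poly.simps(2)[of "Suc n"]
    by (simp only: sqrt_poly.simps(2)[of n] smult_diff_right smult_add_right)
  also have "u\<^sup>2 - v\<^sup>2 = (u - v) * (u + v)" by algebra
  finally have "N (sqrt_poly (Suc (Suc n)) - sqrt_poly (Suc n)) \<le> 1/2 * N ((u - v) * (u + v))"
    using N_smult[of "1/2"] by simp
  also have "\<dots> \<le> 1/2 * ((x - y) * (x + y))"
  proof -
    have "N ((u - v) * (u + v)) \<le> N (u - v) * N (u + v)" by (rule N_mult)
    also have "\<dots> \<le> (x - y) * (x + y)"
      using Suc N_add[of u v] N_sqrt_poly[of n] N_sqrt_poly[of "Suc n"] N_nonneg sqrt_bound_incr[of n]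
      unfolding u_def[symmetric] v_def[symmetric] x_def[symmetric] y_def[symmetric]
      by (intro mult_mono) auto
    finally show ?thesis by simp
  qed
  also have "\<dots> = sqrt_bound (Suc (Suc n)) - sqrt_bound (Suc n)"
    unfolding sqrt_bound.simps(2)[of "Suc n"] x_def[symmetric]
    by (simp add: x_def y_def field_simps power2_eq_square)
  finally show ?case .
qed

lemma sqrt_poly_defect:
  "[:0, 1:]\<^sup>2 + (1 - sqrt_poly j)\<^sup>2 = 1 + smult 2 (sqrt_poly (Suc j) - sqrt_poly j)"
proof -
  have "smult 2 (sqrt_poly (Suc j) - sqrt_poly j) = [:0, 1:]\<^sup>2 + (sqrt_poly j)\<^sup>2 - 2 * sqrt_poly j"
    by (simp add: smult_diff_right numeral_poly del: power2_eq_square)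
  then show ?thesis by (simp add: power2_eq_square algebra_simps)
qed

text \<open>With \<open>s = 1 - sqrt_poly j\<close>, the real part of \<open>(t + i s)\<^sup>n\<close> tends to the \<open>n\<close>-th Chebyshev
  polynomial as \<open>j\<close> grows, and its seminorm is bounded through \<open>t\<^sup>2 + s\<^sup>2\<close>, which tends to \<open>1\<close>.\<close>

lemma N_chebyshev: "N (chebyshev n) \<le> 1"
proof -
  define \<rho> where "\<rho> j = [:0, 1:]\<^sup>2 + (1 - sqrt_poly j)\<^sup>2" for j
  define \<eta> where "\<eta> j = 2 * (sqrt_bound (Suc j) - sqrt_bound j)" for j
  define A where "A j n = fst (re_im_power (1 - sqrt_poly j) n)" for j n
  have eta: "\<eta> \<longlonglongrightarrow> 0"
    using tendsto_mult_left[OF sqrt_bound_step, of 2] unfolding \<eta>_def by simp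
  have eta0: "\<eta> j \<ge> 0" for j unfolding \<eta>_def using sqrt_bound_incr[of j] by simp
  have rho: "N (\<rho> j - 1) \<le> \<eta> j" for j
    using N_smult[of 2 "sqrt_poly (Suc j) - sqrt_poly j"] N_sqrt_poly_step[of j]
    unfolding \<rho>_def sqrt_poly_defect \<eta>_def
    by (simp del: sqrt_poly.simps sqrt_bound.simps)
  have rho1: "N (\<rho> j) \<le> 1 + \<eta> j" for j
    using N_add[of 1 "\<rho> j - 1"] N_one rho[of j] by simp
  have A_bound: "(N (A j n))\<^sup>2 \<le> (1 + \<eta> j) ^ n" for j n
  proof -
    have "(N (A j n))\<^sup>2 \<le> N ((A j n)\<^sup>2)" by (rule N_square)
    also have "\<dots> \<le> N (\<rho> j ^ n)"
      using N_sum_squares[of "A j n" "snd (re_im_power (1 - sqrt_poly j) n)"]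
      unfolding A_def re_im_power_norm \<rho>_def .
    also have "\<dots> \<le> N (\<rho> j) ^ n" by (rule N_power)
    also have "\<dots> \<le> (1 + \<eta> j) ^ n" using rho1 N_nonneg by (intro power_mono) auto
    finally show ?thesis .
  qed
  have A_bound': "N (A j n) \<le> 1 + (1 + \<eta> j) ^ n" for j n
  proof -
    have "2 * N (A j n) \<le> 1 + (N (A j n))\<^sup>2" using sum_squares_bound[of "N (A j n)" 1] by simp
    then have "N (A j n) \<le> 1 + (N (A j n))\<^sup>2" using N_nonneg[of "A j n"] by linarith
    then show ?thesis using A_bound[of j n] by linarith
  qed
  have N2X: "N [:0, 2:] \<le> 2" using N_smult[of 2 "[:0,1:]"] N_X by simp
  have conv: "(\<lambda>j. N (A j n - chebyshev n)) \<longlonglongrightarrow> 0" for n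
  proof (induction n rule: chebyshev.induct)
    case 1
    show ?case by (simp add: A_def N_zero)
  next
    case 2
    have "A j (Suc 0) - chebyshev (Suc 0) = 0" for j
      unfolding A_def by (simp flip: one_pCons)
    then show ?case by (simp only: N_zero tendsto_const)
  next
    case (3 n)
    have bound: "N (A j (Suc (Suc n)) - chebyshev (Suc (Suc n))) \<le>
        2 * N (A j (Suc n) - chebyshev (Suc n)) + N (A j n - chebyshev n)
          + \<eta> j * (1 + (1 + \<eta> j) ^ n)" for j
    proof -
      have *: "A j (Suc (Suc n)) - chebyshev (Suc (Suc n)) =
          [:0, 2:] * (A j (Suc n) - chebyshev (Suc n)) - (A j n - chebyshev n) - (\<rho> j - 1) * A j n"
        unfolding A_def re_im_power_rec chebyshev.simps(3) \<rho>_def[symmetric]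
        by (simp only: algebra_simps)
      have "N ([:0, 2:] * (A j (Suc n) - chebyshev (Suc n))) \<le> 2 * N (A j (Suc n) - chebyshev (Suc n))"
        by (rule order_trans[OF N_mult]) (intro mult_right_mono N2X N_nonneg)
      moreover have "N ((\<rho> j - 1) * A j n) \<le> \<eta> j * (1 + (1 + \<eta> j) ^ n)"
        by (rule order_trans[OF N_mult]) (intro mult_mono rho A_bound' N_nonneg eta0)
      ultimately show ?thesis
        unfolding * using N_diff[of "[:0, 2:] * (A j (Suc n) - chebyshev (Suc n)) - (A j n - chebyshev n)" "(\<rho> j - 1) * A j n"]
          N_diff[of "[:0, 2:] * (A j (Suc n) - chebyshev (Suc n))" "A j n - chebyshev n"] by linarith
    qed
    have "(\<lambda>j. 2 * N (A j (Suc n) - chebyshev (Suc n)) + N (A j n - chebyshev n)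
          + \<eta> j * (1 + (1 + \<eta> j) ^ n)) \<longlonglongrightarrow> 2 * 0 + 0 + 0 * (1 + (1 + 0) ^ n)"
      by (intro tendsto_intros 3 eta)
    then have lim: "(\<lambda>j. 2 * N (A j (Suc n) - chebyshev (Suc n)) + N (A j n - chebyshev n)
          + \<eta> j * (1 + (1 + \<eta> j) ^ n)) \<longlonglongrightarrow> 0" by simp
    show ?case
      by (rule tendsto_sandwich[OF _ _ tendsto_const lim])
        (rule always_eventually, rule allI, rule N_nonneg bound)+
  qed
  have "N (chebyshev n) \<le> sqrt ((1 + \<eta> j) ^ n) + N (A j n - chebyshev n)" for j
  proof -
    have "N (A j n) \<le> sqrt ((1 + \<eta> j) ^ n)" using A_bound by (rule real_le_rsqrt)
    then show ?thesis using N_diff[of "A j n" "A j n - chebyshev n"] by simp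
  qed
  moreover have "(\<lambda>j. sqrt ((1 + \<eta> j) ^ n) + N (A j n - chebyshev n)) \<longlonglongrightarrow> sqrt ((1 + 0) ^ n) + 0"
    by (intro tendsto_intros conv eta)
  ultimately show ?thesis
    using LIMSEQ_le_const[of _ "sqrt ((1 + 0) ^ n) + 0" "N (chebyshev n)"] by auto
qed

lemma N_le_degree_sup:
  assumes "\<And>t. \<bar>t\<bar> \<le> 1 \<Longrightarrow> \<bar>poly q t\<bar> \<le> B"
  shows "N q \<le> real (degree q + 1) * (2 * B)"
proof -
  obtain \<alpha> where \<alpha>: "q = (\<Sum>k\<le>degree q. smult (\<alpha> k) (chebyshev k))"
    using chebyshev_expansion[of q "degree q"] by auto
  have "N q \<le> (\<Sum>k\<le>degree q. N (smult (\<alpha> k) (chebyshev k)))"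
    by (subst \<alpha>) (rule N_sum)
  also have "\<dots> \<le> (\<Sum>k\<le>degree q. 2 * B)"
  proof (rule sum_mono)
    fix k assume k: "k \<in> {..degree q}"
    have "N (smult (\<alpha> k) (chebyshev k)) \<le> \<bar>\<alpha> k\<bar> * N (chebyshev k)" by (rule N_smult)
    also have "\<dots> \<le> \<bar>\<alpha> k\<bar> * 1" by (intro mult_left_mono N_chebyshev) auto
    also have "\<dots> \<le> 2 * B" using chebyshev_coefficient_bound[OF \<alpha> assms] k by simp
    finally show "N (smult (\<alpha> k) (chebyshev k)) \<le> 2 * B" .
  qed
  also have "\<dots> = real (degree q + 1) * (2 * B)" by simp
  finally show ?thesis .
qed

text \<open>The crude bound above, applied to the powers \<open>q\<^sup>m\<close> with \<open>m = 2\<^sup>k\<close>, loses a factor that is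
  linear in \<open>m\<close>; the C*-identity makes \<open>N (q\<^sup>m) = (N q)\<^sup>m\<close>, so the factor disappears in the limit.\<close>

theorem N_le_sup:
  assumes B: "\<And>t. \<bar>t\<bar> \<le> 1 \<Longrightarrow> \<bar>poly q t\<bar> \<le> B"
  shows "N q \<le> B"
proof (rule ccontr)
  assume "\<not> N q \<le> B"
  then have gt: "B < N q" by simp
  have "0 \<le> B" using B[of 0] by simp
  obtain B' where B': "B < B'" "B' < N q" using gt dense by blast
  define r where "r = N q / B'"
  have B'0: "B' > 0" using B' \<open>0 \<le> B\<close> by linarith
  have r1: "r > 1" unfolding r_def using B' B'0 by simp
  have bound: "r ^ (2 ^ k) \<le> 2 * (real (degree q) * 2 ^ k + 1)" for k
  proof -
    have "N q ^ (2 ^ k) \<le> N (q ^ (2 ^ k))" by (rule N_power_two_power)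
    also have "\<dots> \<le> real (degree (q ^ 2 ^ k) + 1) * (2 * B' ^ (2 ^ k))"
    proof (rule N_le_degree_sup)
      fix t :: real assume "\<bar>t\<bar> \<le> 1"
      then show "\<bar>poly (q ^ 2 ^ k) t\<bar> \<le> B' ^ (2 ^ k)"
        using B[of t] B' by (simp add: power_abs power_mono)
    qed
    also have "\<dots> \<le> (real (degree q) * 2 ^ k + 1) * (2 * B' ^ (2 ^ k))"
    proof (rule mult_right_mono)
      have "real (degree (q ^ 2 ^ k)) \<le> real (degree q * 2 ^ k)"
        by (intro of_nat_mono degree_power_le)
      then show "real (degree (q ^ 2 ^ k) + 1) \<le> real (degree q) * 2 ^ k + 1" by simp
    qed (use B'0 in simp)
    finally show ?thesis unfolding r_def power_divide using B'0 by (simp add: field_simps)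
  qed
  have "(\<lambda>m. (2 * (real (degree q) * real m + 1)) / r ^ m) \<longlonglongrightarrow> 0"
  proof -
    have "(\<lambda>m. real m * (1/r) ^ m) \<longlonglongrightarrow> 0"
      using r1 by (intro powser_times_n_limit_0) (auto simp: field_simps)
    moreover have "(\<lambda>m. (1/r) ^ m) \<longlonglongrightarrow> 0" using r1 by (intro LIMSEQ_power_zero) auto
    ultimately have "(\<lambda>m. 2 * real (degree q) * (real m * (1/r) ^ m) + 2 * (1/r) ^ m)
        \<longlonglongrightarrow> 2 * real (degree q) * 0 + 2 * 0"
      by (rule tendsto_add[OF tendsto_mult_left tendsto_mult_left])
    then show ?thesis by (simp add: power_divide add_divide_distrib distrib_left mult.assoc)
  qed
  then have "\<forall>\<^sub>F m in sequentially. (2 * (real (degree q) * real m + 1)) / r ^ m < 1"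
    by (rule order_tendstoD) simp
  then obtain m0 where m0: "\<And>m. m \<ge> m0 \<Longrightarrow> (2 * (real (degree q) * real m + 1)) / r ^ m < 1"
    unfolding eventually_sequentially by blast
  have "m0 \<le> 2 ^ m0" using less_exp[of m0] by simp
  then have "(2 * (real (degree q) * real (2 ^ m0) + 1)) / r ^ (2 ^ m0) < 1" by (rule m0)
  then show False using bound[of m0] r1 by (simp add: field_simps)
qed

end

text \<open>Polynomial approximations that vanish at zero, as polynomials in an element of a
  non-unital algebra should.\<close>

lemma weierstrass_vanishing_at_zero:
  fixes f :: "real \<Rightarrow> real"
  assumes f: "continuous_on {-R..R} f" "f 0 = 0" and "R \<ge> 0" "e > 0"
  shows "\<exists>q. \<forall>t. \<bar>t\<bar> \<le> R \<longrightarrow> \<bar>f t - poly (pCons 0 q) t\<bar> < e"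
proof -
  obtain g where g: "real_polynomial_function g" "\<And>x. x \<in> {-R..R} \<Longrightarrow> \<bar>f x - g x\<bar> < e / 2"
    using Stone_Weierstrass_real_polynomial_function[of "{-R..R}" f "e/2"] assms by auto
  obtain a n where a: "g = (\<lambda>x. \<Sum>i\<le>n. a i * x ^ i)"
    using g(1) real_polynomial_function_iff_sum by blast
  define p where "p = (\<Sum>i\<le>n. monom (a i) i)"
  have p: "poly p x = g x" for x unfolding p_def a by (simp add: poly_sum poly_monom)
  obtain c q where q: "p = pCons c q" by (cases p)
  have "\<bar>f t - poly (pCons 0 q) t\<bar> < e" if "\<bar>t\<bar> \<le> R" for t
  proof -
    have "poly (pCons 0 q) t = g t - g 0" using p[of t] p[of 0] q by simp
    moreover have "\<bar>f t - g t\<bar> < e / 2" "\<bar>f 0 - g 0\<bar> < e / 2"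
      using g(2)[of t] g(2)[of 0] that assms(3) by (simp_all add: abs_le_iff)
    ultimately show ?thesis using f(2) by linarith
  qed
  then show ?thesis by blast
qed

section \<open>*-algebras with a C*-seminorm\<close>

notation alg_zero ("\<zero>\<index>")
notation alg_add (infixl "\<oplus>\<index>" 65)
notation alg_diff (infixl "\<ominus>\<index>" 65)
notation alg_mult (infixl "\<otimes>\<index>" 70)
notation alg_scale (infixr "\<odot>\<index>" 75)
notation alg_star ("_\<dagger>\<index>" [1000] 1000)

text \<open>Algebras on a carrier set, because the C*-algebra of a Fell bundle depends on the bundle and is not a
  type of its own. The zero axiom \<open>0 \<odot> x = \<zero>\<close> makes \<open>(-1) \<odot> x\<close> the additive inverse.\<close>

locale star_alg =
  fixes D :: "('a, 'z) star_algebra_scheme" (structure)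
  assumes zero_closed [simp]: "\<zero> \<in> alg_carrier D"
    and add_closed [simp]: "\<lbrakk>x \<in> alg_carrier D; y \<in> alg_carrier D\<rbrakk> \<Longrightarrow> x \<oplus> y \<in> alg_carrier D"
    and scale_closed [simp]: "x \<in> alg_carrier D \<Longrightarrow> c \<odot> x \<in> alg_carrier D"
    and mult_closed [simp]: "\<lbrakk>x \<in> alg_carrier D; y \<in> alg_carrier D\<rbrakk> \<Longrightarrow> x \<otimes> y \<in> alg_carrier D"
    and star_closed [simp]: "x \<in> alg_carrier D \<Longrightarrow> x\<dagger> \<in> alg_carrier D"
    and add_assoc: "\<lbrakk>x \<in> alg_carrier D; y \<in> alg_carrier D; z \<in> alg_carrier D\<rbrakk> \<Longrightarrow>
          x \<oplus> y \<oplus> z = x \<oplus> (y \<oplus> z)"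
    and add_commute: "\<lbrakk>x \<in> alg_carrier D; y \<in> alg_carrier D\<rbrakk> \<Longrightarrow> x \<oplus> y = y \<oplus> x"
    and add_zero [simp]: "x \<in> alg_carrier D \<Longrightarrow> x \<oplus> \<zero> = x"
    and scale_zero_left [simp]: "x \<in> alg_carrier D \<Longrightarrow> 0 \<odot> x = \<zero>"
    and scale_one [simp]: "x \<in> alg_carrier D \<Longrightarrow> 1 \<odot> x = x"
    and scale_scale [simp]: "x \<in> alg_carrier D \<Longrightarrow> c \<odot> d \<odot> x = (c * d) \<odot> x"
    and scale_add_right: "\<lbrakk>x \<in> alg_carrier D; y \<in> alg_carrier D\<rbrakk> \<Longrightarrow>
          c \<odot> (x \<oplus> y) = c \<odot> x \<oplus> c \<odot> y"
    and scale_add_left: "x \<in> alg_carrier D \<Longrightarrow> (c + d) \<odot> x = c \<odot> x \<oplus> d \<odot> x"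
    and mult_assoc: "\<lbrakk>x \<in> alg_carrier D; y \<in> alg_carrier D; z \<in> alg_carrier D\<rbrakk> \<Longrightarrow>
          x \<otimes> y \<otimes> z = x \<otimes> (y \<otimes> z)"
    and mult_add_left: "\<lbrakk>x \<in> alg_carrier D; y \<in> alg_carrier D; z \<in> alg_carrier D\<rbrakk> \<Longrightarrow>
          (x \<oplus> y) \<otimes> z = x \<otimes> z \<oplus> y \<otimes> z"
    and mult_add_right: "\<lbrakk>x \<in> alg_carrier D; y \<in> alg_carrier D; z \<in> alg_carrier D\<rbrakk> \<Longrightarrow>
          x \<otimes> (y \<oplus> z) = x \<otimes> y \<oplus> x \<otimes> z"
    and mult_scale_left [simp]: "\<lbrakk>x \<in> alg_carrier D; y \<in> alg_carrier D\<rbrakk> \<Longrightarrow>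
          (c \<odot> x) \<otimes> y = c \<odot> (x \<otimes> y)"
    and mult_scale_right [simp]: "\<lbrakk>x \<in> alg_carrier D; y \<in> alg_carrier D\<rbrakk> \<Longrightarrow>
          x \<otimes> (c \<odot> y) = c \<odot> (x \<otimes> y)"
    and star_add: "\<lbrakk>x \<in> alg_carrier D; y \<in> alg_carrier D\<rbrakk> \<Longrightarrow> (x \<oplus> y)\<dagger> = x\<dagger> \<oplus> y\<dagger>"
    and star_scale: "x \<in> alg_carrier D \<Longrightarrow> (c \<odot> x)\<dagger> = cnj c \<odot> x\<dagger>"
    and star_mult: "\<lbrakk>x \<in> alg_carrier D; y \<in> alg_carrier D\<rbrakk> \<Longrightarrow> (x \<otimes> y)\<dagger> = y\<dagger> \<otimes> x\<dagger>"
    and star_star [simp]: "x \<in> alg_carrier D \<Longrightarrow> x\<dagger>\<dagger> = x"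
begin

abbreviation "C \<equiv> alg_carrier D"

lemma add_left_commute: "\<lbrakk>x \<in> C; y \<in> C; z \<in> C\<rbrakk> \<Longrightarrow> x \<oplus> (y \<oplus> z) = y \<oplus> (x \<oplus> z)"
  by (metis add_assoc add_commute)

lemmas add_ac = add_assoc add_commute add_left_commute

lemma zero_add [simp]: "x \<in> C \<Longrightarrow> \<zero> \<oplus> x = x"
  by (simp add: add_commute)

lemma scale_zero_right [simp]: "c \<odot> \<zero> = \<zero>"
  by (metis mult_zero_right scale_scale scale_zero_left zero_closed)

lemma mult_zero_left [simp]: "x \<in> C \<Longrightarrow> \<zero> \<otimes> x = \<zero>"
  by (metis mult_closed mult_scale_left scale_zero_left zero_closed)

lemma mult_zero_right [simp]: "x \<in> C \<Longrightarrow> x \<otimes> \<zero> = \<zero>"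
  by (metis mult_closed mult_scale_right scale_zero_left zero_closed)

lemma star_zero [simp]: "\<zero>\<dagger> = \<zero>"
  by (metis complex_cnj_zero scale_zero_left star_closed star_scale zero_closed)

lemma diff_closed [simp]: "\<lbrakk>x \<in> C; y \<in> C\<rbrakk> \<Longrightarrow> x \<ominus> y \<in> C"
  by (simp add: alg_diff_def)

lemma add_neg [simp]: "x \<in> C \<Longrightarrow> x \<oplus> (-1) \<odot> x = \<zero>"
  using scale_add_left[of x 1 "-1"] by simp

lemma neg_add [simp]: "x \<in> C \<Longrightarrow> (-1) \<odot> x \<oplus> x = \<zero>"
  by (simp add: add_commute)

lemma neg_add_cancel [simp]: "\<lbrakk>x \<in> C; y \<in> C\<rbrakk> \<Longrightarrow> (-1) \<odot> x \<oplus> (x \<oplus> y) = y"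
  by (simp flip: add_assoc)

lemma diff_self [simp]: "x \<in> C \<Longrightarrow> x \<ominus> x = \<zero>"
  by (simp add: alg_diff_def)

lemma diff_zero [simp]: "x \<in> C \<Longrightarrow> x \<ominus> \<zero> = x"
  by (simp add: alg_diff_def)

lemma diff_add_cancel: "\<lbrakk>x \<in> C; y \<in> C\<rbrakk> \<Longrightarrow> (x \<ominus> y) \<oplus> y = x"
  by (simp add: alg_diff_def add_assoc)

lemma diff_eq_zero: "\<lbrakk>x \<in> C; y \<in> C\<rbrakk> \<Longrightarrow> x \<ominus> y = \<zero> \<longleftrightarrow> x = y"
  by (metis diff_add_cancel diff_self zero_add)

lemma diff_diff_split: "\<lbrakk>x \<in> C; y \<in> C; z \<in> C\<rbrakk> \<Longrightarrow> x \<ominus> z = (x \<ominus> y) \<oplus> (y \<ominus> z)"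
  by (simp add: alg_diff_def add_assoc)

lemma add_diff_add: "\<lbrakk>x \<in> C; y \<in> C; z \<in> C; w \<in> C\<rbrakk> \<Longrightarrow>
    (x \<oplus> y) \<ominus> (z \<oplus> w) = (x \<ominus> z) \<oplus> (y \<ominus> w)"
  by (simp add: alg_diff_def scale_add_right add_ac)

lemma scale_diff: "\<lbrakk>x \<in> C; y \<in> C\<rbrakk> \<Longrightarrow> c \<odot> (x \<ominus> y) = c \<odot> x \<ominus> c \<odot> y"
  by (simp add: alg_diff_def scale_add_right)

lemma mult_diff_left: "\<lbrakk>x \<in> C; y \<in> C; z \<in> C\<rbrakk> \<Longrightarrow> (x \<ominus> y) \<otimes> z = x \<otimes> z \<ominus> y \<otimes> z"
  by (simp add: alg_diff_def mult_add_left)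

lemma mult_diff_right: "\<lbrakk>x \<in> C; y \<in> C; z \<in> C\<rbrakk> \<Longrightarrow> z \<otimes> (x \<ominus> y) = z \<otimes> x \<ominus> z \<otimes> y"
  by (simp add: alg_diff_def mult_add_right)

lemma star_diff: "\<lbrakk>x \<in> C; y \<in> C\<rbrakk> \<Longrightarrow> (x \<ominus> y)\<dagger> = x\<dagger> \<ominus> y\<dagger>"
  by (simp add: alg_diff_def star_add star_scale)

lemma neg_diff: "\<lbrakk>x \<in> C; y \<in> C\<rbrakk> \<Longrightarrow> (-1) \<odot> (x \<ominus> y) = y \<ominus> x"
  by (simp add: alg_diff_def scale_add_right add_commute)

end

text \<open>The seminorm is a parameter besides the record, because several C*-seminorms on one section algebra
  have to be compared.\<close>

locale cstar_seminormed = star_alg D for D :: "('a, 'z) star_algebra_scheme" (structure) +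
  fixes p :: "'a \<Rightarrow> real"
  assumes seminorm: "cstar_seminorm D p"
begin

lemma p_nonneg [simp]: "x \<in> C \<Longrightarrow> 0 \<le> p x"
  using seminorm unfolding cstar_seminorm_def by blast

lemma p_add: "\<lbrakk>x \<in> C; y \<in> C\<rbrakk> \<Longrightarrow> p (x \<oplus> y) \<le> p x + p y"
  using seminorm unfolding cstar_seminorm_def by blast

lemma p_scale: "x \<in> C \<Longrightarrow> p (c \<odot> x) = cmod c * p x"
  using seminorm unfolding cstar_seminorm_def by blast

lemma p_mult: "\<lbrakk>x \<in> C; y \<in> C\<rbrakk> \<Longrightarrow> p (x \<otimes> y) \<le> p x * p y"
  using seminorm unfolding cstar_seminorm_def by blast

lemma p_star_mult: "x \<in> C \<Longrightarrow> p (x\<dagger> \<otimes> x) = (p x)\<^sup>2"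
  using seminorm unfolding cstar_seminorm_def by blast

lemma p_zero [simp]: "p \<zero> = 0"
  using p_scale[of \<zero> 0] by simp

lemma p_neg: "x \<in> C \<Longrightarrow> p ((-1) \<odot> x) = p x"
  by (simp add: p_scale)

lemma p_diff_commute: "\<lbrakk>x \<in> C; y \<in> C\<rbrakk> \<Longrightarrow> p (x \<ominus> y) = p (y \<ominus> x)"
  using p_neg[of "x \<ominus> y"] by (simp add: neg_diff)

lemma p_triangle: "\<lbrakk>x \<in> C; y \<in> C; z \<in> C\<rbrakk> \<Longrightarrow> p (x \<ominus> z) \<le> p (x \<ominus> y) + p (y \<ominus> z)"
  using p_add[of "x \<ominus> y" "y \<ominus> z"] by (simp add: diff_diff_split[of x y z])

lemma p_le_diff: "\<lbrakk>x \<in> C; y \<in> C\<rbrakk> \<Longrightarrow> p x \<le> p y + p (x \<ominus> y)"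
  using p_add[of "x \<ominus> y" y] by (simp add: diff_add_cancel)

lemma p_abs_diff: "\<lbrakk>x \<in> C; y \<in> C\<rbrakk> \<Longrightarrow> \<bar>p x - p y\<bar> \<le> p (x \<ominus> y)"
  using p_le_diff[of x y] p_le_diff[of y x] p_diff_commute[of x y] by auto

lemma p_star [simp]:
  assumes x: "x \<in> C"
  shows "p (x\<dagger>) = p x"
proof -
  have le: "p y \<le> p (y\<dagger>)" if y: "y \<in> C" for y
  proof (cases "p y = 0")
    case False
    have "(p y)\<^sup>2 \<le> p (y\<dagger>) * p y" using p_mult[of "y\<dagger>" y] y by (simp add: p_star_mult)
    then show ?thesis using False p_nonneg[OF y] by (simp add: power2_eq_square)
  qed (use y in simp)
  show ?thesis using le[of x] le[of "x\<dagger>"] x by (simp add: order_antisym)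
qed

subsection \<open>Polynomials in a self-adjoint element\<close>

text \<open>The action of \<open>q(a)\<close> on \<open>y\<close> by left multiplication. Acting on vectors gives a meaning to the
  constant term of \<open>q\<close> although the algebra may have no unit.\<close>

definition poly_act :: "'a \<Rightarrow> real poly \<Rightarrow> 'a \<Rightarrow> 'a" where
  "poly_act a q y = fold_coeffs (\<lambda>c z. complex_of_real c \<odot> y \<oplus> a \<otimes> z) q \<zero>"

lemma poly_act_0 [simp]: "poly_act a 0 y = \<zero>"
  by (simp add: poly_act_def)

lemma poly_act_pCons [simp]:
  assumes "a \<in> C" "y \<in> C"
  shows "poly_act a (pCons c q) y = complex_of_real c \<odot> y \<oplus> a \<otimes> poly_act a q y"
  using assms by (cases "c = 0 \<and> q = 0") (auto simp: poly_act_def)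

lemma poly_act_closed [simp]: "\<lbrakk>a \<in> C; y \<in> C\<rbrakk> \<Longrightarrow> poly_act a q y \<in> C"
  by (induction q) auto

lemma poly_act_1 [simp]: "\<lbrakk>a \<in> C; y \<in> C\<rbrakk> \<Longrightarrow> poly_act a 1 y = y"
  by (simp add: one_pCons)

lemma poly_act_add_poly:
  assumes "a \<in> C" "y \<in> C"
  shows "poly_act a (q + r) y = poly_act a q y \<oplus> poly_act a r y"
  using assms
proof (induction q arbitrary: r)
  case (pCons c q)
  obtain d s where "r = pCons d s" by (cases r)
  with pCons show ?case by (simp add: scale_add_left mult_add_right add_ac)
qed simp

lemma poly_act_smult:
  assumes "a \<in> C" "y \<in> C"
  shows "poly_act a (smult c q) y = complex_of_real c \<odot> poly_act a q y"
  using assms by (induction q) (auto simp: scale_add_right)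

lemma poly_act_diff_poly:
  assumes "a \<in> C" "y \<in> C"
  shows "poly_act a (q - r) y = poly_act a q y \<ominus> poly_act a r y"
  using poly_act_add_poly[OF assms, of q "smult (-1) r"] poly_act_smult[OF assms, of "-1" r]
  by (simp add: alg_diff_def)

lemma poly_act_add:
  assumes "a \<in> C" "y \<in> C" "z \<in> C"
  shows "poly_act a q (y \<oplus> z) = poly_act a q y \<oplus> poly_act a q z"
  using assms by (induction q) (auto simp: scale_add_right mult_add_right add_ac)

lemma poly_act_scale:
  assumes "a \<in> C" "y \<in> C"
  shows "poly_act a q (c \<odot> y) = c \<odot> poly_act a q y"
  using assms by (induction q) (auto simp: scale_add_right mult.commute)

lemma poly_act_diff:
  assumes "a \<in> C" "y \<in> C" "z \<in> C"
  shows "poly_act a q (y \<ominus> z) = poly_act a q y \<ominus> poly_act a q z"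
  using assms by (simp add: alg_diff_def poly_act_add poly_act_scale)

lemma poly_act_mult_right:
  assumes "a \<in> C" "y \<in> C" "z \<in> C"
  shows "poly_act a q (y \<otimes> z) = poly_act a q y \<otimes> z"
  using assms by (induction q) (auto simp: mult_add_left mult_assoc)

lemma poly_act_mult_self:
  assumes "a \<in> C" "y \<in> C"
  shows "poly_act a q (a \<otimes> y) = a \<otimes> poly_act a q y"
  using assms by (induction q) (auto simp: mult_add_right)

lemma poly_act_mult_poly:
  assumes "a \<in> C" "y \<in> C"
  shows "poly_act a (q * r) y = poly_act a q (poly_act a r y)"
  using assms
  by (induction q) (auto simp: poly_act_add_poly poly_act_smult)

lemma poly_act_star:
  assumes a: "a \<in> C" "a\<dagger> = a" and "y \<in> C" "z \<in> C"
  shows "(poly_act a q y)\<dagger> \<otimes> z = y\<dagger> \<otimes> poly_act a q z"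
  using assms(3,4)
proof (induction q arbitrary: y z)
  case (pCons c q)
  have "(a \<otimes> poly_act a q y)\<dagger> \<otimes> z = (poly_act a q y)\<dagger> \<otimes> (a \<otimes> z)"
    using pCons.prems a by (simp add: star_mult mult_assoc)
  also have "\<dots> = y\<dagger> \<otimes> (a \<otimes> poly_act a q z)"
    using pCons a by (simp add: poly_act_mult_self)
  finally show ?case using pCons.prems a
    by (simp add: star_add star_scale mult_add_left mult_add_right)
qed simp

lemma poly_act_star_self:
  assumes a: "a \<in> C" "a\<dagger> = a"
  shows "(poly_act a q a)\<dagger> = poly_act a q a"
  using a by (induction q)
    (auto simp: star_add star_scale star_mult poly_act_mult_right[symmetric] poly_act_mult_self)

text \<open>The operator seminorm of \<open>q(a)\<close>.\<close>

definition opnorm :: "'a \<Rightarrow> real poly \<Rightarrow> real" where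
  "opnorm a q = Inf {M. 0 \<le> M \<and> (\<forall>y\<in>C. p (poly_act a q y) \<le> M * p y)}"

lemma poly_act_bounded:
  assumes "a \<in> C"
  shows "\<exists>M\<ge>0. \<forall>y\<in>C. p (poly_act a q y) \<le> M * p y"
proof (induction q)
  case 0
  then show ?case by (intro exI[of _ 0]) simp
next
  case (pCons c q)
  then obtain M where M: "M \<ge> 0" "\<And>y. y \<in> C \<Longrightarrow> p (poly_act a q y) \<le> M * p y" by blast
  have "p (poly_act a (pCons c q) y) \<le> (\<bar>c\<bar> + p a * M) * p y" if y: "y \<in> C" for y
  proof -
    have "p (poly_act a (pCons c q) y) \<le> \<bar>c\<bar> * p y + p (a \<otimes> poly_act a q y)"
      using p_add[of "complex_of_real c \<odot> y" "a \<otimes> poly_act a q y"] assms y by (simp add: p_scale)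
    also have "p (a \<otimes> poly_act a q y) \<le> p a * p (poly_act a q y)"
      using assms y by (intro p_mult) auto
    also have "\<dots> \<le> p a * (M * p y)"
      using M(2)[OF y] assms by (intro mult_left_mono) auto
    finally show ?thesis by (simp add: algebra_simps)
  qed
  then show ?case using M(1) assms by (intro exI[of _ "\<bar>c\<bar> + p a * M"]) auto
qed

lemma opnorm_nonneg: "a \<in> C \<Longrightarrow> 0 \<le> opnorm a q"
  unfolding opnorm_def using poly_act_bounded[of a q] by (intro cInf_greatest) auto

lemma opnorm_le:
  assumes "0 \<le> M" "\<And>y. y \<in> C \<Longrightarrow> p (poly_act a q y) \<le> M * p y"
  shows "opnorm a q \<le> M"
  unfolding opnorm_def using assms by (intro cInf_lower) (auto intro: bdd_belowI)

lemma opnorm_bound: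
  assumes a: "a \<in> C" and y: "y \<in> C"
  shows "p (poly_act a q y) \<le> opnorm a q * p y"
proof (cases "p y = 0")
  case True
  then show ?thesis using poly_act_bounded[OF a, of q] y by fastforce
next
  case False
  then have pos: "p y > 0" using p_nonneg[OF y] by linarith
  have "p (poly_act a q y) / p y \<le> opnorm a q"
    unfolding opnorm_def
  proof (rule cInf_greatest)
    show "{M. 0 \<le> M \<and> (\<forall>y\<in>C. p (poly_act a q y) \<le> M * p y)} \<noteq> {}"
      using poly_act_bounded[OF a, of q] by auto
  qed (use y pos in \<open>auto simp: field_simps\<close>)
  then show ?thesis using pos by (simp add: field_simps)
qed

lemma opnorm_X: "a \<in> C \<Longrightarrow> opnorm a [:0, 1:] \<le> p a"
  by (rule opnorm_le) (auto intro: p_mult)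

lemma opnorm_square:
  assumes a: "a \<in> C" "a\<dagger> = a"
  shows "(opnorm a q)\<^sup>2 \<le> opnorm a (q\<^sup>2)"
proof -
  have "opnorm a q \<le> sqrt (opnorm a (q\<^sup>2))"
  proof (rule opnorm_le)
    fix y assume y: "y \<in> C"
    have "(p (poly_act a q y))\<^sup>2 = p ((poly_act a q y)\<dagger> \<otimes> poly_act a q y)"
      using a y by (intro p_star_mult[symmetric]) simp
    also have "(poly_act a q y)\<dagger> \<otimes> poly_act a q y = y\<dagger> \<otimes> poly_act a q (poly_act a q y)"
      using a y by (intro poly_act_star) auto
    also have "poly_act a q (poly_act a q y) = poly_act a (q\<^sup>2) y"
      unfolding power2_eq_square using a y by (intro poly_act_mult_poly[symmetric])
    finally have "(p (poly_act a q y))\<^sup>2 = p (y\<dagger> \<otimes> poly_act a (q\<^sup>2) y)" .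
    also have "p (y\<dagger> \<otimes> poly_act a (q\<^sup>2) y) \<le> p y * p (poly_act a (q\<^sup>2) y)"
      using p_mult[of "y\<dagger>" "poly_act a (q\<^sup>2) y"] a y by simp
    also have "\<dots> \<le> p y * (opnorm a (q\<^sup>2) * p y)"
      using a y by (intro mult_left_mono opnorm_bound p_nonneg)
    finally have "(p (poly_act a q y))\<^sup>2 \<le> (sqrt (opnorm a (q\<^sup>2)) * p y)\<^sup>2"
      using opnorm_nonneg[OF a(1), of "q\<^sup>2"]
      by (simp add: power_mult_distrib power2_eq_square[of "p y"] mult_ac)
    then show "p (poly_act a q y) \<le> sqrt (opnorm a (q\<^sup>2)) * p y"
      using y a opnorm_nonneg[OF a(1), of "q\<^sup>2"] by - (rule power2_le_imp_le, auto)
  qed (use a opnorm_nonneg in simp)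
  then have "(opnorm a q)\<^sup>2 \<le> (sqrt (opnorm a (q\<^sup>2)))\<^sup>2"
    using opnorm_nonneg[OF a(1)] by (intro power_mono)
  then show ?thesis using opnorm_nonneg[OF a(1), of "q\<^sup>2"] by simp
qed

text \<open>With \<open>u = q(a) y\<close> and \<open>v = r(a) y\<close>, the vector \<open>u\<close> is the mean of \<open>u + i v\<close> and \<open>u - i v\<close>,
  and both of these have squared norm \<open>\<parallel>y\<dagger> (q\<^sup>2 + r\<^sup>2)(a) y\<parallel>\<close>.\<close>

lemma opnorm_sum_squares:
  assumes a: "a \<in> C" "a\<dagger> = a"
  shows "opnorm a (q\<^sup>2) \<le> opnorm a (q\<^sup>2 + r\<^sup>2)"
proof -
  define K where "K = opnorm a (q\<^sup>2 + r\<^sup>2)"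
  have K0: "K \<ge> 0" unfolding K_def using a opnorm_nonneg by simp
  have half: "p (poly_act a q y \<oplus> c \<odot> poly_act a r y) \<le> sqrt K * p y"
    if y: "y \<in> C" and c: "c = \<i> \<or> c = -\<i>" for y c
  proof -
    define u where "u = poly_act a q y"
    define v where "v = poly_act a r y"
    have [simp]: "u \<in> C" "v \<in> C" using a y unfolding u_def v_def by auto
    have uv: "u\<dagger> \<otimes> v = v\<dagger> \<otimes> u"
      using a y unfolding u_def v_def
      by (simp add: poly_act_star poly_act_mult_poly[symmetric] mult.commute)
    have cc: "cnj c * c = 1" "cnj c = - c" using c by auto
    have "(u \<oplus> c \<odot> v)\<dagger> \<otimes> (u \<oplus> c \<odot> v) =
        u\<dagger> \<otimes> u \<oplus> (c \<odot> (u\<dagger> \<otimes> v) \<oplus> (cnj c \<odot> (v\<dagger> \<otimes> u) \<oplus> (cnj c * c) \<odot> (v\<dagger> \<otimes> v)))"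
      by (simp add: star_add star_scale mult_add_left mult_add_right scale_add_right mult.commute[of c])
        (simp add: add_ac)
    also have "c \<odot> (u\<dagger> \<otimes> v) \<oplus> (cnj c \<odot> (v\<dagger> \<otimes> u) \<oplus> (cnj c * c) \<odot> (v\<dagger> \<otimes> v)) =
        (c + cnj c) \<odot> (v\<dagger> \<otimes> u) \<oplus> v\<dagger> \<otimes> v"
      unfolding cc(1) uv by (simp add: scale_add_left add_assoc)
    also have "u\<dagger> \<otimes> u \<oplus> ((c + cnj c) \<odot> (v\<dagger> \<otimes> u) \<oplus> v\<dagger> \<otimes> v) = u\<dagger> \<otimes> u \<oplus> v\<dagger> \<otimes> v"
      unfolding cc(2) by simp
    also have "\<dots> = y\<dagger> \<otimes> poly_act a (q\<^sup>2 + r\<^sup>2) y"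
      using a y unfolding u_def v_def
      by (simp add: poly_act_star poly_act_mult_poly[symmetric] mult_add_right[symmetric]
          poly_act_add_poly[symmetric] power2_eq_square)
    finally have eq: "(u \<oplus> c \<odot> v)\<dagger> \<otimes> (u \<oplus> c \<odot> v) = y\<dagger> \<otimes> poly_act a (q\<^sup>2 + r\<^sup>2) y" .
    have "(p (u \<oplus> c \<odot> v))\<^sup>2 = p (y\<dagger> \<otimes> poly_act a (q\<^sup>2 + r\<^sup>2) y)"
      using eq by (simp add: p_star_mult[symmetric])
    also have "\<dots> \<le> p y * p (poly_act a (q\<^sup>2 + r\<^sup>2) y)"
      using p_mult[of "y\<dagger>" "poly_act a (q\<^sup>2 + r\<^sup>2) y"] a y by simp
    also have "\<dots> \<le> p y * (K * p y)"
      unfolding K_def using a y by (intro mult_left_mono opnorm_bound p_nonneg)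
    finally have "(p (u \<oplus> c \<odot> v))\<^sup>2 \<le> (sqrt K * p y)\<^sup>2"
      using K0 by (simp add: power_mult_distrib power2_eq_square[of "p y"] mult_ac)
    then show ?thesis
      using y K0 unfolding u_def[symmetric] v_def[symmetric] by - (rule power2_le_imp_le, auto)
  qed
  have q: "opnorm a q \<le> sqrt K"
  proof (rule opnorm_le)
    fix y assume y: "y \<in> C"
    define u where "u = poly_act a q y"
    define v where "v = poly_act a r y"
    have [simp]: "u \<in> C" "v \<in> C" using a y unfolding u_def v_def by auto
    have "(u \<oplus> \<i> \<odot> v) \<oplus> (u \<oplus> (-\<i>) \<odot> v) = (u \<oplus> u) \<oplus> (\<i> \<odot> v \<oplus> (-\<i>) \<odot> v)"
      by (simp add: add_ac)
    also have "\<i> \<odot> v \<oplus> (-\<i>) \<odot> v = \<zero>" using scale_add_left[of v \<i> "-\<i>"] by simp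
    also have "u \<oplus> u = 2 \<odot> u" using scale_add_left[of u 1 1] by simp
    finally have "2 \<odot> u = (u \<oplus> \<i> \<odot> v) \<oplus> (u \<oplus> (-\<i>) \<odot> v)" by simp
    then have "2 * p u \<le> p (u \<oplus> \<i> \<odot> v) + p (u \<oplus> (-\<i>) \<odot> v)"
      using p_scale[of u 2] p_add[of "u \<oplus> \<i> \<odot> v" "u \<oplus> (-\<i>) \<odot> v"] by simp
    then show "p u \<le> sqrt K * p y"
      using half[OF y, of \<i>] half[OF y, of "-\<i>"] unfolding u_def v_def by simp
  qed (use K0 in simp)
  have "opnorm a (q\<^sup>2) \<le> (opnorm a q)\<^sup>2"
  proof (rule opnorm_le)
    fix y assume y: "y \<in> C"
    have "p (poly_act a (q\<^sup>2) y) \<le> opnorm a q * p (poly_act a q y)"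
      using a y opnorm_bound[of a "poly_act a q y" q] by (simp add: power2_eq_square poly_act_mult_poly)
    also have "\<dots> \<le> opnorm a q * (opnorm a q * p y)"
      using a y by (intro mult_left_mono opnorm_bound opnorm_nonneg)
    finally show "p (poly_act a (q\<^sup>2) y) \<le> (opnorm a q)\<^sup>2 * p y"
      by (simp add: power2_eq_square mult.assoc)
  qed simp
  also have "\<dots> \<le> (sqrt K)\<^sup>2" using q opnorm_nonneg[OF a(1)] by (intro power_mono) auto
  finally show ?thesis using K0 unfolding K_def[symmetric] by simp
qed

lemma opnorm_add:
  assumes a: "a \<in> C"
  shows "opnorm a (q + r) \<le> opnorm a q + opnorm a r"
proof (rule opnorm_le)
  fix y assume y: "y \<in> C"
  have "p (poly_act a (q + r) y) \<le> p (poly_act a q y) + p (poly_act a r y)"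
    using a y by (simp add: poly_act_add_poly p_add)
  also have "\<dots> \<le> opnorm a q * p y + opnorm a r * p y"
    using a y by (intro add_mono opnorm_bound)
  finally show "p (poly_act a (q + r) y) \<le> (opnorm a q + opnorm a r) * p y"
    by (simp add: distrib_right)
qed (simp add: opnorm_nonneg a)

lemma opnorm_mult:
  assumes a: "a \<in> C"
  shows "opnorm a (q * r) \<le> opnorm a q * opnorm a r"
proof (rule opnorm_le)
  fix y assume y: "y \<in> C"
  have "p (poly_act a (q * r) y) \<le> opnorm a q * p (poly_act a r y)"
    using a y opnorm_bound[of a "poly_act a r y" q] by (simp add: poly_act_mult_poly)
  also have "\<dots> \<le> opnorm a q * (opnorm a r * p y)"
    using a y by (intro mult_left_mono opnorm_bound opnorm_nonneg)
  finally show "p (poly_act a (q * r) y) \<le> opnorm a q * opnorm a r * p y"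
    by (simp add: mult.assoc)
qed (simp add: opnorm_nonneg a)

lemma opnorm_smult:
  assumes a: "a \<in> C"
  shows "opnorm a (smult c q) \<le> \<bar>c\<bar> * opnorm a q"
proof (rule opnorm_le)
  fix y assume y: "y \<in> C"
  have "p (poly_act a (smult c q) y) = \<bar>c\<bar> * p (poly_act a q y)"
    using a y by (simp add: poly_act_smult p_scale)
  also have "\<dots> \<le> \<bar>c\<bar> * (opnorm a q * p y)"
    using a y by (intro mult_left_mono opnorm_bound) auto
  finally show "p (poly_act a (smult c q) y) \<le> \<bar>c\<bar> * opnorm a q * p y" by (simp add: mult.assoc)
qed (simp add: opnorm_nonneg a)

text \<open>The polynomial functional calculus is contractive for the sup norm on \<open>[-r, r]\<close> as soon as
  \<open>p a \<le> r\<close>. The rescaling \<open>q \<mapsto> q(t/r)\<close> reduces this to the interval \<open>[-1, 1]\<close>.\<close>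

theorem opnorm_le_sup:
  assumes a: "a \<in> C" "a\<dagger> = a" and r: "p a \<le> r" "r > 0"
    and B: "\<And>t. \<bar>t\<bar> \<le> r \<Longrightarrow> \<bar>poly q t\<bar> \<le> B"
  shows "opnorm a q \<le> B"
proof -
  define N where "N q = opnorm a (pcompose q [:0, 1 / r:])" for q
  interpret poly_seminorm N
  proof
    fix q s :: "real poly" and c :: real
    show "0 \<le> N q" unfolding N_def using a opnorm_nonneg by simp
    show "N (q + s) \<le> N q + N s" unfolding N_def pcompose_add using a opnorm_add by simp
    show "N (smult c q) \<le> \<bar>c\<bar> * N q" unfolding N_def pcompose_smult using a opnorm_smult by simp
    show "N (q * s) \<le> N q * N s" unfolding N_def pcompose_mult using a opnorm_mult by simp
    show "(N q)\<^sup>2 \<le> N (q\<^sup>2)" unfolding N_def power2_eq_square[of q] pcompose_mult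
      using opnorm_square[OF a, of "pcompose q [:0, 1 / r:]"] by (simp add: power2_eq_square)
    show "N (q\<^sup>2) \<le> N (q\<^sup>2 + s\<^sup>2)"
      unfolding N_def power2_eq_square pcompose_mult pcompose_add
      using opnorm_sum_squares[OF a, of "pcompose q [:0, 1 / r:]" "pcompose s [:0, 1 / r:]"]
      by (simp add: power2_eq_square)
    show "N 1 \<le> 1" unfolding N_def using a by (simp add: pcompose_1) (rule opnorm_le, auto)
    have "pcompose [:0, 1:] [:0, 1 / r:] = smult (1 / r) [:0, 1:]"
      by (simp add: pcompose_pCons)
    then have "N [:0, 1:] \<le> \<bar>1 / r\<bar> * opnorm a [:0, 1:]"
      unfolding N_def using opnorm_smult[OF a(1), of "1 / r" "[:0, 1:]"] by simp
    also have "\<dots> \<le> \<bar>1 / r\<bar> * r"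
      using opnorm_X[OF a(1)] r by (intro mult_left_mono) auto
    finally show "N [:0, 1:] \<le> 1" using r by simp
  qed
  have "pcompose (pcompose q [:0, r:]) [:0, 1 / r:] = q"
    using r by (simp add: pcompose_assoc[symmetric] pcompose_pCons pcompose_idR)
  then have "opnorm a q = N (pcompose q [:0, r:])" unfolding N_def by simp
  also have "\<dots> \<le> B"
  proof (rule N_le_sup)
    fix t :: real assume "\<bar>t\<bar> \<le> 1"
    then have "\<bar>r * t\<bar> \<le> r" using r by (simp add: abs_mult)
    then show "\<bar>poly (pcompose q [:0, r:]) t\<bar> \<le> B" using B[of "r * t"] by (simp add: poly_pcompose mult.commute)
  qed
  finally show ?thesis .
qed

text \<open>For a polynomial \<open>t q(t)\<close> without constant term, \<open>poly_act a q a\<close> is the corresponding element of the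
  algebra.\<close>

lemma poly_act_self_le_opnorm:
  assumes a: "a \<in> C" "a\<dagger> = a"
  shows "p (poly_act a q a) \<le> opnorm a (pCons 0 q)"
proof (cases "p (poly_act a q a) = 0")
  case True
  then show ?thesis using a opnorm_nonneg by simp
next
  case False
  define z where "z = poly_act a q a"
  have z: "z \<in> C" unfolding z_def using a by simp
  have zz: "z\<dagger> = z" unfolding z_def using a by (rule poly_act_star_self)
  have "z \<otimes> z = poly_act a (pCons 0 q) z"
    using a z unfolding z_def by (simp add: poly_act_mult_right[symmetric] poly_act_mult_self)
  then have "(p z)\<^sup>2 \<le> opnorm a (pCons 0 q) * p z"
    using p_star_mult[OF z] opnorm_bound[OF a(1) z, of "pCons 0 q"] unfolding zz by simp
  then show ?thesis
    using False p_nonneg[OF z] unfolding z_def[symmetric] by (simp add: power2_eq_square)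
qed

lemma poly_act_self_le_sup:
  assumes "a \<in> C" "a\<dagger> = a" "p a \<le> r" "r > 0"
    and "\<And>t. \<bar>t\<bar> \<le> r \<Longrightarrow> \<bar>poly (pCons 0 q) t\<bar> \<le> B"
  shows "p (poly_act a q a) \<le> B"
  by (rule order_trans[OF poly_act_self_le_opnorm[OF assms(1,2)] opnorm_le_sup[OF assms]])

end

section \<open>Convergence and completeness\<close>

context cstar_seminormed
begin

text \<open>Convergence and the Cauchy property with respect to the seminorm; a limit is unique only if the
  seminorm is a norm.\<close>

definition conv :: "(nat \<Rightarrow> 'a) \<Rightarrow> 'a \<Rightarrow> bool" where
  "conv X l \<longleftrightarrow> (\<lambda>n. p (X n \<ominus> l)) \<longlonglongrightarrow> 0"

definition is_cauchy :: "(nat \<Rightarrow> 'a) \<Rightarrow> bool" where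
  "is_cauchy X \<longleftrightarrow> (\<forall>\<epsilon>>0. \<exists>N. \<forall>m\<ge>N. \<forall>n\<ge>N. p (X m \<ominus> X n) < \<epsilon>)"

lemma convI:
  assumes "\<And>n. p (X n \<ominus> l) \<le> e n" "e \<longlonglongrightarrow> 0" "\<And>n. X n \<in> C" "l \<in> C"
  shows "conv X l"
  unfolding conv_def
  by (rule tendsto_sandwich[OF _ _ tendsto_const assms(2)]) (use assms in \<open>auto intro: always_eventually\<close>)

lemma conv_const [simp]: "l \<in> C \<Longrightarrow> conv (\<lambda>n. l) l"
  by (simp add: conv_def)

lemma conv_Suc: "conv X l \<Longrightarrow> conv (\<lambda>n. X (Suc n)) l"
  unfolding conv_def by (rule LIMSEQ_Suc)

lemma conv_add:
  assumes "conv X x" "conv Y y" "\<And>n. X n \<in> C" "\<And>n. Y n \<in> C" "x \<in> C" "y \<in> C"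
  shows "conv (\<lambda>n. X n \<oplus> Y n) (x \<oplus> y)"
proof (rule convI)
  show "p ((X n \<oplus> Y n) \<ominus> (x \<oplus> y)) \<le> p (X n \<ominus> x) + p (Y n \<ominus> y)" for n
    using assms by (simp add: add_diff_add p_add)
  show "(\<lambda>n. p (X n \<ominus> x) + p (Y n \<ominus> y)) \<longlonglongrightarrow> 0"
    using assms(1,2) unfolding conv_def by (rule tendsto_add_zero)
qed (use assms in auto)

lemma conv_scale:
  assumes "conv X x" "\<And>n. X n \<in> C" "x \<in> C"
  shows "conv (\<lambda>n. c \<odot> X n) (c \<odot> x)"
proof (rule convI)
  show "p (c \<odot> X n \<ominus> c \<odot> x) \<le> cmod c * p (X n \<ominus> x)" for n
    using assms by (simp add: scale_diff[symmetric] p_scale)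
  show "(\<lambda>n. cmod c * p (X n \<ominus> x)) \<longlonglongrightarrow> 0"
    using assms(1) unfolding conv_def by (rule tendsto_mult_right_zero)
qed (use assms in auto)

lemma conv_diff:
  assumes "conv X x" "conv Y y" "\<And>n. X n \<in> C" "\<And>n. Y n \<in> C" "x \<in> C" "y \<in> C"
  shows "conv (\<lambda>n. X n \<ominus> Y n) (x \<ominus> y)"
  unfolding alg_diff_def using assms by (intro conv_add conv_scale) auto

lemma conv_norm:
  assumes "conv X x" "\<And>n. X n \<in> C" "x \<in> C"
  shows "(\<lambda>n. p (X n)) \<longlonglongrightarrow> p x"
proof -
  have "(\<lambda>n. p (X n) - p x) \<longlonglongrightarrow> 0"
    by (rule Lim_null_comparison[OF _ assms(1)[unfolded conv_def]])
      (use assms p_abs_diff in \<open>auto intro: always_eventually\<close>)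
  then show ?thesis by (simp add: LIM_zero_iff)
qed

lemma conv_mult:
  assumes "conv X x" "conv Y y" "\<And>n. X n \<in> C" "\<And>n. Y n \<in> C" "x \<in> C" "y \<in> C"
  shows "conv (\<lambda>n. X n \<otimes> Y n) (x \<otimes> y)"
proof (rule convI)
  show "p (X n \<otimes> Y n \<ominus> x \<otimes> y) \<le> p (X n) * p (Y n \<ominus> y) + p (X n \<ominus> x) * p y" for n
  proof -
    have "p (X n \<otimes> Y n \<ominus> x \<otimes> y) \<le> p (X n \<otimes> Y n \<ominus> X n \<otimes> y) + p (X n \<otimes> y \<ominus> x \<otimes> y)"
      using assms by (intro p_triangle) auto
    also have "\<dots> = p (X n \<otimes> (Y n \<ominus> y)) + p ((X n \<ominus> x) \<otimes> y)"
      using assms by (simp add: mult_diff_left mult_diff_right)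
    also have "\<dots> \<le> p (X n) * p (Y n \<ominus> y) + p (X n \<ominus> x) * p y"
      using assms by (intro add_mono p_mult) auto
    finally show ?thesis .
  qed
  have "(\<lambda>n. p (X n) * p (Y n \<ominus> y) + p (X n \<ominus> x) * p y) \<longlonglongrightarrow> p x * 0 + 0 * p y"
    using assms(1,2) unfolding conv_def
    by (intro tendsto_intros conv_norm assms)
  then show "(\<lambda>n. p (X n) * p (Y n \<ominus> y) + p (X n \<ominus> x) * p y) \<longlonglongrightarrow> 0" by simp
qed (use assms in auto)

lemma is_cauchyI:
  assumes bound: "\<And>n k. p (X (n + k) \<ominus> X n) \<le> e n" and e: "e \<longlonglongrightarrow> 0" and X: "\<And>n. X n \<in> C"
  shows "is_cauchy X"
  unfolding is_cauchy_def
proof (intro allI impI)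
  fix \<epsilon> :: real assume "\<epsilon> > 0"
  then have "\<forall>\<^sub>F n in sequentially. e n < \<epsilon> / 2" by (intro order_tendstoD(2)[OF e]) simp
  then obtain N where N: "e N < \<epsilon> / 2" by (auto simp: eventually_sequentially)
  have "p (X m \<ominus> X n) < \<epsilon>" if "m \<ge> N" "n \<ge> N" for m n
  proof -
    have "p (X m \<ominus> X N) \<le> e N" using bound[of N "m - N"] that by simp
    moreover have "p (X n \<ominus> X N) \<le> e N" using bound[of N "n - N"] that by simp
    moreover have "p (X m \<ominus> X n) \<le> p (X m \<ominus> X N) + p (X n \<ominus> X N)"
      using p_triangle[of "X m" "X N" "X n"] p_diff_commute[of "X N" "X n"] X by simp
    ultimately show ?thesis using N by linarith
  qed
  then show "\<exists>N. \<forall>m\<ge>N. \<forall>n\<ge>N. p (X m \<ominus> X n) < \<epsilon>" by blast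
qed

lemma is_cauchy_geometric:
  assumes step: "\<And>n. p (X (Suc n) \<ominus> X n) \<le> K * r ^ n" and r: "0 \<le> r" "r < 1" and X: "\<And>n. X n \<in> C"
  shows "is_cauchy X"
proof (rule is_cauchyI)
  have K: "K \<ge> 0"
    using order_trans[OF p_nonneg step[of 0]] X by simp
  have telescope: "p (X (n + k) \<ominus> X n) \<le> K * r ^ n * (1 - r ^ k) / (1 - r)" for n k
  proof (induction k)
    case 0
    show ?case using X by simp
  next
    case (Suc k)
    have "p (X (n + Suc k) \<ominus> X n) \<le> p (X (Suc (n + k)) \<ominus> X (n + k)) + p (X (n + k) \<ominus> X n)"
      using p_triangle[of "X (Suc (n + k))" "X (n + k)" "X n"] X by simp
    also have "\<dots> \<le> K * r ^ (n + k) + K * r ^ n * (1 - r ^ k) / (1 - r)"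
      using step[of "n + k"] Suc by linarith
    also have "\<dots> = K * r ^ n * (1 - r ^ Suc k) / (1 - r)"
      using r by (simp add: field_simps power_add)
    finally show ?case .
  qed
  show "p (X (n + k) \<ominus> X n) \<le> K / (1 - r) * r ^ n" for n k
  proof -
    have "K * r ^ n * (1 - r ^ k) / (1 - r) \<le> K * r ^ n * 1 / (1 - r)"
      using K r by (intro divide_right_mono mult_left_mono) auto
    then show ?thesis using telescope[of n k] by simp
  qed
  show "(\<lambda>n. K / (1 - r) * r ^ n) \<longlonglongrightarrow> 0"
    using r by (intro tendsto_mult_right_zero LIMSEQ_power_zero) simp
qed (rule X)

end

text \<open>C*-algebras: the C*-seminorm is a complete norm.\<close>

locale cstar_alg = cstar_seminormed D p
  for D :: "('a, 'z) star_algebra_scheme" (structure) and p +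
  assumes p_definite: "\<lbrakk>x \<in> C; p x = 0\<rbrakk> \<Longrightarrow> x = \<zero>"
    and p_complete: "\<lbrakk>\<And>n. X n \<in> C; is_cauchy X\<rbrakk> \<Longrightarrow> \<exists>l\<in>C. conv X l"
begin

lemma conv_unique:
  assumes "conv X x" "conv X y" "\<And>n. X n \<in> C" "x \<in> C" "y \<in> C"
  shows "x = y"
proof -
  have "conv (\<lambda>n. X n \<ominus> X n) (x \<ominus> y)" using assms by (intro conv_diff)
  then have "(\<lambda>n. 0 :: real) \<longlonglongrightarrow> p (x \<ominus> y)"
    using conv_norm[of "\<lambda>n. X n \<ominus> X n"] assms by simp
  then have "p (x \<ominus> y) = 0" using LIMSEQ_unique tendsto_const by blast
  then show ?thesis using p_definite[of "x \<ominus> y"] assms diff_eq_zero by simp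
qed

text \<open>Continuous functional calculus, given by approximating polynomials. The value of \<open>f\<close> at \<open>a\<close>
  is the element \<open>c\<close>.\<close>

lemma continuous_calculus:
  assumes a: "a \<in> C" "a\<dagger> = a" "p a \<le> r" "r > 0"
    and f: "continuous_on {-r..r} f" "f 0 = 0"
  obtains q c where "\<And>n t. \<bar>t\<bar> \<le> r \<Longrightarrow> \<bar>f t - poly (pCons 0 (q n)) t\<bar> < 1 / real (Suc n)"
    and "c \<in> C" and "conv (\<lambda>n. poly_act a (q n) a) c"
proof -
  have "\<exists>q. \<forall>t. \<bar>t\<bar> \<le> r \<longrightarrow> \<bar>f t - poly (pCons 0 q) t\<bar> < 1 / real (Suc n)" for n
    using weierstrass_vanishing_at_zero[OF f] a by simp
  then obtain q where q: "\<And>n t. \<bar>t\<bar> \<le> r \<Longrightarrow> \<bar>f t - poly (pCons 0 (q n)) t\<bar> < 1 / real (Suc n)"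
    by metis
  have "is_cauchy (\<lambda>n. poly_act a (q n) a)"
  proof (rule is_cauchyI)
    show "p (poly_act a (q (n + k)) a \<ominus> poly_act a (q n) a) \<le> 2 / real (Suc n)" for n k
    proof -
      have "p (poly_act a (q (n + k) - q n) a) \<le> 2 / real (Suc n)"
      proof (rule poly_act_self_le_sup[OF a])
        fix t assume t: "\<bar>t\<bar> \<le> r"
        have "1 / real (Suc (n + k)) \<le> 1 / real (Suc n)" by (intro divide_left_mono) auto
        moreover have "poly (pCons 0 (q (n + k) - q n)) t =
            poly (pCons 0 (q (n + k))) t - poly (pCons 0 (q n)) t" by (simp add: algebra_simps)
        ultimately show "\<bar>poly (pCons 0 (q (n + k) - q n)) t\<bar> \<le> 2 / real (Suc n)"
          using q[OF t, of n] q[OF t, of "n + k"] by linarith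
      qed
      then show ?thesis using a by (simp add: poly_act_diff_poly)
    qed
    show "(\<lambda>n. 2 / real (Suc n)) \<longlonglongrightarrow> 0"
      using tendsto_mult_right_zero[OF LIMSEQ_inverse_real_of_nat, of 2] by (simp add: divide_inverse)
  qed (use a in auto)
  then obtain c where "c \<in> C" "conv (\<lambda>n. poly_act a (q n) a) c"
    using p_complete[of "\<lambda>n. poly_act a (q n) a"] a by auto
  with q show ?thesis using that by blast
qed

text \<open>A local unit: with \<open>f\<close> supported away from zero and \<open>g t = 1/t\<close> on the support of \<open>f\<close>,
  the elements \<open>c = f(a)\<close> and \<open>w = g(a)\<close> satisfy \<open>w a c = c\<close>.\<close>

lemma local_inverse:
  assumes a: "a \<in> C" "a\<dagger> = a" "a \<noteq> \<zero>"
  obtains w c where "w \<in> C" "c \<in> C" "c \<noteq> \<zero>" "w \<otimes> a \<otimes> c = c"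
proof -
  define r where "r = p a"
  have r: "r > 0" using a p_definite[of a] p_nonneg[OF a(1)] unfolding r_def by linarith
  define s where "s = r / 2"
  have s: "s > 0" using r unfolding s_def by simp
  \<comment> \<open>The factor \<open>t\<close> in the numerator extends \<open>1/t\<close> continuously to \<open>[-s, s]\<close>, where \<open>f\<close> vanishes.\<close>
  define f where "f t = t - max (- s) (min s t)" for t
  define g where "g t = t / (max \<bar>t\<bar> s)\<^sup>2" for t
  have contf: "continuous_on {-r..r} f" unfolding f_def by (intro continuous_intros)
  have contg: "continuous_on {-r..r} g"
    unfolding g_def using s by (intro continuous_intros) auto
  have f0: "f 0 = 0" "g 0 = 0" unfolding f_def g_def using s by auto
  have "p a \<le> r" by (simp add: r_def)
  note base = a(1,2) this r
  obtain qf c where qf: "\<And>n t. \<bar>t\<bar> \<le> r \<Longrightarrow> \<bar>f t - poly (pCons 0 (qf n)) t\<bar> < 1 / real (Suc n)"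
    and c: "c \<in> C" "conv (\<lambda>n. poly_act a (qf n) a) c"
    using continuous_calculus[OF base contf f0(1)] by metis
  obtain qg w where qg: "\<And>n t. \<bar>t\<bar> \<le> r \<Longrightarrow> \<bar>g t - poly (pCons 0 (qg n)) t\<bar> < 1 / real (Suc n)"
    and w: "w \<in> C" "conv (\<lambda>n. poly_act a (qg n) a) w"
    using continuous_calculus[OF base contg f0(2)] by metis
  have lim0: "(\<lambda>n. 1 / real (Suc n)) \<longlonglongrightarrow> 0"
    using LIMSEQ_inverse_real_of_nat by (simp add: divide_inverse)
  have fg: "g t * t * f t = f t" "\<bar>g t * t - 1\<bar> \<le> 1" "\<bar>t - f t\<bar> \<le> s" for t
  proof -
    show "\<bar>t - f t\<bar> \<le> s" unfolding f_def using s by auto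
    show "g t * t * f t = f t"
    proof (cases "\<bar>t\<bar> \<le> s")
      case True
      then have "f t = 0" unfolding f_def by auto
      then show ?thesis by simp
    next
      case False
      then have "g t * t = 1" unfolding g_def using s by (simp add: power2_eq_square)
      then show ?thesis by simp
    qed
    have "t * t \<le> (max \<bar>t\<bar> s)\<^sup>2"
      using power_mono[of "\<bar>t\<bar>" "max \<bar>t\<bar> s" 2] by (simp add: power2_eq_square)
    then have "0 \<le> g t * t" "g t * t \<le> 1"
      unfolding g_def using s by (auto simp: divide_le_eq)
    then show "\<bar>g t * t - 1\<bar> \<le> 1" by auto
  qed
  have "conv (\<lambda>n. poly_act a (qg n) a \<otimes> (a \<otimes> poly_act a (qf n) a)) c"
  proof -
    have "conv (\<lambda>n. poly_act a (qg n) a \<otimes> (a \<otimes> poly_act a (qf n) a) \<ominus> poly_act a (qf n) a) \<zero>"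
    proof (rule convI)
      fix n
      define G where "G = pCons 0 (qg n)"
      define F where "F = pCons 0 (qf n)"
      define e where "e = 1 / real (Suc n)"
      have "poly_act a (qg n) a \<otimes> (a \<otimes> poly_act a (qf n) a) =
          poly_act a (G * ([:0, 1:] * qf n)) a"
        using a unfolding G_def
        by (simp add: poly_act_mult_poly poly_act_mult_right[symmetric] poly_act_mult_self
            poly_act_smult del: mult_pCons_left mult_pCons_right)
      then have eq: "poly_act a (qg n) a \<otimes> (a \<otimes> poly_act a (qf n) a) \<ominus> poly_act a (qf n) a \<ominus> \<zero> =
          poly_act a (G * ([:0, 1:] * qf n) - qf n) a"
        using a by (simp add: poly_act_diff_poly)
      show "p (poly_act a (qg n) a \<otimes> (a \<otimes> poly_act a (qf n) a) \<ominus> poly_act a (qf n) a \<ominus> \<zero>)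
          \<le> e + e * r * (r + s + e)"
        unfolding eq
      proof (rule poly_act_self_le_sup[OF base])
        fix t assume t: "\<bar>t\<bar> \<le> r"
        have e1: "\<bar>g t - poly G t\<bar> \<le> e" and e2: "\<bar>f t - poly F t\<bar> \<le> e"
          using qf[OF t, of n] qg[OF t, of n] unfolding F_def G_def e_def by auto
        have e0: "e \<ge> 0" unfolding e_def by simp
        have "poly (pCons 0 (G * ([:0, 1:] * qf n) - qf n)) t = poly G t * t * poly F t - poly F t"
          unfolding F_def by (simp add: algebra_simps)
        also have "\<dots> = (g t * t - 1) * (poly F t - f t) - (g t - poly G t) * (t * poly F t)
            + (g t * t * f t - f t)"
          by (simp add: algebra_simps)
        finally have id: "poly (pCons 0 (G * ([:0, 1:] * qf n) - qf n)) t =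
            (g t * t - 1) * (poly F t - f t) - (g t - poly G t) * (t * poly F t)"
          using fg(1) by simp
        have "\<bar>poly F t\<bar> \<le> r + s + e" using e2 fg(3)[of t] t by linarith
        then have "\<bar>t * poly F t\<bar> \<le> r * (r + s + e)"
          unfolding abs_mult using t r by (intro mult_mono) auto
        then have "\<bar>(g t - poly G t) * (t * poly F t)\<bar> \<le> e * (r * (r + s + e))"
          unfolding abs_mult[of "g t - poly G t"] using e1 e0 by (intro mult_mono) auto
        moreover have "\<bar>(g t * t - 1) * (poly F t - f t)\<bar> \<le> 1 * e"
          unfolding abs_mult[of "g t * t - 1"] using e2 fg(2) e0 by (intro mult_mono) (auto simp: abs_minus_commute)
        ultimately show "\<bar>poly (pCons 0 (G * ([:0, 1:] * qf n) - qf n)) t\<bar> \<le> e + e * r * (r + s + e)"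
          unfolding id by (simp add: mult.assoc)
      qed
    next
      have "(\<lambda>n. 1 / real (Suc n) + 1 / real (Suc n) * r * (r + s + 1 / real (Suc n)))
          \<longlonglongrightarrow> 0 + 0 * r * (r + s + 0)"
        by (intro tendsto_add tendsto_mult tendsto_const lim0)
      then show "(\<lambda>n. 1 / real (Suc n) + 1 / real (Suc n) * r * (r + s + 1 / real (Suc n))) \<longlonglongrightarrow> 0"
        by simp
    qed (use a in auto)
    from conv_add[OF this c(2)] show ?thesis using a c by (simp add: diff_add_cancel)
  qed
  moreover have "conv (\<lambda>n. poly_act a (qg n) a \<otimes> (a \<otimes> poly_act a (qf n) a)) (w \<otimes> (a \<otimes> c))"
    using a c w by (intro conv_mult conv_const) auto
  ultimately have "w \<otimes> (a \<otimes> c) = c"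
    by (rule conv_unique[symmetric]) (use a c w in auto)
  then have "w \<otimes> a \<otimes> c = c" using a c w by (simp add: mult_assoc)
  \<comment> \<open>\<open>f(t)\<close> differs from \<open>t\<close> by at most \<open>r/2\<close>, and \<open>a\<close> has norm \<open>r\<close>.\<close>
  moreover have "c \<noteq> \<zero>"
  proof
    assume "c = \<zero>"
    then have lim: "(\<lambda>n. p (poly_act a (qf n) a \<ominus> a)) \<longlonglongrightarrow> r"
      using conv_norm[of "\<lambda>n. poly_act a (qf n) a \<ominus> a" "\<zero> \<ominus> a"] c(2) a conv_diff[OF c(2) conv_const[OF a(1)]]
      by (simp add: r_def p_diff_commute[of \<zero>])
    have "p (poly_act a (qf n) a \<ominus> a) \<le> s + 1 / real (Suc n)" for n
    proof -
      have "p (poly_act a (qf n - 1) a) \<le> s + 1 / real (Suc n)"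
      proof (rule poly_act_self_le_sup[OF base])
        fix t assume t: "\<bar>t\<bar> \<le> r"
        have "poly (pCons 0 (qf n - 1)) t = poly (pCons 0 (qf n)) t - t" by (simp add: algebra_simps)
        then show "\<bar>poly (pCons 0 (qf n - 1)) t\<bar> \<le> s + 1 / real (Suc n)"
          using qf[OF t, of n] fg(3)[of t] by linarith
      qed
      then show ?thesis using a by (simp add: poly_act_diff_poly)
    qed
    moreover have "(\<lambda>n. s + 1 / real (Suc n)) \<longlonglongrightarrow> s + 0"
      by (intro tendsto_add tendsto_const lim0)
    ultimately have "r \<le> s" using LIMSEQ_le[OF lim] by force
    then show False using r unfolding s_def by simp
  qed
  ultimately show ?thesis using that c w by blast
qed

end

section \<open>Homomorphisms of C*-algebras\<close>

text \<open>*-homomorphisms, without any condition of continuity.\<close>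

definition star_hom ::
  "('b, 'y) star_algebra_scheme \<Rightarrow> ('a, 'z) star_algebra_scheme \<Rightarrow> ('b \<Rightarrow> 'a) \<Rightarrow> bool" where
  "star_hom B D h \<longleftrightarrow>
     (\<forall>x\<in>alg_carrier B. h x \<in> alg_carrier D) \<and>
     (\<forall>x\<in>alg_carrier B. \<forall>y\<in>alg_carrier B. h (x \<oplus>\<^bsub>B\<^esub> y) = h x \<oplus>\<^bsub>D\<^esub> h y) \<and>
     (\<forall>c. \<forall>x\<in>alg_carrier B. h (c \<odot>\<^bsub>B\<^esub> x) = c \<odot>\<^bsub>D\<^esub> h x) \<and>
     (\<forall>x\<in>alg_carrier B. \<forall>y\<in>alg_carrier B. h (x \<otimes>\<^bsub>B\<^esub> y) = h x \<otimes>\<^bsub>D\<^esub> h y) \<and>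
     (\<forall>x\<in>alg_carrier B. h (x\<dagger>\<^bsub>B\<^esub>) = (h x)\<dagger>\<^bsub>D\<^esub>)"

text \<open>A *-homomorphism from a C*-algebra; the codomain carries just a C*-seminorm. It is automatically
  contractive, see \<open>contractive\<close> below.\<close>

locale cstar_hom = B: cstar_alg B q + D: cstar_seminormed D p
  for B :: "('b, 'y) star_algebra_scheme" and q
    and D :: "('a, 'z) star_algebra_scheme" (structure) and p +
  fixes h :: "'b \<Rightarrow> 'a"
  assumes hom: "star_hom B D h"
begin

lemma hom_closed [simp]: "x \<in> B.C \<Longrightarrow> h x \<in> D.C"
  using hom unfolding star_hom_def by blast

lemma hom_add: "\<lbrakk>x \<in> B.C; y \<in> B.C\<rbrakk> \<Longrightarrow> h (x \<oplus>\<^bsub>B\<^esub> y) = h x \<oplus> h y"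
  using hom unfolding star_hom_def by blast

lemma hom_scale: "x \<in> B.C \<Longrightarrow> h (c \<odot>\<^bsub>B\<^esub> x) = c \<odot> h x"
  using hom unfolding star_hom_def by blast

lemma hom_mult: "\<lbrakk>x \<in> B.C; y \<in> B.C\<rbrakk> \<Longrightarrow> h (x \<otimes>\<^bsub>B\<^esub> y) = h x \<otimes> h y"
  using hom unfolding star_hom_def by blast

lemma hom_star: "x \<in> B.C \<Longrightarrow> h (x\<dagger>\<^bsub>B\<^esub>) = (h x)\<dagger>"
  using hom unfolding star_hom_def by blast

lemma hom_diff: "\<lbrakk>x \<in> B.C; y \<in> B.C\<rbrakk> \<Longrightarrow> h (x \<ominus>\<^bsub>B\<^esub> y) = h x \<ominus> h y"
  by (simp add: alg_diff_def hom_add hom_scale)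

lemma hom_zero: "h \<zero>\<^bsub>B\<^esub> = \<zero>"
  using hom_scale[of "\<zero>\<^bsub>B\<^esub>" 0] by simp

lemma hom_poly_act:
  assumes "a \<in> B.C" "y \<in> B.C"
  shows "h (B.poly_act a s y) = D.poly_act (h a) s (h y)"
  using assms by (induction s) (auto simp: hom_zero hom_add hom_scale hom_mult)

text \<open>A self-adjoint \<open>b\<close> with \<open>q b < 1\<close> and \<open>p (h b) = 1\<close> cannot exist. For the sum \<open>k\<close> of the
  geometric series, \<open>(1 + k)(1 - b\<^sup>2) = 1\<close>, so that \<open>1 - h(b)\<^sup>2\<close> is bounded below. But it is small on
  the range of \<open>h(b)\<^sup>m\<close> for large \<open>m\<close>, while \<open>h(b)\<^sup>m\<close> has operator norm at least \<open>1\<close>.\<close>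

lemma contractive_aux:
  assumes b: "b \<in> B.C" "b\<dagger>\<^bsub>B\<^esub> = b" "q b < 1" and one: "p (h b) = 1"
  shows False
proof -
  define d where "d = b \<otimes>\<^bsub>B\<^esub> b"
  have d: "d \<in> B.C" unfolding d_def using b by simp
  have "q d = (q b)\<^sup>2" unfolding d_def using B.p_star_mult[OF b(1)] b(2) by simp
  also have "\<dots> < 1" using b B.p_nonneg[OF b(1)] by (simp add: power_less_one_iff abs_square_less_1)
  finally have qd: "q d < 1" .
  define S where "S = rec_nat \<zero>\<^bsub>B\<^esub> (\<lambda>_ x. d \<oplus>\<^bsub>B\<^esub> x \<otimes>\<^bsub>B\<^esub> d)"
  have S_rec: "S 0 = \<zero>\<^bsub>B\<^esub>" "S (Suc n) = d \<oplus>\<^bsub>B\<^esub> S n \<otimes>\<^bsub>B\<^esub> d" for n unfolding S_def by auto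
  have S: "S n \<in> B.C" for n by (induction n) (auto simp: S_rec d)
  have step: "q (S (Suc n) \<ominus>\<^bsub>B\<^esub> S n) \<le> q d * q d ^ n" for n
  proof (induction n)
    case 0
    show ?case using d by (simp add: S_rec)
  next
    case (Suc n)
    have "S (Suc (Suc n)) \<ominus>\<^bsub>B\<^esub> S (Suc n) = (S (Suc n) \<ominus>\<^bsub>B\<^esub> S n) \<otimes>\<^bsub>B\<^esub> d"
      using S d S_rec(2)[of "Suc n"] S_rec(2)[of n]
      by (simp add: B.add_diff_add B.mult_diff_left)
    then have "q (S (Suc (Suc n)) \<ominus>\<^bsub>B\<^esub> S (Suc n)) \<le> q (S (Suc n) \<ominus>\<^bsub>B\<^esub> S n) * q d"
      using B.p_mult[of "S (Suc n) \<ominus>\<^bsub>B\<^esub> S n" d] S d by simp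
    also have "\<dots> \<le> (q d * q d ^ n) * q d" using Suc d by (intro mult_right_mono) auto
    finally show ?case by (simp add: mult.commute)
  qed
  have "B.is_cauchy S" using step qd d by (intro B.is_cauchy_geometric[OF step _ qd S]) auto
  then obtain k where k: "k \<in> B.C" "B.conv S k" using B.p_complete S by blast
  have "B.conv (\<lambda>n. S (Suc n)) (d \<oplus>\<^bsub>B\<^esub> k \<otimes>\<^bsub>B\<^esub> d)"
    unfolding S_rec using S d k by (intro B.conv_add B.conv_mult B.conv_const) auto
  then have "k = d \<oplus>\<^bsub>B\<^esub> k \<otimes>\<^bsub>B\<^esub> d"
    by (rule B.conv_unique[OF B.conv_Suc[OF k(2)]]) (use S k d in simp_all)
  then have hk: "h k = h d \<oplus> h k \<otimes> h d"
    using k d by (metis B.mult_closed hom_add hom_mult)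
  define a where "a = h b"
  have a: "a \<in> D.C" "a\<dagger> = a" using b hom_star[OF b(1)] unfolding a_def by auto
  have hd: "h d = a \<otimes> a" unfolding d_def a_def using b by (simp add: hom_mult)
  define K where "K = h k"
  have K: "K \<in> D.C" unfolding K_def using k by simp
  have K_eq: "K = a \<otimes> a \<oplus> K \<otimes> (a \<otimes> a)" using hk unfolding K_def hd .
  have below: "p z \<le> (1 + p K) * p (z \<ominus> a \<otimes> a \<otimes> z)" if z: "z \<in> D.C" for z
  proof -
    define y where "y = a \<otimes> a \<otimes> z"
    have y: "y \<in> D.C" unfolding y_def using a z by simp
    have Kz: "K \<otimes> z = y \<oplus> K \<otimes> y"
    proof -
      have "K \<otimes> z = (a \<otimes> a \<oplus> K \<otimes> (a \<otimes> a)) \<otimes> z" using K_eq by simp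
      then show ?thesis using a K z unfolding y_def by (simp add: D.mult_add_left D.mult_assoc)
    qed
    have "(z \<ominus> y) \<oplus> K \<otimes> (z \<ominus> y) = (z \<ominus> y) \<oplus> (K \<otimes> z \<ominus> K \<otimes> y)"
      using K z y by (simp add: D.mult_diff_right)
    also have "K \<otimes> z \<ominus> K \<otimes> y = y"
      unfolding Kz alg_diff_def using K y by (simp add: D.add_assoc)
    also have "(z \<ominus> y) \<oplus> y = z" using z y by (rule D.diff_add_cancel)
    finally have "p z \<le> p (z \<ominus> y) + p (K \<otimes> (z \<ominus> y))"
      using D.p_add[of "z \<ominus> y" "K \<otimes> (z \<ominus> y)"] K y z by simp
    also have "\<dots> \<le> p (z \<ominus> y) + p K * p (z \<ominus> y)"
      using K y z by (intro add_left_mono D.p_mult) auto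
    finally show ?thesis unfolding y_def by (simp add: distrib_right)
  qed
  have op_below: "D.opnorm a s \<le> (1 + p K) * D.opnorm a ((1 - [:0, 1:]\<^sup>2) * s)" for s
  proof (rule D.opnorm_le)
    fix z assume z: "z \<in> D.C"
    have "p (D.poly_act a s z) \<le> (1 + p K) * p (D.poly_act a ((1 - [:0, 1:]\<^sup>2) * s) z)"
    proof -
      have "D.poly_act a ((1 - [:0, 1:]\<^sup>2) * s) z =
          D.poly_act a s z \<ominus> a \<otimes> a \<otimes> D.poly_act a s z"
        using a z by (simp add: D.poly_act_mult_poly D.poly_act_diff_poly power2_eq_square D.mult_assoc
            del: mult_pCons_left mult_pCons_right)
      then show ?thesis using below[of "D.poly_act a s z"] a z by simp
    qed
    also have "\<dots> \<le> (1 + p K) * (D.opnorm a ((1 - [:0, 1:]\<^sup>2) * s) * p z)"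
      using D.opnorm_bound[OF a(1) z] K by (intro mult_left_mono) auto
    finally show "p (D.poly_act a s z) \<le> (1 + p K) * D.opnorm a ((1 - [:0, 1:]\<^sup>2) * s) * p z"
      by (simp add: mult.assoc)
  qed (use a K D.opnorm_nonneg in simp)
  have ge1: "1 \<le> D.opnorm a ([:0, 1:] ^ (2 ^ j))" for j
  proof (induction j)
    case 0
    show ?case using D.poly_act_self_le_opnorm[OF a, of 1] one a by (simp add: a_def one_pCons)
  next
    case (Suc j)
    then have "1 \<le> (D.opnorm a ([:0, 1:] ^ (2 ^ j)))\<^sup>2" by simp
    also have "\<dots> \<le> D.opnorm a (([:0, 1:] ^ (2 ^ j))\<^sup>2)" by (rule D.opnorm_square[OF a])
    also have "([:0, 1:] ^ (2 ^ j))\<^sup>2 = ([:0, 1:] :: real poly) ^ (2 ^ Suc j)"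
      by (simp add: power_mult[symmetric] mult.commute)
    finally show ?case .
  qed
  have small: "D.opnorm a ((1 - [:0, 1:]\<^sup>2) * [:0, 1:] ^ (2 * n)) \<le> 1 / real (Suc n)" for n
  proof (rule D.opnorm_le_sup[OF a, of 1])
    fix t :: real assume t: "\<bar>t\<bar> \<le> 1"
    define u where "u = t\<^sup>2"
    have u: "0 \<le> u" "u \<le> 1" unfolding u_def using t by (auto simp: abs_square_le_1)
    have "real (Suc n) * u ^ n = (\<Sum>i<Suc n. u ^ n)" by simp
    also have "\<dots> \<le> (\<Sum>i<Suc n. u ^ i)" using u by (intro sum_mono power_decreasing) auto
    finally have "real (Suc n) * u ^ n * (1 - u) \<le> (\<Sum>i<Suc n. u ^ i) * (1 - u)"
      using u by (intro mult_right_mono) auto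
    also have "\<dots> = 1 - u ^ Suc n" using one_diff_power_eq[of u "Suc n"] by (simp add: mult.commute)
    also have "\<dots> \<le> 1" using u by simp
    finally have "(1 - u) * u ^ n \<le> 1 / real (Suc n)" by (simp add: field_simps)
    moreover have "poly ((1 - [:0, 1:]\<^sup>2) * [:0, 1:] ^ (2 * n)) t = (1 - u) * u ^ n"
      unfolding u_def by (simp add: power_mult)
    ultimately show "\<bar>poly ((1 - [:0, 1:]\<^sup>2) * [:0, 1:] ^ (2 * n)) t\<bar> \<le> 1 / real (Suc n)"
      using u by simp
  qed (use one a_def in auto)
  have bound: "real (2 ^ j) \<le> 1 + p K" for j
  proof -
    have "1 \<le> D.opnorm a ([:0, 1:] ^ (2 * 2 ^ j))" using ge1[of "Suc j"] by simp
    also have "\<dots> \<le> (1 + p K) * D.opnorm a ((1 - [:0, 1:]\<^sup>2) * [:0, 1:] ^ (2 * 2 ^ j))" by (rule op_below)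
    also have "\<dots> \<le> (1 + p K) * (1 / real (Suc (2 ^ j)))"
      using K by (intro mult_left_mono small) auto
    finally have "1 \<le> (1 + p K) / real (Suc (2 ^ j))" by simp
    moreover have "0 < real (Suc (2 ^ j))" by (rule of_nat_0_less_iff[THEN iffD2]) simp
    ultimately have "real (Suc (2 ^ j)) \<le> 1 + p K" by (simp only: le_divide_eq_1_pos)
    then show ?thesis by simp
  qed
  obtain m :: nat where "1 + p K < real m" using reals_Archimedean2 by blast
  also have "real m \<le> real (2 ^ m)" using less_exp[of m] by (simp only: of_nat_le_iff)
  also have "\<dots> \<le> 1 + p K" by (rule bound)
  finally show False by simp
qed

theorem contractive:
  assumes x: "x \<in> B.C"
  shows "p (h x) \<le> q x"
proof -
  have sa: "p (h b) \<le> q b" if b: "b \<in> B.C" "b\<dagger>\<^bsub>B\<^esub> = b" for b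
  proof (rule ccontr)
    assume "\<not> p (h b) \<le> q b"
    then have lt: "q b < p (h b)" by simp
    define r where "r = p (h b)"
    have r: "r > 0" unfolding r_def using lt B.p_nonneg[OF b(1)] by linarith
    define b' where "b' = complex_of_real (1 / r) \<odot>\<^bsub>B\<^esub> b"
    have "q b' < 1" unfolding b'_def using b lt r by (simp add: B.p_scale norm_divide r_def[symmetric])
    moreover have "p (h b') = 1"
      unfolding b'_def using b r by (simp add: hom_scale D.p_scale norm_divide r_def[symmetric])
    moreover have "b' \<in> B.C" "b'\<dagger>\<^bsub>B\<^esub> = b'" unfolding b'_def using b by (auto simp: B.star_scale)
    ultimately show False using contractive_aux by blast
  qed
  have "(p (h x))\<^sup>2 = p (h (x\<dagger>\<^bsub>B\<^esub> \<otimes>\<^bsub>B\<^esub> x))"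
    using x by (simp add: hom_mult hom_star D.p_star_mult)
  also have "\<dots> \<le> q (x\<dagger>\<^bsub>B\<^esub> \<otimes>\<^bsub>B\<^esub> x)" using x by (intro sa) (auto simp: B.star_mult)
  also have "\<dots> = (q x)\<^sup>2" using x by (rule B.p_star_mult)
  finally show ?thesis using x by (intro power2_le_imp_le[OF _ B.p_nonneg])
qed

lemma hom_conv:
  assumes "B.conv X x" "\<And>n. X n \<in> B.C" "x \<in> B.C"
  shows "D.conv (\<lambda>n. h (X n)) (h x)"
proof (rule D.convI)
  show "p (h (X n) \<ominus> h x) \<le> q (X n \<ominus>\<^bsub>B\<^esub> x)" for n
    using contractive[of "X n \<ominus>\<^bsub>B\<^esub> x"] assms by (simp add: hom_diff)
  show "(\<lambda>n. q (X n \<ominus>\<^bsub>B\<^esub> x)) \<longlonglongrightarrow> 0" using assms(1) unfolding B.conv_def .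
qed (use assms in auto)

end

text \<open>The range of a homomorphism between C*-algebras is closed. Cutting a self-adjoint \<open>b\<close> off at
  \<open>\<plusminus>r\<close> by functional calculus, for \<open>r > p (h b)\<close>, does not change its image; so elements of the range
  lift with control of the norm.\<close>

locale cstar_hom_complete = cstar_hom B q D p h + D: cstar_alg D p
  for B :: "('b, 'y) star_algebra_scheme" and q
    and D :: "('a, 'z) star_algebra_scheme" (structure) and p and h
begin

lemma lift_self_adjoint:
  assumes b: "b \<in> B.C" "b\<dagger>\<^bsub>B\<^esub> = b" and r: "p (h b) < r"
  obtains b' where "b' \<in> B.C" "h b' = h b" "q b' \<le> r"
proof -
  have r0: "r > 0" using r D.p_nonneg[OF hom_closed[OF b(1)]] by linarith
  define R where "R = q b + r"
  have R: "q b \<le> R" "R > 0" "r \<le> R" unfolding R_def using r0 B.p_nonneg[OF b(1)] by auto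
  define f where "f t = max (- r) (min r t)" for t
  have "continuous_on {-R..R} f" "f 0 = 0" unfolding f_def using r0 by (auto intro!: continuous_intros)
  then obtain s b' where s: "\<And>n t. \<bar>t\<bar> \<le> R \<Longrightarrow> \<bar>f t - poly (pCons 0 (s n)) t\<bar> < 1 / real (Suc n)"
    and b': "b' \<in> B.C" "B.conv (\<lambda>n. B.poly_act b (s n) b) b'"
    using B.continuous_calculus[OF b R(1,2)] by metis
  have lim0: "(\<lambda>n. 1 / real (Suc n)) \<longlonglongrightarrow> 0"
    using LIMSEQ_inverse_real_of_nat by (simp add: divide_inverse)
  define a where "a = h b"
  have a: "a \<in> D.C" "a\<dagger> = a" using b hom_star[OF b(1)] unfolding a_def by auto
  have "D.conv (\<lambda>n. h (B.poly_act b (s n) b)) (h b')"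
    using b b' by (intro hom_conv) auto
  moreover have "D.conv (\<lambda>n. h (B.poly_act b (s n) b)) a"
  proof (rule D.convI[OF _ lim0])
    fix n
    have "p (D.poly_act a (s n - 1) a) \<le> 1 / real (Suc n)"
    proof (rule D.poly_act_self_le_sup[OF a _ r0])
      fix t assume t: "\<bar>t\<bar> \<le> r"
      then have "f t = t" unfolding f_def by auto
      moreover have "poly (pCons 0 (s n - 1)) t = poly (pCons 0 (s n)) t - t" by (simp add: algebra_simps)
      ultimately show "\<bar>poly (pCons 0 (s n - 1)) t\<bar> \<le> 1 / real (Suc n)"
        using s[of t n] t R(3) by simp
    qed (use r a_def in simp)
    then show "p (h (B.poly_act b (s n) b) \<ominus> a) \<le> 1 / real (Suc n)"
      using a b by (simp add: hom_poly_act D.poly_act_diff_poly a_def)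
  qed (use a b in auto)
  ultimately have "h b' = a" by (rule D.conv_unique) (use a b b' in auto)
  moreover have "q b' \<le> r"
  proof -
    have "q (B.poly_act b (s n) b) \<le> r + 1 / real (Suc n)" for n
    proof (rule B.poly_act_self_le_sup[OF b R(1,2)])
      fix t assume t: "\<bar>t\<bar> \<le> R"
      have "\<bar>f t\<bar> \<le> r" unfolding f_def using r0 by auto
      then show "\<bar>poly (pCons 0 (s n)) t\<bar> \<le> r + 1 / real (Suc n)" using s[OF t, of n] by linarith
    qed
    moreover have "(\<lambda>n. q (B.poly_act b (s n) b)) \<longlonglongrightarrow> q b'"
      using b b' by (intro B.conv_norm) auto
    moreover have "(\<lambda>n. r + 1 / real (Suc n)) \<longlonglongrightarrow> r + 0"
      by (intro tendsto_add tendsto_const lim0)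
    ultimately show ?thesis using LIMSEQ_le[of _ "q b'" _ "r + 0"] by force
  qed
  ultimately show ?thesis using that b' a_def by blast
qed

lemma lift_norm_control:
  assumes b: "b \<in> B.C" and r: "p (h b) < r"
  obtains b' where "b' \<in> B.C" "h b' = h b" "q b' \<le> 2 * r"
proof -
  define b1 where "b1 = (1/2) \<odot>\<^bsub>B\<^esub> (b \<oplus>\<^bsub>B\<^esub> b\<dagger>\<^bsub>B\<^esub>)"
  define b2 where "b2 = (-\<i>/2) \<odot>\<^bsub>B\<^esub> (b \<oplus>\<^bsub>B\<^esub> (-1) \<odot>\<^bsub>B\<^esub> b\<dagger>\<^bsub>B\<^esub>)"
  have bs: "b1 \<in> B.C" "b2 \<in> B.C" "b1\<dagger>\<^bsub>B\<^esub> = b1" "b2\<dagger>\<^bsub>B\<^esub> = b2"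
    unfolding b1_def b2_def using b
    by (auto simp: B.star_scale B.star_add B.scale_add_right B.add_commute)
  have split: "b = b1 \<oplus>\<^bsub>B\<^esub> \<i> \<odot>\<^bsub>B\<^esub> b2"
  proof -
    have "b1 \<oplus>\<^bsub>B\<^esub> \<i> \<odot>\<^bsub>B\<^esub> b2 =
        ((1/2) \<odot>\<^bsub>B\<^esub> b \<oplus>\<^bsub>B\<^esub> (1/2) \<odot>\<^bsub>B\<^esub> b) \<oplus>\<^bsub>B\<^esub> ((1/2) \<odot>\<^bsub>B\<^esub> b\<dagger>\<^bsub>B\<^esub> \<oplus>\<^bsub>B\<^esub> (-1/2) \<odot>\<^bsub>B\<^esub> b\<dagger>\<^bsub>B\<^esub>)"
      unfolding b1_def b2_def using b by (simp add: B.scale_add_right B.add_ac)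
    also have "\<dots> = b" using b by (simp add: B.scale_add_left[symmetric])
    finally show ?thesis by simp
  qed
  have half: "p ((1/2) \<odot> u \<oplus> c \<odot> v) < r"
    if "u \<in> D.C" "v \<in> D.C" "cmod c = 1/2" "p u < r" "p v < r" for u v c
    using D.p_add[of "(1/2) \<odot> u" "c \<odot> v"] that by (simp add: D.p_scale)
  have "p (h b1) < r"
    using half[of "h b" "h (b\<dagger>\<^bsub>B\<^esub>)" "1/2"] b r unfolding b1_def
    by (simp add: hom_scale hom_add hom_star D.scale_add_right)
  moreover have "p (h b2) < r"
  proof -
    have "h b2 = (-\<i>) \<odot> ((1/2) \<odot> h b \<oplus> (-1/2) \<odot> (h b)\<dagger>)"
      unfolding b2_def using b by (simp add: hom_scale hom_add hom_star D.scale_add_right)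
    then show ?thesis using half[of "h b" "h (b\<dagger>\<^bsub>B\<^esub>)" "-1/2"] b r
      by (simp add: D.p_scale hom_star)
  qed
  ultimately obtain c1 c2 where c: "c1 \<in> B.C" "h c1 = h b1" "q c1 \<le> r"
      "c2 \<in> B.C" "h c2 = h b2" "q c2 \<le> r"
    using lift_self_adjoint bs by metis
  show ?thesis
  proof (rule that)
    show "c1 \<oplus>\<^bsub>B\<^esub> \<i> \<odot>\<^bsub>B\<^esub> c2 \<in> B.C" using c by simp
    show "h (c1 \<oplus>\<^bsub>B\<^esub> \<i> \<odot>\<^bsub>B\<^esub> c2) = h b" using c bs by (subst split) (simp add: hom_add hom_scale)
    show "q (c1 \<oplus>\<^bsub>B\<^esub> \<i> \<odot>\<^bsub>B\<^esub> c2) \<le> 2 * r"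
      using B.p_add[of c1 "\<i> \<odot>\<^bsub>B\<^esub> c2"] c by (simp add: B.p_scale)
  qed
qed

theorem range_closed:
  assumes Y: "\<And>n. Y n \<in> h ` B.C" and l: "l \<in> D.C" "D.conv Y l"
  shows "l \<in> h ` B.C"
proof -
  have "\<exists>b\<in>B.C. p (h b \<ominus> l) < (1/2) ^ n / 2" for n :: nat
  proof -
    have "\<forall>\<^sub>F m in sequentially. p (Y m \<ominus> l) < (1/2) ^ n / 2"
      using l(2) unfolding D.conv_def by (rule order_tendstoD) simp
    then obtain m where "p (Y m \<ominus> l) < (1/2) ^ n / 2" by (auto simp: eventually_sequentially)
    then show ?thesis using Y[of m] by auto
  qed
  then obtain W where W: "\<And>n. W n \<in> B.C" "\<And>n. p (h (W n) \<ominus> l) < (1/2) ^ n / 2" by metis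
  have close: "p (h (W (Suc n) \<ominus>\<^bsub>B\<^esub> W n)) < (1/2) ^ n" for n
  proof -
    have "p (h (W (Suc n)) \<ominus> h (W n)) \<le> p (h (W (Suc n)) \<ominus> l) + p (h (W n) \<ominus> l)"
      using D.p_triangle[of "h (W (Suc n))" l "h (W n)"] W l D.p_diff_commute[of l "h (W n)"] by simp
    also have "\<dots> < (1/2) ^ n"
    proof -
      have "(1/2 :: real) ^ Suc n / 2 \<le> (1/2) ^ n / 2" by simp
      then show ?thesis using W(2)[of n] W(2)[of "Suc n"] by linarith
    qed
    finally show ?thesis using W by (simp add: hom_diff)
  qed
  have "\<exists>c. c \<in> B.C \<and> h c = h (W (Suc n) \<ominus>\<^bsub>B\<^esub> W n) \<and> q c \<le> 2 * (1/2) ^ n" for n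
    using lift_norm_control[OF _ close[of n]] W by (metis B.diff_closed)
  then obtain c where c: "\<And>n. c n \<in> B.C" "\<And>n. h (c n) = h (W (Suc n) \<ominus>\<^bsub>B\<^esub> W n)"
      "\<And>n. q (c n) \<le> 2 * (1/2) ^ n" by metis
  define Z where "Z = rec_nat (W 0) (\<lambda>n z. c n \<oplus>\<^bsub>B\<^esub> z)"
  have Z_rec: "Z 0 = W 0" "Z (Suc n) = c n \<oplus>\<^bsub>B\<^esub> Z n" for n unfolding Z_def by auto
  have Z: "Z n \<in> B.C" for n by (induction n) (auto simp: Z_rec W c)
  have hZ: "h (Z n) = h (W n)" for n
  proof (induction n)
    case (Suc n)
    then show ?case using Z c W by (simp add: Z_rec hom_add hom_diff D.diff_add_cancel)
  qed (simp add: Z_rec)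
  have "B.is_cauchy Z"
  proof (rule B.is_cauchy_geometric)
    show "q (Z (Suc n) \<ominus>\<^bsub>B\<^esub> Z n) \<le> 2 * (1/2) ^ n" for n
      using c Z unfolding Z_rec alg_diff_def by (simp add: B.add_assoc)
  qed (use Z in auto)
  then obtain z where z: "z \<in> B.C" "B.conv Z z" using B.p_complete Z by blast
  have "D.conv (\<lambda>n. h (Z n)) (h z)" using Z z by (intro hom_conv)
  moreover have "D.conv (\<lambda>n. h (Z n)) l"
  proof (rule D.convI)
    show "p (h (Z n) \<ominus> l) \<le> (1/2) ^ n / 2" for n using W(2)[of n] hZ[of n] by simp
    show "(\<lambda>n. (1/2) ^ n / 2 :: real) \<longlonglongrightarrow> 0"
      using tendsto_divide[OF LIMSEQ_power_zero[of "1/2 :: real"] tendsto_const[of 2]] by simp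
  qed (use Z l in auto)
  ultimately have "h z = l" by (rule D.conv_unique) (use Z z l in auto)
  then show ?thesis using z by blast
qed

end

section \<open>Closed ideals\<close>

text \<open>Here the C*-norm is the one stored in the record, which is the one in the definition of closed
  ideals.\<close>

locale cstar_normed = cstar_alg D "alg_norm D"
  for D :: "('a, 'z) normed_star_algebra_scheme" (structure)
begin

lemma closed_ideal_subset: "closed_ideal D J \<Longrightarrow> x \<in> J \<Longrightarrow> x \<in> C"
  unfolding closed_ideal_def by blast

lemma closed_ideal_zero: "closed_ideal D J \<Longrightarrow> \<zero> \<in> J"
  unfolding closed_ideal_def by blast

lemma closed_ideal_add: "\<lbrakk>closed_ideal D J; x \<in> J; y \<in> J\<rbrakk> \<Longrightarrow> x \<oplus> y \<in> J"
  unfolding closed_ideal_def by blast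

lemma closed_ideal_scale: "\<lbrakk>closed_ideal D J; x \<in> J\<rbrakk> \<Longrightarrow> c \<odot> x \<in> J"
  unfolding closed_ideal_def by blast

lemma closed_ideal_mult_left: "\<lbrakk>closed_ideal D J; a \<in> C; x \<in> J\<rbrakk> \<Longrightarrow> a \<otimes> x \<in> J"
  unfolding closed_ideal_def by blast

lemma closed_ideal_mult_right: "\<lbrakk>closed_ideal D J; a \<in> C; x \<in> J\<rbrakk> \<Longrightarrow> x \<otimes> a \<in> J"
  unfolding closed_ideal_def by blast

lemma closed_ideal_closed:
  "\<lbrakk>closed_ideal D J; \<And>n. X n \<in> J; l \<in> C; conv X l\<rbrakk> \<Longrightarrow> l \<in> J"
  unfolding closed_ideal_def conv_def by blast

lemma closed_idealI:
  assumes "J \<subseteq> C" "\<zero> \<in> J" "\<And>x y. x \<in> J \<Longrightarrow> y \<in> J \<Longrightarrow> x \<oplus> y \<in> J" "\<And>c x. x \<in> J \<Longrightarrow> c \<odot> x \<in> J"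
    "\<And>a x. a \<in> C \<Longrightarrow> x \<in> J \<Longrightarrow> a \<otimes> x \<in> J" "\<And>a x. a \<in> C \<Longrightarrow> x \<in> J \<Longrightarrow> x \<otimes> a \<in> J"
    "\<And>X l. (\<And>n. X n \<in> J) \<Longrightarrow> l \<in> C \<Longrightarrow> conv X l \<Longrightarrow> l \<in> J"
  shows "closed_ideal D J"
  unfolding closed_ideal_def
proof (intro conjI ballI allI impI)
  fix X l assume "l \<in> C" "(\<forall>n. X n \<in> J) \<and> (\<lambda>n. alg_norm D (X n \<ominus> l)) \<longlonglongrightarrow> 0"
  then show "l \<in> J" using assms(7)[of X l] unfolding conv_def by blast
qed (use assms in auto)

lemma closed_ideal_approx:
  assumes J: "closed_ideal D J" and x: "x \<in> C"
    and approx: "\<And>\<epsilon>. \<epsilon> > 0 \<Longrightarrow> \<exists>y\<in>J. alg_norm D (y \<ominus> x) < \<epsilon>"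
  shows "x \<in> J"
proof -
  obtain Y where Y: "\<And>n. Y n \<in> J" "\<And>n. alg_norm D (Y n \<ominus> x) < inverse (real (Suc n))"
    using approx[of "inverse (real (Suc _))"] by (metis inverse_positive_iff_positive of_nat_0_less_iff zero_less_Suc)
  have "conv Y x"
    using Y x closed_ideal_subset[OF J]
    by (intro convI[OF _ LIMSEQ_inverse_real_of_nat]) (auto intro: less_imp_le)
  then show ?thesis by (rule closed_ideal_closed[OF J Y(1) x])
qed

lemma closed_ideal_zero_set: "closed_ideal D {\<zero>}"
proof (rule closed_idealI)
  fix X l assume "\<And>n. X n \<in> {\<zero>}" "l \<in> C" "conv X l"
  then show "l \<in> {\<zero>}" using conv_unique[of X l \<zero>] by (simp add: conv_def)
qed auto

lemma closed_ideal_Inter: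
  assumes "\<F> \<noteq> {}" "\<And>J. J \<in> \<F> \<Longrightarrow> closed_ideal D J"
  shows "closed_ideal D (\<Inter>\<F>)"
proof (rule closed_idealI)
  show "\<Inter>\<F> \<subseteq> C" using assms closed_ideal_subset by blast
  fix X l assume "\<And>n. X n \<in> \<Inter>\<F>" "l \<in> C" "conv X l"
  then show "l \<in> \<Inter>\<F>" using closed_ideal_closed[OF assms(2)] by blast
qed (use assms in \<open>auto intro: closed_ideal_zero closed_ideal_add closed_ideal_scale
    closed_ideal_mult_left closed_ideal_mult_right\<close>)

lemma poly_act_self_in_ideal:
  assumes J: "closed_ideal D J" and b: "b \<in> J"
  shows "poly_act b q b \<in> J"
proof -
  have "b \<in> C" using J b closed_ideal_subset by blast
  then show ?thesis
    by (induction q) (use J b in \<open>auto intro: closed_ideal_zero closed_ideal_add closed_ideal_scale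
        closed_ideal_mult_left\<close>)
qed

text \<open>With \<open>b = a\<dagger> a\<close>, the elements \<open>a Q(b)\<close> converge to \<open>a\<close> as soon as \<open>t (1 - Q(t))\<^sup>2\<close> tends to \<open>0\<close>
  uniformly on an interval around the spectrum of \<open>b\<close>.\<close>

lemma star_mult_self_in_ideal:
  assumes J: "closed_ideal D J" and a: "a \<in> C" and b: "a\<dagger> \<otimes> a \<in> J"
  shows "a \<in> J"
proof -
  define b where "b = a\<dagger> \<otimes> a"
  have bC: "b \<in> C" "b\<dagger> = b" unfolding b_def using a by (auto simp: star_mult)
  \<comment> \<open>The summand \<open>1\<close> only makes the interval nondegenerate.\<close>
  define r where "r = alg_norm D b + 1"
  have r: "alg_norm D b \<le> r" "r > 0" unfolding r_def using p_nonneg[OF bC(1)] by auto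
  have "\<exists>q. \<forall>t. \<bar>t\<bar> \<le> r \<longrightarrow> \<bar>min 1 (\<bar>t\<bar> * real (Suc n)) - poly (pCons 0 q) t\<bar> < inverse (real (Suc n))" for n
    using r by (intro weierstrass_vanishing_at_zero) (auto intro!: continuous_intros)
  then obtain q where q: "\<And>n t. \<bar>t\<bar> \<le> r \<Longrightarrow>
      \<bar>min 1 (\<bar>t\<bar> * real (Suc n)) - poly (pCons 0 (q n)) t\<bar> < inverse (real (Suc n))" by metis
  define e where "e n = inverse (real (Suc n))" for n
  define x where "x n = a \<otimes> poly_act b (q n) b" for n
  have x: "x n \<in> J" for n
    unfolding x_def using poly_act_self_in_ideal[OF J] b a J
    by (simp add: b_def closed_ideal_mult_left)
  have bound: "(alg_norm D (x n \<ominus> a))\<^sup>2 \<le> 2 * e n + 2 * r * (e n)\<^sup>2" for n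
  proof -
    define Q where "Q = pCons 0 (q n)"
    define u where "u = poly_act b (q n) b"
    have u: "u \<in> C" "u\<dagger> = u" unfolding u_def using bC by (auto intro: poly_act_star_self)
    have uz: "u \<otimes> z = poly_act b Q z" if "z \<in> C" for z
      unfolding u_def Q_def using bC that
      by (simp add: poly_act_mult_right[symmetric] poly_act_mult_self)
    have bu: "b \<otimes> u = u \<otimes> b"
      unfolding uz[OF bC(1)] unfolding u_def Q_def using bC by simp
    have ab: "a\<dagger> \<otimes> a = b" "a\<dagger> \<otimes> (a \<otimes> z) = b \<otimes> z" if "z \<in> C" for z
      unfolding b_def using a that by (auto simp: mult_assoc)
    have "(a \<ominus> a \<otimes> u)\<dagger> \<otimes> (a \<ominus> a \<otimes> u) = (b \<ominus> u \<otimes> b) \<ominus> (b \<otimes> u \<ominus> u \<otimes> (b \<otimes> u))"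
      using a u bC by (simp add: star_diff star_mult mult_diff_left mult_diff_right mult_assoc ab)
    also have "\<dots> = poly_act b ((1 - Q) * (1 - Q)) b"
      unfolding bu using u bC
      by (simp add: uz poly_act_mult_poly poly_act_diff_poly poly_act_diff)
    finally have eq: "(a \<ominus> a \<otimes> u)\<dagger> \<otimes> (a \<ominus> a \<otimes> u) = poly_act b ((1 - Q) * (1 - Q)) b" .
    have "(alg_norm D (x n \<ominus> a))\<^sup>2 = (alg_norm D (a \<ominus> a \<otimes> u))\<^sup>2"
      unfolding x_def u_def[symmetric] using p_diff_commute[of "a \<otimes> u" a] a u by simp
    also have "\<dots> = alg_norm D (poly_act b ((1 - Q) * (1 - Q)) b)"
      using p_star_mult[of "a \<ominus> a \<otimes> u"] a u eq by simp
    also have "\<dots> \<le> 2 * e n + 2 * r * (e n)\<^sup>2"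
    proof (rule poly_act_self_le_sup[OF bC r])
      fix t assume t: "\<bar>t\<bar> \<le> r"
      define f where "f = min 1 (\<bar>t\<bar> * real (Suc n))"
      have f: "\<bar>t\<bar> * (1 - f)\<^sup>2 \<le> e n"
      proof (cases "\<bar>t\<bar> * real (Suc n) \<le> 1")
        case True
        then have "\<bar>t\<bar> \<le> e n" unfolding e_def by (simp add: field_simps)
        moreover have "(1 - f)\<^sup>2 \<le> 1"
          using True unfolding f_def by (simp add: power_le_one)
        ultimately show ?thesis using mult_mono[of "\<bar>t\<bar>" "e n" "(1 - f)\<^sup>2" 1] by (simp add: e_def)
      next
        case False
        then have "f = 1" unfolding f_def by simp
        then show ?thesis by (simp add: e_def)
      qed
      have fQ: "\<bar>f - poly Q t\<bar> \<le> e n" unfolding f_def Q_def e_def using q[OF t, of n] by simp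
      have "(1 - poly Q t)\<^sup>2 \<le> 2 * (1 - f)\<^sup>2 + 2 * (f - poly Q t)\<^sup>2"
        using sum_squares_bound[of "1 - f" "f - poly Q t"] by (simp add: power2_eq_square algebra_simps)
      also have "\<dots> \<le> 2 * (1 - f)\<^sup>2 + 2 * (e n)\<^sup>2"
        using power_mono[OF fQ, of 2] by simp
      finally have "\<bar>t\<bar> * (1 - poly Q t)\<^sup>2 \<le> \<bar>t\<bar> * (2 * (1 - f)\<^sup>2 + 2 * (e n)\<^sup>2)"
        by (intro mult_left_mono) auto
      also have "\<dots> = 2 * (\<bar>t\<bar> * (1 - f)\<^sup>2) + 2 * \<bar>t\<bar> * (e n)\<^sup>2" by (simp add: algebra_simps)
      also have "\<dots> \<le> 2 * e n + 2 * r * (e n)\<^sup>2"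
        using f t by (intro add_mono mult_right_mono mult_left_mono) auto
      finally show "\<bar>poly (pCons 0 ((1 - Q) * (1 - Q))) t\<bar> \<le> 2 * e n + 2 * r * (e n)\<^sup>2"
        by (simp add: abs_mult power2_eq_square)
    qed
    finally show ?thesis .
  qed
  have "(\<lambda>n. 2 * e n + 2 * r * (e n)\<^sup>2) \<longlonglongrightarrow> 2 * 0 + 2 * r * 0\<^sup>2"
    unfolding e_def by (intro tendsto_intros LIMSEQ_inverse_real_of_nat)
  then have "(\<lambda>n. sqrt (2 * e n + 2 * r * (e n)\<^sup>2)) \<longlonglongrightarrow> sqrt 0"
    by (intro tendsto_real_sqrt) simp
  moreover have "alg_norm D (x n \<ominus> a) \<le> sqrt (2 * e n + 2 * r * (e n)\<^sup>2)" for n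
    using bound by (rule real_le_rsqrt)
  ultimately have "conv x a"
    using x J a by (intro convI) (auto intro: closed_ideal_subset)
  then show ?thesis by (rule closed_ideal_closed[OF J x a])
qed

text \<open>If \<open>w a c = c\<close> then \<open>c\<close> lies in every closed ideal \<open>K\<close> close enough to \<open>a\<close>: modulo \<open>K\<close>, the
  element \<open>c\<close> equals \<open>(w a - w k)\<^sup>n c\<close>, which has norm at most \<open>2\<^sup>-\<^sup>n \<parallel>c\<parallel>\<close>.\<close>

lemma local_unit_in_close_ideal:
  assumes K: "closed_ideal D K" and wac: "w \<in> C" "a \<in> C" "c \<in> C" "w \<otimes> a \<otimes> c = c"
    and k: "k \<in> K" "alg_norm D w * alg_norm D (a \<ominus> k) \<le> 1/2"
  shows "c \<in> K"
proof -
  have kC: "k \<in> C" using K k closed_ideal_subset by blast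
  have ex: "\<exists>y\<in>K. alg_norm D (c \<ominus> y) \<le> (1/2) ^ n * alg_norm D c" for n
  proof (induction n)
    case 0
    show ?case using K wac closed_ideal_zero by (intro bexI[of _ \<zero>]) auto
  next
    case (Suc n)
    then obtain y where y: "y \<in> K" "alg_norm D (c \<ominus> y) \<le> (1/2) ^ n * alg_norm D c" by blast
    have yC: "y \<in> C" using K y closed_ideal_subset by blast
    define y' where "y' = w \<otimes> a \<otimes> y \<oplus> w \<otimes> k \<otimes> (c \<ominus> y)"
    have "w \<otimes> a \<otimes> y \<in> K" using closed_ideal_mult_left[OF K _ y(1), of "w \<otimes> a"] wac by simp
    moreover have "w \<otimes> k \<otimes> (c \<ominus> y) \<in> K"
      using closed_ideal_mult_right[OF K _ closed_ideal_mult_left[OF K wac(1) k(1)], of "c \<ominus> y"] wac yC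
      by simp
    ultimately have "y' \<in> K" unfolding y'_def by (rule closed_ideal_add[OF K])
    moreover have "alg_norm D (c \<ominus> y') \<le> (1/2) ^ Suc n * alg_norm D c"
    proof -
      have "w \<otimes> (a \<ominus> k) \<otimes> (c \<ominus> y) = w \<otimes> a \<otimes> (c \<ominus> y) \<ominus> w \<otimes> k \<otimes> (c \<ominus> y)"
        using wac kC yC by (simp add: mult_diff_left mult_diff_right[of a k w])
      also have "w \<otimes> a \<otimes> (c \<ominus> y) = c \<ominus> w \<otimes> a \<otimes> y"
        using wac yC by (simp add: mult_diff_right)
      also have "c \<ominus> w \<otimes> a \<otimes> y \<ominus> w \<otimes> k \<otimes> (c \<ominus> y) = c \<ominus> y'"
        unfolding y'_def alg_diff_def using wac kC yC by (simp add: scale_add_right add_assoc)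
      finally have "alg_norm D (c \<ominus> y') = alg_norm D (w \<otimes> (a \<ominus> k) \<otimes> (c \<ominus> y))" by simp
      also have "\<dots> \<le> alg_norm D (w \<otimes> (a \<ominus> k)) * alg_norm D (c \<ominus> y)"
        using wac kC yC by (intro p_mult) auto
      also have "\<dots> \<le> (alg_norm D w * alg_norm D (a \<ominus> k)) * alg_norm D (c \<ominus> y)"
        using wac kC yC by (intro mult_right_mono p_mult) auto
      also have "\<dots> \<le> 1/2 * ((1/2) ^ n * alg_norm D c)"
        using wac kC yC k y by (intro mult_mono) auto
      finally show ?thesis by simp
    qed
    ultimately show ?case by blast
  qed
  then obtain Y where Y: "\<And>n. Y n \<in> K" "\<And>n. alg_norm D (c \<ominus> Y n) \<le> (1/2) ^ n * alg_norm D c" by metis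
  have "conv Y c"
  proof (rule convI)
    show "alg_norm D (Y n \<ominus> c) \<le> (1/2) ^ n * alg_norm D c" for n
      using Y[of n] p_diff_commute[of c "Y n"] wac K closed_ideal_subset by simp
    show "(\<lambda>n. (1/2) ^ n * alg_norm D c) \<longlonglongrightarrow> 0"
      by (intro tendsto_mult_left_zero LIMSEQ_power_zero) simp
  qed (use Y wac K closed_ideal_subset in auto)
  then show ?thesis by (rule closed_ideal_closed[OF K Y(1) wac(3)])
qed

end

section \<open>The completion of a C*-seminormed *-algebra\<close>

text \<open>Definiteness is not assumed: the completion identifies Cauchy sequences whose difference tends to zero,
  so the completion of a C*-seminormed algebra is a C*-algebra as well.\<close>

locale cstar_prenormed = cstar_seminormed D "alg_norm D"
  for D :: "('a, 'z) normed_star_algebra_scheme" (structure)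
begin

abbreviation nrm :: "'a \<Rightarrow> real" where "nrm \<equiv> alg_norm D"

abbreviation CS :: "(nat \<Rightarrow> 'a) set" where "CS \<equiv> cauchy_seqs D"

text \<open>The element of the completion that a Cauchy sequence represents.\<close>

definition cls :: "(nat \<Rightarrow> 'a) \<Rightarrow> (nat \<Rightarrow> 'a) set" where
  "cls X = null_rel D `` {X}"

lemma CS_iff: "X \<in> CS \<longleftrightarrow> (\<forall>n. X n \<in> C) \<and> is_cauchy X"
  unfolding cauchy_seqs_def is_cauchy_def by simp

lemma CS_closed [simp]: "X \<in> CS \<Longrightarrow> X n \<in> C"
  by (simp add: CS_iff)

lemma CS_const [simp]: "x \<in> C \<Longrightarrow> (\<lambda>n. x) \<in> CS"
  by (auto simp: CS_iff is_cauchy_def)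

lemma CS_norm_convergent:
  assumes "X \<in> CS"
  shows "convergent (\<lambda>n. nrm (X n))"
proof (rule Cauchy_convergent, rule metric_CauchyI)
  fix \<epsilon> :: real assume "\<epsilon> > 0"
  then obtain N where N: "\<And>m n. m \<ge> N \<Longrightarrow> n \<ge> N \<Longrightarrow> nrm (X m \<ominus> X n) < \<epsilon>"
    using assms unfolding CS_iff is_cauchy_def by blast
  have "dist (nrm (X m)) (nrm (X n)) < \<epsilon>" if "m \<ge> N" "n \<ge> N" for m n
    using p_abs_diff[of "X m" "X n"] N[OF that] assms by (simp add: dist_real_def)
  then show "\<exists>M. \<forall>m\<ge>M. \<forall>n\<ge>M. dist (nrm (X m)) (nrm (X n)) < \<epsilon>" by blast
qed

lemma CS_bounded:
  assumes "X \<in> CS"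
  obtains M where "M > 0" "\<And>n. nrm (X n) \<le> M"
proof -
  have "Bseq (\<lambda>n. nrm (X n))" using CS_norm_convergent[OF assms] by (rule convergent_imp_Bseq)
  then obtain M where "M > 0" "\<And>n. norm (nrm (X n)) \<le> M" by (rule BseqE) blast
  then show ?thesis using that by (metis abs_le_D1 real_norm_def)
qed

lemma CS_I:
  assumes closed: "\<And>n. X n \<in> C" and Y: "Y \<in> CS" and Z: "Z \<in> CS" and K: "K \<ge> 0"
    and bound: "\<And>m n. nrm (X m \<ominus> X n) \<le> K * (nrm (Y m \<ominus> Y n) + nrm (Z m \<ominus> Z n))"
  shows "X \<in> CS"
  unfolding CS_iff is_cauchy_def
proof (intro conjI allI impI)
  fix \<epsilon> :: real assume \<epsilon>: "\<epsilon> > 0"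
  define \<delta> where "\<delta> = \<epsilon> / (2 * (K + 1))"
  have \<delta>: "\<delta> > 0" unfolding \<delta>_def using \<epsilon> K by simp
  obtain N1 where N1: "\<And>m n. m \<ge> N1 \<Longrightarrow> n \<ge> N1 \<Longrightarrow> nrm (Y m \<ominus> Y n) < \<delta>"
    using Y \<delta> unfolding CS_iff is_cauchy_def by blast
  obtain N2 where N2: "\<And>m n. m \<ge> N2 \<Longrightarrow> n \<ge> N2 \<Longrightarrow> nrm (Z m \<ominus> Z n) < \<delta>"
    using Z \<delta> unfolding CS_iff is_cauchy_def by blast
  have "nrm (X m \<ominus> X n) < \<epsilon>" if "m \<ge> max N1 N2" "n \<ge> max N1 N2" for m n
  proof -
    have "nrm (X m \<ominus> X n) \<le> K * (2 * \<delta>)"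
      using bound[of m n] N1[of m n] N2[of m n] that K
      by (smt (verit) max.boundedE mult_left_mono)
    also have "\<dots> < (K + 1) * (2 * \<delta>)" using \<delta> by (intro mult_strict_right_mono) auto
    also have "\<dots> = \<epsilon>" unfolding \<delta>_def using K by (simp add: field_simps)
    finally show ?thesis .
  qed
  then show "\<exists>N. \<forall>m\<ge>N. \<forall>n\<ge>N. nrm (X m \<ominus> X n) < \<epsilon>" by blast
qed (rule closed)

lemma CS_add [simp]: "X \<in> CS \<Longrightarrow> Y \<in> CS \<Longrightarrow> (\<lambda>n. X n \<oplus> Y n) \<in> CS"
  by (rule CS_I[of _ X Y 1]) (auto simp: add_diff_add p_add)

lemma CS_scale [simp]: "X \<in> CS \<Longrightarrow> (\<lambda>n. c \<odot> X n) \<in> CS"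
  by (rule CS_I[of _ X X "cmod c"]) (auto simp: scale_diff[symmetric] p_scale mult_left_mono)

lemma CS_star [simp]: "X \<in> CS \<Longrightarrow> (\<lambda>n. (X n)\<dagger>) \<in> CS"
  by (rule CS_I[of _ X X 1]) (auto simp: star_diff[symmetric])

lemma mult_diff_bound:
  assumes "x \<in> C" "y \<in> C" "x' \<in> C" "y' \<in> C" "nrm x \<le> M" "nrm y' \<le> M"
  shows "nrm (x \<otimes> y \<ominus> x' \<otimes> y') \<le> M * (nrm (x \<ominus> x') + nrm (y \<ominus> y'))"
proof -
  have "nrm (x \<otimes> y \<ominus> x' \<otimes> y') \<le> nrm (x \<otimes> (y \<ominus> y')) + nrm ((x \<ominus> x') \<otimes> y')"
    using p_triangle[of "x \<otimes> y" "x \<otimes> y'" "x' \<otimes> y'"] assms by (simp add: mult_diff_left mult_diff_right)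
  also have "\<dots> \<le> nrm x * nrm (y \<ominus> y') + nrm (x \<ominus> x') * nrm y'"
    using assms by (intro add_mono p_mult) auto
  also have "\<dots> \<le> M * nrm (y \<ominus> y') + nrm (x \<ominus> x') * M"
    using assms by (intro add_mono mult_right_mono mult_left_mono) auto
  finally show ?thesis by (simp add: algebra_simps)
qed

lemma CS_mult [simp]:
  assumes "X \<in> CS" "Y \<in> CS"
  shows "(\<lambda>n. X n \<otimes> Y n) \<in> CS"
proof -
  obtain M1 where M1: "M1 > 0" "\<And>n. nrm (X n) \<le> M1" using CS_bounded[OF assms(1)] by metis
  obtain M2 where M2: "M2 > 0" "\<And>n. nrm (Y n) \<le> M2" using CS_bounded[OF assms(2)] by metis
  show ?thesis
  proof (rule CS_I[of _ X Y "max M1 M2"])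
    show "nrm (X m \<otimes> Y m \<ominus> X n \<otimes> Y n) \<le> max M1 M2 * (nrm (X m \<ominus> X n) + nrm (Y m \<ominus> Y n))" for m n
      using assms M1(2)[of m] M2(2)[of n] by (intro mult_diff_bound) auto
  qed (use assms M1 in auto)
qed

lemma equiv_null_rel: "equiv CS (null_rel D)"
proof (rule equivI)
  show "null_rel D \<subseteq> CS \<times> CS" unfolding null_rel_def by auto
  show "refl_on CS (null_rel D)" unfolding refl_on_def null_rel_def by auto
  show "sym (null_rel D)"
    unfolding sym_def null_rel_def using p_diff_commute by auto
  show "trans (null_rel D)"
  proof (rule transI)
    fix X Y Z assume XY: "(X, Y) \<in> null_rel D" and YZ: "(Y, Z) \<in> null_rel D"
    have lim: "(\<lambda>n. nrm (X n \<ominus> Y n) + nrm (Y n \<ominus> Z n)) \<longlonglongrightarrow> 0"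
      using XY YZ unfolding null_rel_def by (intro tendsto_add_zero) auto
    have "(\<lambda>n. nrm (X n \<ominus> Z n)) \<longlonglongrightarrow> 0"
      by (rule tendsto_sandwich[OF _ _ tendsto_const lim])
        (use XY YZ in \<open>auto intro!: always_eventually p_triangle simp: null_rel_def\<close>)
    then show "(X, Z) \<in> null_rel D" using XY YZ unfolding null_rel_def by auto
  qed
qed

lemma cls_eq:
  assumes "X \<in> CS" "Y \<in> CS"
  shows "cls X = cls Y \<longleftrightarrow> (\<lambda>n. nrm (X n \<ominus> Y n)) \<longlonglongrightarrow> 0"
  using eq_equiv_class_iff[OF equiv_null_rel assms] assms
  by (simp add: cls_def null_rel_def)

lemma cls_eqI:
  assumes "X \<in> CS" "Y \<in> CS" "\<And>n. nrm (X n \<ominus> Y n) \<le> e n" "e \<longlonglongrightarrow> 0"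
  shows "cls X = cls Y"
  unfolding cls_eq[OF assms(1,2)]
  by (rule tendsto_sandwich[OF _ _ tendsto_const assms(4)]) (use assms in \<open>auto intro: always_eventually\<close>)

lemma mem_cls:
  assumes "X \<in> CS"
  shows "Y \<in> cls X \<longleftrightarrow> Y \<in> CS \<and> cls Y = cls X"
  using assms equiv_class_eq_iff[OF equiv_null_rel, of X Y] unfolding cls_def by auto

lemma completion_carrier: "alg_carrier (completion D) = cls ` CS"
  unfolding completion_def cls_def quotient_def by auto

lemma cls_closed [simp]: "X \<in> CS \<Longrightarrow> cls X \<in> alg_carrier (completion D)"
  by (simp add: completion_carrier)

lemma completion_cases:
  assumes "U \<in> alg_carrier (completion D)"
  obtains X where "X \<in> CS" "U = cls X"
  using assms unfolding completion_carrier by blast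

lemma completion_map_cls:
  assumes X: "X \<in> CS" and cong: "\<And>Y. Y \<in> CS \<Longrightarrow> cls Y = cls X \<Longrightarrow> cls (\<lambda>n. \<phi> (Y n)) = cls (\<lambda>n. \<phi> (X n))"
  shows "completion_map D \<phi> (cls X) = cls (\<lambda>n. \<phi> (X n))"
proof -
  have "completion_map D \<phi> (cls X) = (\<Union>Y\<in>cls X. cls (\<lambda>n. \<phi> (Y n)))"
    unfolding completion_map_def cls_def ..
  also have "\<dots> = cls (\<lambda>n. \<phi> (X n))"
    by (rule UN_constant_eq[of X]) (use mem_cls[OF X] X in \<open>auto intro!: cong\<close>)
  finally show ?thesis .
qed

lemma completion_map2_cls:
  assumes X: "X \<in> CS" "Y \<in> CS"
    and cong: "\<And>X' Y'. X' \<in> CS \<Longrightarrow> Y' \<in> CS \<Longrightarrow> cls X' = cls X \<Longrightarrow> cls Y' = cls Y \<Longrightarrow>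
      cls (\<lambda>n. \<phi> (X' n) (Y' n)) = cls (\<lambda>n. \<phi> (X n) (Y n))"
  shows "completion_map2 D \<phi> (cls X) (cls Y) = cls (\<lambda>n. \<phi> (X n) (Y n))"
proof -
  have "completion_map2 D \<phi> (cls X) (cls Y) = (\<Union>X'\<in>cls X. \<Union>Y'\<in>cls Y. cls (\<lambda>n. \<phi> (X' n) (Y' n)))"
    unfolding completion_map2_def cls_def ..
  also have "\<dots> = cls (\<lambda>n. \<phi> (X n) (Y n))"
  proof (rule UN_constant_eq[of X], simp add: mem_cls X, rule ballI, rule UN_constant_eq[of Y])
    show "Y \<in> cls Y" by (simp add: mem_cls X)
    show "\<forall>Y'\<in>cls Y. cls (\<lambda>n. \<phi> (X' n) (Y' n)) = cls (\<lambda>n. \<phi> (X n) (Y n))" if "X' \<in> cls X" for X'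
    proof
      fix Y' assume "Y' \<in> cls Y"
      then show "cls (\<lambda>n. \<phi> (X' n) (Y' n)) = cls (\<lambda>n. \<phi> (X n) (Y n))"
        using that mem_cls[OF X(1)] mem_cls[OF X(2)] by (intro cong) blast+
    qed
  qed
  finally show ?thesis .
qed

lemma cls_add [simp]:
  assumes "X \<in> CS" "Y \<in> CS"
  shows "cls X \<oplus>\<^bsub>completion D\<^esub> cls Y = cls (\<lambda>n. X n \<oplus> Y n)"
proof -
  have "completion_map2 D (alg_add D) (cls X) (cls Y) = cls (\<lambda>n. X n \<oplus> Y n)"
  proof (rule completion_map2_cls[OF assms])
    fix X' Y' assume *: "X' \<in> CS" "Y' \<in> CS" "cls X' = cls X" "cls Y' = cls Y"
    show "cls (\<lambda>n. X' n \<oplus> Y' n) = cls (\<lambda>n. X n \<oplus> Y n)"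
    proof (rule cls_eqI)
      show "nrm ((X' n \<oplus> Y' n) \<ominus> (X n \<oplus> Y n)) \<le> nrm (X' n \<ominus> X n) + nrm (Y' n \<ominus> Y n)" for n
        using * assms by (simp add: add_diff_add p_add)
      show "(\<lambda>n. nrm (X' n \<ominus> X n) + nrm (Y' n \<ominus> Y n)) \<longlonglongrightarrow> 0"
        using * assms by (intro tendsto_add_zero) (simp_all add: cls_eq)
    qed (use * assms in auto)
  qed
  then show ?thesis by (simp add: completion_def)
qed

lemma cls_mult [simp]:
  assumes "X \<in> CS" "Y \<in> CS"
  shows "cls X \<otimes>\<^bsub>completion D\<^esub> cls Y = cls (\<lambda>n. X n \<otimes> Y n)"
proof -
  have "completion_map2 D (alg_mult D) (cls X) (cls Y) = cls (\<lambda>n. X n \<otimes> Y n)"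
  proof (rule completion_map2_cls[OF assms])
    fix X' Y' assume *: "X' \<in> CS" "Y' \<in> CS" "cls X' = cls X" "cls Y' = cls Y"
    obtain M1 where M1: "M1 > 0" "\<And>n. nrm (X' n) \<le> M1" using CS_bounded[OF *(1)] by metis
    obtain M2 where M2: "M2 > 0" "\<And>n. nrm (Y n) \<le> M2" using CS_bounded[OF assms(2)] by metis
    show "cls (\<lambda>n. X' n \<otimes> Y' n) = cls (\<lambda>n. X n \<otimes> Y n)"
    proof (rule cls_eqI)
      show "nrm ((X' n \<otimes> Y' n) \<ominus> (X n \<otimes> Y n)) \<le> max M1 M2 * (nrm (X' n \<ominus> X n) + nrm (Y' n \<ominus> Y n))" for n
        using * assms M1(2)[of n] M2(2)[of n] by (intro mult_diff_bound) auto
      show "(\<lambda>n. max M1 M2 * (nrm (X' n \<ominus> X n) + nrm (Y' n \<ominus> Y n))) \<longlonglongrightarrow> 0"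
        using * assms by (intro tendsto_mult_right_zero tendsto_add_zero) (simp_all add: cls_eq)
    qed (use * assms in auto)
  qed
  then show ?thesis by (simp add: completion_def)
qed

text \<open>Linear operators with norm bound \<open>M\<close>. Their continuous extension to the completion is given by
  \<open>completion_map\<close>.\<close>

definition bounded_op :: "('a \<Rightarrow> 'a) \<Rightarrow> real \<Rightarrow> bool" where
  "bounded_op \<phi> M \<longleftrightarrow> (\<forall>x\<in>C. \<phi> x \<in> C \<and> nrm (\<phi> x) \<le> M * nrm x) \<and> M \<ge> 0 \<and>
     (\<forall>x\<in>C. \<forall>y\<in>C. \<phi> (x \<oplus> y) = \<phi> x \<oplus> \<phi> y) \<and> (\<forall>c. \<forall>x\<in>C. \<phi> (c \<odot> x) = c \<odot> \<phi> x)"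

lemma lipschitz_CS:
  assumes "\<And>x. x \<in> C \<Longrightarrow> \<phi> x \<in> C" "\<And>x y. x \<in> C \<Longrightarrow> y \<in> C \<Longrightarrow> nrm (\<phi> x \<ominus> \<phi> y) \<le> M * nrm (x \<ominus> y)"
    "M \<ge> 0" "X \<in> CS"
  shows "(\<lambda>n. \<phi> (X n)) \<in> CS"
proof (rule CS_I[of _ X X M])
  show "nrm (\<phi> (X m) \<ominus> \<phi> (X n)) \<le> M * (nrm (X m \<ominus> X n) + nrm (X m \<ominus> X n))" for m n
  proof -
    have "M * nrm (X m \<ominus> X n) \<le> M * (nrm (X m \<ominus> X n) + nrm (X m \<ominus> X n))"
      using assms by (intro mult_left_mono) auto
    then show ?thesis using assms(2)[of "X m" "X n"] assms(4) by simp
  qed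
qed (use assms in auto)

lemma completion_map_lipschitz:
  assumes \<phi>: "\<And>x. x \<in> C \<Longrightarrow> \<phi> x \<in> C" "\<And>x y. x \<in> C \<Longrightarrow> y \<in> C \<Longrightarrow> nrm (\<phi> x \<ominus> \<phi> y) \<le> M * nrm (x \<ominus> y)"
    "M \<ge> 0" and X: "X \<in> CS"
  shows "completion_map D \<phi> (cls X) = cls (\<lambda>n. \<phi> (X n))"
proof (rule completion_map_cls[OF X])
  fix Y assume Y: "Y \<in> CS" "cls Y = cls X"
  show "cls (\<lambda>n. \<phi> (Y n)) = cls (\<lambda>n. \<phi> (X n))"
  proof (rule cls_eqI)
    show "nrm (\<phi> (Y n) \<ominus> \<phi> (X n)) \<le> M * nrm (Y n \<ominus> X n)" for n using \<phi>(2) X Y by simp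
    show "(\<lambda>n. M * nrm (Y n \<ominus> X n)) \<longlonglongrightarrow> 0"
      using X Y by (intro tendsto_mult_right_zero) (simp add: cls_eq)
  qed (use lipschitz_CS[OF \<phi>] X Y in auto)
qed

lemma cls_scale [simp]: "X \<in> CS \<Longrightarrow> c \<odot>\<^bsub>completion D\<^esub> cls X = cls (\<lambda>n. c \<odot> X n)"
  using completion_map_lipschitz[of "\<lambda>x. c \<odot> x" "cmod c" X]
  by (simp add: completion_def scale_diff[symmetric] p_scale)

lemma cls_star [simp]: "X \<in> CS \<Longrightarrow> (cls X)\<dagger>\<^bsub>completion D\<^esub> = cls (\<lambda>n. (X n)\<dagger>)"
  using completion_map_lipschitz[of "\<lambda>x. x\<dagger>" 1 X]
  by (simp add: completion_def star_diff[symmetric])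

lemma completion_zero: "\<zero>\<^bsub>completion D\<^esub> = cls (\<lambda>n. \<zero>)"
  by (simp add: completion_def completion_embed_def cls_def)

lemma completion_embed_cls: "completion_embed D x = cls (\<lambda>n. x)"
  by (simp add: completion_embed_def cls_def)

lemma cls_norm:
  assumes X: "X \<in> CS"
  shows "(\<lambda>n. nrm (X n)) \<longlonglongrightarrow> alg_norm (completion D) (cls X)"
proof -
  define Y where "Y = (SOME Y. Y \<in> cls X)"
  have "X \<in> cls X" using X mem_cls by blast
  then have "Y \<in> cls X" unfolding Y_def by (rule someI[of "\<lambda>Y. Y \<in> cls X"])
  then have Y: "Y \<in> CS" "cls Y = cls X" using mem_cls[OF X] by auto
  have "alg_norm (completion D) (cls X) = lim (\<lambda>n. nrm (Y n))"
    unfolding completion_def Y_def by simp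
  moreover have "(\<lambda>n. nrm (Y n)) \<longlonglongrightarrow> lim (\<lambda>n. nrm (Y n))"
    using CS_norm_convergent[OF Y(1)] by (simp add: convergent_LIMSEQ_iff)
  ultimately have *: "(\<lambda>n. nrm (Y n)) \<longlonglongrightarrow> alg_norm (completion D) (cls X)" by simp
  have "(\<lambda>n. nrm (X n) - nrm (Y n)) \<longlonglongrightarrow> 0"
  proof (rule Lim_null_comparison)
    show "(\<lambda>n. nrm (X n \<ominus> Y n)) \<longlonglongrightarrow> 0"
      using cls_eq[OF X Y(1)] Y(2) by simp
  qed (use X Y p_abs_diff in \<open>auto intro: always_eventually\<close>)
  from tendsto_add[OF this *] show ?thesis by simp
qed

lemma cls_diff [simp]:
  assumes "X \<in> CS" "Y \<in> CS"
  shows "cls X \<ominus>\<^bsub>completion D\<^esub> cls Y = cls (\<lambda>n. X n \<ominus> Y n)"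
  using assms by (simp add: alg_diff_def)

lemma CS_diff [simp]: "X \<in> CS \<Longrightarrow> Y \<in> CS \<Longrightarrow> (\<lambda>n. X n \<ominus> Y n) \<in> CS"
  by (simp add: alg_diff_def)

lemma completion_norm_leI:
  assumes "X \<in> CS" "Y \<in> CS" "\<And>n. nrm (X n) \<le> M * nrm (Y n)"
  shows "alg_norm (completion D) (cls X) \<le> M * alg_norm (completion D) (cls Y)"
  by (rule LIMSEQ_le[OF cls_norm[OF assms(1)] tendsto_mult_left[OF cls_norm[OF assms(2)]]])
    (use assms in auto)

lemma star_alg_completion: "star_alg (completion D)"
proof
  note [elim!] = completion_cases
  let ?E = "completion D"
  fix x y z :: "(nat \<Rightarrow> 'a) set" and c d :: complex
  show "\<zero>\<^bsub>?E\<^esub> \<in> alg_carrier ?E" by (simp add: completion_zero)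
  {
    assume "x \<in> alg_carrier ?E"
    then obtain X where X: "X \<in> CS" "x = cls X" by blast
    show "c \<odot>\<^bsub>?E\<^esub> x \<in> alg_carrier ?E" "x\<dagger>\<^bsub>?E\<^esub> \<in> alg_carrier ?E" using X by auto
    show "x \<oplus>\<^bsub>?E\<^esub> \<zero>\<^bsub>?E\<^esub> = x" "0 \<odot>\<^bsub>?E\<^esub> x = \<zero>\<^bsub>?E\<^esub>" "1 \<odot>\<^bsub>?E\<^esub> x = x"
      "c \<odot>\<^bsub>?E\<^esub> d \<odot>\<^bsub>?E\<^esub> x = (c * d) \<odot>\<^bsub>?E\<^esub> x"
      "(c + d) \<odot>\<^bsub>?E\<^esub> x = c \<odot>\<^bsub>?E\<^esub> x \<oplus>\<^bsub>?E\<^esub> d \<odot>\<^bsub>?E\<^esub> x"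
      "(c \<odot>\<^bsub>?E\<^esub> x)\<dagger>\<^bsub>?E\<^esub> = cnj c \<odot>\<^bsub>?E\<^esub> x\<dagger>\<^bsub>?E\<^esub>" "x\<dagger>\<^bsub>?E\<^esub>\<dagger>\<^bsub>?E\<^esub> = x"
      using X by (simp_all add: completion_zero scale_add_left star_scale)
    assume "y \<in> alg_carrier ?E"
    then obtain Y where Y: "Y \<in> CS" "y = cls Y" by blast
    show "x \<oplus>\<^bsub>?E\<^esub> y \<in> alg_carrier ?E" "x \<otimes>\<^bsub>?E\<^esub> y \<in> alg_carrier ?E" using X Y by auto
    show "x \<oplus>\<^bsub>?E\<^esub> y = y \<oplus>\<^bsub>?E\<^esub> x"
      using X Y by (simp add: add_commute)
    show "c \<odot>\<^bsub>?E\<^esub> (x \<oplus>\<^bsub>?E\<^esub> y) = c \<odot>\<^bsub>?E\<^esub> x \<oplus>\<^bsub>?E\<^esub> c \<odot>\<^bsub>?E\<^esub> y"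
      "(c \<odot>\<^bsub>?E\<^esub> x) \<otimes>\<^bsub>?E\<^esub> y = c \<odot>\<^bsub>?E\<^esub> (x \<otimes>\<^bsub>?E\<^esub> y)"
      "x \<otimes>\<^bsub>?E\<^esub> (c \<odot>\<^bsub>?E\<^esub> y) = c \<odot>\<^bsub>?E\<^esub> (x \<otimes>\<^bsub>?E\<^esub> y)"
      "(x \<oplus>\<^bsub>?E\<^esub> y)\<dagger>\<^bsub>?E\<^esub> = x\<dagger>\<^bsub>?E\<^esub> \<oplus>\<^bsub>?E\<^esub> y\<dagger>\<^bsub>?E\<^esub>"
      "(x \<otimes>\<^bsub>?E\<^esub> y)\<dagger>\<^bsub>?E\<^esub> = y\<dagger>\<^bsub>?E\<^esub> \<otimes>\<^bsub>?E\<^esub> x\<dagger>\<^bsub>?E\<^esub>"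
      using X Y by (simp_all add: scale_add_right star_add star_mult)
    assume "z \<in> alg_carrier ?E"
    then obtain Z where Z: "Z \<in> CS" "z = cls Z" by blast
    show "x \<oplus>\<^bsub>?E\<^esub> y \<oplus>\<^bsub>?E\<^esub> z = x \<oplus>\<^bsub>?E\<^esub> (y \<oplus>\<^bsub>?E\<^esub> z)"
      "x \<otimes>\<^bsub>?E\<^esub> y \<otimes>\<^bsub>?E\<^esub> z = x \<otimes>\<^bsub>?E\<^esub> (y \<otimes>\<^bsub>?E\<^esub> z)"
      "(x \<oplus>\<^bsub>?E\<^esub> y) \<otimes>\<^bsub>?E\<^esub> z = x \<otimes>\<^bsub>?E\<^esub> z \<oplus>\<^bsub>?E\<^esub> y \<otimes>\<^bsub>?E\<^esub> z"
      "x \<otimes>\<^bsub>?E\<^esub> (y \<oplus>\<^bsub>?E\<^esub> z) = x \<otimes>\<^bsub>?E\<^esub> y \<oplus>\<^bsub>?E\<^esub> x \<otimes>\<^bsub>?E\<^esub> z"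
      using X Y Z by (simp_all add: add_assoc mult_assoc mult_add_left mult_add_right)
  }
qed

lemma cstar_seminorm_completion: "cstar_seminorm (completion D) (alg_norm (completion D))"
  unfolding cstar_seminorm_def
proof (intro conjI ballI allI)
  let ?E = "completion D" and ?n = "alg_norm (completion D)"
  fix x assume "x \<in> alg_carrier ?E"
  then obtain X where X: "X \<in> CS" "x = cls X" by (rule completion_cases)
  show "0 \<le> ?n x"
    unfolding X(2) by (rule LIMSEQ_le_const[OF cls_norm[OF X(1)]]) (use X in auto)
  show "?n (c \<odot>\<^bsub>?E\<^esub> x) = cmod c * ?n x" for c
  proof -
    have "(\<lambda>n. nrm (c \<odot> X n)) \<longlonglongrightarrow> cmod c * ?n x"
      using tendsto_mult_left[OF cls_norm[OF X(1)], of "cmod c"] X by (simp add: p_scale)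
    moreover have "(\<lambda>n. nrm (c \<odot> X n)) \<longlonglongrightarrow> ?n (c \<odot>\<^bsub>?E\<^esub> x)"
      using cls_norm[of "\<lambda>n. c \<odot> X n"] X by simp
    ultimately show ?thesis using LIMSEQ_unique by blast
  qed
  show "?n (x\<dagger>\<^bsub>?E\<^esub> \<otimes>\<^bsub>?E\<^esub> x) = (?n x)\<^sup>2"
  proof -
    have "(\<lambda>n. nrm ((X n)\<dagger> \<otimes> X n)) \<longlonglongrightarrow> (?n x)\<^sup>2"
      using tendsto_power[OF cls_norm[OF X(1)], of 2] X by (simp add: p_star_mult)
    moreover have "(\<lambda>n. nrm ((X n)\<dagger> \<otimes> X n)) \<longlonglongrightarrow> ?n (x\<dagger>\<^bsub>?E\<^esub> \<otimes>\<^bsub>?E\<^esub> x)"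
      using cls_norm[of "\<lambda>n. (X n)\<dagger> \<otimes> X n"] X by simp
    ultimately show ?thesis using LIMSEQ_unique by blast
  qed
  fix y assume "y \<in> alg_carrier ?E"
  then obtain Y where Y: "Y \<in> CS" "y = cls Y" by (rule completion_cases)
  show "?n (x \<oplus>\<^bsub>?E\<^esub> y) \<le> ?n x + ?n y"
    using X Y by (auto intro!: LIMSEQ_le[OF cls_norm tendsto_add[OF cls_norm cls_norm]] exI[of _ 0] p_add)
  show "?n (x \<otimes>\<^bsub>?E\<^esub> y) \<le> ?n x * ?n y"
    using X Y by (auto intro!: LIMSEQ_le[OF cls_norm tendsto_mult[OF cls_norm cls_norm]] exI[of _ 0] p_mult)
qed

sublocale compl: cstar_seminormed "completion D" "alg_norm (completion D)"
  by (intro cstar_seminormed.intro star_alg_completion cstar_seminormed_axioms.intro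
      cstar_seminorm_completion)

lemma embed_closed [simp]: "x \<in> C \<Longrightarrow> completion_embed D x \<in> alg_carrier (completion D)"
  by (simp add: completion_embed_cls)

lemma embed_norm: "x \<in> C \<Longrightarrow> alg_norm (completion D) (completion_embed D x) = nrm x"
  using LIMSEQ_unique[OF cls_norm[of "\<lambda>n. x"] tendsto_const] by (simp add: completion_embed_cls)

lemma embed_diff: "\<lbrakk>x \<in> C; y \<in> C\<rbrakk> \<Longrightarrow>
    completion_embed D (x \<ominus> y) = completion_embed D x \<ominus>\<^bsub>completion D\<^esub> completion_embed D y"
  by (simp add: completion_embed_cls)

lemma embed_hom: "star_hom D (completion D) (completion_embed D)"
  unfolding star_hom_def by (simp add: completion_embed_cls)

lemma cls_limit:
  assumes X: "X \<in> CS"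
  shows "compl.conv (\<lambda>n. completion_embed D (X n)) (cls X)"
  unfolding compl.conv_def
proof (rule LIMSEQ_I)
  fix \<epsilon> :: real assume \<epsilon>: "\<epsilon> > 0"
  then obtain N where N: "\<And>m n. m \<ge> N \<Longrightarrow> n \<ge> N \<Longrightarrow> nrm (X m \<ominus> X n) < \<epsilon> / 2"
    using X half_gt_zero[OF \<epsilon>] unfolding CS_iff is_cauchy_def by blast
  have "alg_norm (completion D) (completion_embed D (X n) \<ominus>\<^bsub>completion D\<^esub> cls X) < \<epsilon>" if "n \<ge> N" for n
  proof -
    have CSn: "(\<lambda>m. X n \<ominus> X m) \<in> CS" using X by (intro CS_diff CS_const) auto
    have "alg_norm (completion D) (cls (\<lambda>m. X n \<ominus> X m)) \<le> \<epsilon> / 2"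
      by (rule LIMSEQ_le_const2[OF cls_norm[OF CSn]]) (use N[OF that] in \<open>auto intro: less_imp_le\<close>)
    then show ?thesis using X \<epsilon> by (simp add: completion_embed_cls)
  qed
  then show "\<exists>N. \<forall>n\<ge>N. norm (alg_norm (completion D)
      (completion_embed D (X n) \<ominus>\<^bsub>completion D\<^esub> cls X) - 0) < \<epsilon>"
    using X by (intro exI[of _ N]) auto
qed

lemma embed_dense:
  assumes "U \<in> alg_carrier (completion D)" "\<epsilon> > 0"
  shows "\<exists>x\<in>C. alg_norm (completion D) (completion_embed D x \<ominus>\<^bsub>completion D\<^esub> U) < \<epsilon>"
proof -
  obtain X where X: "X \<in> CS" "U = cls X" using assms(1) by (rule completion_cases)
  have "\<forall>\<^sub>F n in sequentially. alg_norm (completion D) (completion_embed D (X n) \<ominus>\<^bsub>completion D\<^esub> U) < \<epsilon>"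
    using cls_limit[OF X(1)] assms(2) unfolding compl.conv_def X(2) by (rule order_tendstoD(2))
  then obtain n where "alg_norm (completion D) (completion_embed D (X n) \<ominus>\<^bsub>completion D\<^esub> U) < \<epsilon>"
    unfolding eventually_sequentially by (meson order_refl)
  then show ?thesis using X(1) by (intro bexI[of _ "X n"]) auto
qed

lemma completion_complete:
  assumes U: "\<And>n. U n \<in> alg_carrier (completion D)" and cauchy: "compl.is_cauchy U"
  shows "\<exists>l\<in>alg_carrier (completion D). compl.conv U l"
proof -
  let ?n = "alg_norm (completion D)" and ?e = "completion_embed D"
  have "\<exists>x\<in>C. ?n (?e x \<ominus>\<^bsub>completion D\<^esub> U n) < inverse (real (Suc n))" for n
    by (rule embed_dense[OF U]) simp
  then obtain X where X: "\<And>n. X n \<in> C" "\<And>n. ?n (?e (X n) \<ominus>\<^bsub>completion D\<^esub> U n) < inverse (real (Suc n))"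
    by metis
  have "is_cauchy X"
    unfolding is_cauchy_def
  proof (intro allI impI)
    fix \<epsilon> :: real assume \<epsilon>: "\<epsilon> > 0"
    then obtain N where N: "\<And>m n. m \<ge> N \<Longrightarrow> n \<ge> N \<Longrightarrow> ?n (U m \<ominus>\<^bsub>completion D\<^esub> U n) < \<epsilon> / 3"
      using cauchy unfolding compl.is_cauchy_def by (meson divide_pos_pos zero_less_numeral)
    obtain M where M: "inverse (real (Suc M)) < \<epsilon> / 3"
      using reals_Archimedean[of "\<epsilon> / 3"] \<epsilon> by auto
    have "nrm (X m \<ominus> X n) < \<epsilon>" if mn: "m \<ge> max M N" "n \<ge> max M N" for m n
    proof -
      have small: "?n (?e (X k) \<ominus>\<^bsub>completion D\<^esub> U k) < \<epsilon> / 3" if "k \<ge> M" for k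
      proof -
        have "inverse (real (Suc k)) \<le> inverse (real (Suc M))" using that by simp
        then show ?thesis using X(2)[of k] M by linarith
      qed
      have "nrm (X m \<ominus> X n) = ?n (?e (X m) \<ominus>\<^bsub>completion D\<^esub> ?e (X n))"
        using X by (simp add: embed_norm embed_diff[symmetric])
      also have "\<dots> \<le> ?n (?e (X m) \<ominus>\<^bsub>completion D\<^esub> U m) + ?n (U m \<ominus>\<^bsub>completion D\<^esub> ?e (X n))"
        using X U by (intro compl.p_triangle) auto
      also have "?n (U m \<ominus>\<^bsub>completion D\<^esub> ?e (X n)) \<le>
          ?n (U m \<ominus>\<^bsub>completion D\<^esub> U n) + ?n (?e (X n) \<ominus>\<^bsub>completion D\<^esub> U n)"
        using compl.p_triangle[of "U m" "U n" "?e (X n)"] compl.p_diff_commute[of "?e (X n)" "U n"] X U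
        by simp
      finally show ?thesis using small[of m] small[of n] N[of m n] mn by simp
    qed
    then show "\<exists>N. \<forall>m\<ge>N. \<forall>n\<ge>N. nrm (X m \<ominus> X n) < \<epsilon>" by blast
  qed
  then have XC: "X \<in> CS" using X by (simp add: CS_iff)
  have "compl.conv U (cls X)"
  proof (rule compl.convI)
    show "?n (U n \<ominus>\<^bsub>completion D\<^esub> cls X) \<le>
        inverse (real (Suc n)) + ?n (?e (X n) \<ominus>\<^bsub>completion D\<^esub> cls X)" for n
      using compl.p_triangle[of "U n" "?e (X n)" "cls X"] compl.p_diff_commute[of "?e (X n)" "U n"]
        X(1)[of n] X(2)[of n] U XC by simp
    show "(\<lambda>n. inverse (real (Suc n)) + ?n (?e (X n) \<ominus>\<^bsub>completion D\<^esub> cls X)) \<longlonglongrightarrow> 0"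
      using cls_limit[OF XC] unfolding compl.conv_def
      by (intro tendsto_add_zero LIMSEQ_inverse_real_of_nat)
  qed (use U XC in auto)
  then show ?thesis using XC by auto
qed

sublocale compl: cstar_normed "completion D"
proof
  fix x assume "x \<in> alg_carrier (completion D)" and 0: "alg_norm (completion D) x = 0"
  then obtain X where X: "X \<in> CS" "x = cls X" by (blast elim: completion_cases)
  have "cls X = cls (\<lambda>n. \<zero>)"
    using cls_norm[OF X(1)] 0 X by (simp add: cls_eq)
  then show "x = \<zero>\<^bsub>completion D\<^esub>" using X by (simp add: completion_zero)
qed (rule completion_complete)

lemma bounded_op_lipschitz:
  assumes "bounded_op \<phi> M" "x \<in> C" "y \<in> C"
  shows "nrm (\<phi> x \<ominus> \<phi> y) \<le> M * nrm (x \<ominus> y)"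
proof -
  have "\<phi> x \<ominus> \<phi> y = \<phi> (x \<ominus> y)"
    using assms unfolding bounded_op_def alg_diff_def by simp
  then show ?thesis using assms unfolding bounded_op_def by simp
qed

lemma bounded_op_CS: "\<lbrakk>bounded_op \<phi> M; X \<in> CS\<rbrakk> \<Longrightarrow> (\<lambda>n. \<phi> (X n)) \<in> CS"
  by (rule lipschitz_CS[of \<phi> M]) (auto intro: bounded_op_lipschitz simp: bounded_op_def)

lemma bounded_op_cls: "\<lbrakk>bounded_op \<phi> M; X \<in> CS\<rbrakk> \<Longrightarrow> completion_map D \<phi> (cls X) = cls (\<lambda>n. \<phi> (X n))"
  by (rule completion_map_lipschitz[of \<phi> M]) (auto intro: bounded_op_lipschitz simp: bounded_op_def)

lemma bounded_op_embed:
  "\<lbrakk>bounded_op \<phi> M; x \<in> C\<rbrakk> \<Longrightarrow> completion_map D \<phi> (completion_embed D x) = completion_embed D (\<phi> x)"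
  by (simp add: completion_embed_cls bounded_op_cls)

lemma bounded_op_closed:
  assumes "bounded_op \<phi> M" "U \<in> alg_carrier (completion D)"
  shows "completion_map D \<phi> U \<in> alg_carrier (completion D)"
  using assms(2) by (rule completion_cases) (use assms bounded_op_CS bounded_op_cls in auto)

lemma bounded_op_add:
  assumes \<phi>: "bounded_op \<phi> M" and U: "U \<in> alg_carrier (completion D)" "V \<in> alg_carrier (completion D)"
  shows "completion_map D \<phi> (U \<oplus>\<^bsub>completion D\<^esub> V) =
    completion_map D \<phi> U \<oplus>\<^bsub>completion D\<^esub> completion_map D \<phi> V"
proof -
  obtain X Y where "X \<in> CS" "U = cls X" "Y \<in> CS" "V = cls Y" using U completion_cases by metis
  then show ?thesis using \<phi> bounded_op_CS[OF \<phi>] bounded_op_cls[OF \<phi>] by (simp add: bounded_op_def)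
qed

lemma bounded_op_scale:
  assumes \<phi>: "bounded_op \<phi> M" and U: "U \<in> alg_carrier (completion D)"
  shows "completion_map D \<phi> (c \<odot>\<^bsub>completion D\<^esub> U) = c \<odot>\<^bsub>completion D\<^esub> completion_map D \<phi> U"
proof -
  obtain X where "X \<in> CS" "U = cls X" using U completion_cases by metis
  then show ?thesis using \<phi> bounded_op_CS[OF \<phi>] bounded_op_cls[OF \<phi>] by (simp add: bounded_op_def)
qed

lemma bounded_op_diff:
  assumes \<phi>: "bounded_op \<phi> M" and U: "U \<in> alg_carrier (completion D)" "V \<in> alg_carrier (completion D)"
  shows "completion_map D \<phi> (U \<ominus>\<^bsub>completion D\<^esub> V) =
    completion_map D \<phi> U \<ominus>\<^bsub>completion D\<^esub> completion_map D \<phi> V"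
  unfolding alg_diff_def using U by (simp add: bounded_op_add[OF \<phi>] bounded_op_scale[OF \<phi>])

lemma bounded_op_norm:
  assumes \<phi>: "bounded_op \<phi> M" and U: "U \<in> alg_carrier (completion D)"
  shows "alg_norm (completion D) (completion_map D \<phi> U) \<le> M * alg_norm (completion D) U"
proof -
  obtain X where X: "X \<in> CS" "U = cls X" using U completion_cases by metis
  show ?thesis unfolding X(2) bounded_op_cls[OF \<phi> X(1)]
    using \<phi> X bounded_op_CS[OF \<phi>] by (intro completion_norm_leI) (auto simp: bounded_op_def)
qed

lemma bounded_op_conv:
  assumes \<phi>: "bounded_op \<phi> M" and U: "\<And>n. U n \<in> alg_carrier (completion D)" "V \<in> alg_carrier (completion D)"
    and "compl.conv U V"
  shows "compl.conv (\<lambda>n. completion_map D \<phi> (U n)) (completion_map D \<phi> V)"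
proof (rule compl.convI)
  show "alg_norm (completion D) (completion_map D \<phi> (U n) \<ominus>\<^bsub>completion D\<^esub> completion_map D \<phi> V)
      \<le> M * alg_norm (completion D) (U n \<ominus>\<^bsub>completion D\<^esub> V)" for n
    using bounded_op_norm[OF \<phi>, of "U n \<ominus>\<^bsub>completion D\<^esub> V"] U by (simp add: bounded_op_diff[OF \<phi>])
  show "(\<lambda>n. M * alg_norm (completion D) (U n \<ominus>\<^bsub>completion D\<^esub> V)) \<longlonglongrightarrow> 0"
    using assms(4) unfolding compl.conv_def by (intro tendsto_mult_right_zero)
qed (use U bounded_op_closed[OF \<phi>] in auto)

end

section \<open>The section algebra of a Fell bundle\<close>

lemma section_algebra_carrier:
  "alg_carrier (section_algebra \<B>) = {f. (\<forall>g. f g \<in> fibre \<B> g) \<and> finite {g. f g \<noteq> 0}}"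
  by (simp add: section_algebra_def section_star_algebra_def star_algebra.extend_def
      normed_star_algebra.fields_def)

lemma section_algebra_simps [simp]:
  "alg_zero (section_algebra \<B>) = (\<lambda>g. 0)"
  "alg_add (section_algebra \<B>) = (\<lambda>f h g. f g + h g)"
  "alg_scale (section_algebra \<B>) = (\<lambda>c f g. smul \<B> c (f g))"
  "alg_star (section_algebra \<B>) = (\<lambda>f g. fstar \<B> (- g) (f (- g)))"
  "alg_norm (section_algebra \<B>) = max_cstar_norm (section_star_algebra \<B>)"
  by (simp_all add: section_algebra_def section_star_algebra_def star_algebra.extend_def
      normed_star_algebra.fields_def)

lemma section_algebra_mult:
  "alg_mult (section_algebra \<B>) f h k =
     (\<Sum>g | f g \<noteq> 0. fmult \<B> g (- g + k) (f g) (h (- g + k)))"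
  by (simp add: section_algebra_def section_star_algebra_def star_algebra.extend_def
      normed_star_algebra.fields_def)

lemma cstar_seminorm_section:
  "cstar_seminorm (section_star_algebra \<B>) p \<longleftrightarrow> cstar_seminorm (section_algebra \<B>) p"
  by (simp add: cstar_seminorm_def section_algebra_def section_star_algebra_def star_algebra.extend_def
      normed_star_algebra.fields_def)

text \<open>The section supported at one point.\<close>

definition single :: "'g \<Rightarrow> 'b \<Rightarrow> 'g \<Rightarrow> 'b::zero" where
  "single g a = (\<lambda>k. if k = g then a else 0)"

context fell_bundle
begin

sublocale V: vector_space "smul \<B>"
  by (rule vector_space)

abbreviation Sec :: "('g \<Rightarrow> 'b) set" where
  "Sec \<equiv> alg_carrier (section_algebra \<B>)"

lemma fibre_zero [simp]: "0 \<in> fibre \<B> g"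
  using V.subspace_0[OF subspace] .

lemma fibre_add [simp]: "a \<in> fibre \<B> g \<Longrightarrow> b \<in> fibre \<B> g \<Longrightarrow> a + b \<in> fibre \<B> g"
  using V.subspace_add[OF subspace] .

lemma fibre_smul [simp]: "a \<in> fibre \<B> g \<Longrightarrow> smul \<B> c a \<in> fibre \<B> g"
  using V.subspace_scale[OF subspace] .

lemma fibre_sum: "(\<And>i. i \<in> I \<Longrightarrow> f i \<in> fibre \<B> g) \<Longrightarrow> sum f I \<in> fibre \<B> g"
  using V.subspace_sum[OF subspace] .

lemma fmult_zero_left [simp]: "b \<in> fibre \<B> h \<Longrightarrow> fmult \<B> g h 0 b = 0"
  using mult_add_left[of 0 g 0 b h] by simp

lemma fmult_zero_right [simp]: "a \<in> fibre \<B> g \<Longrightarrow> fmult \<B> g h a 0 = 0"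
  using mult_add_right[of a g 0 h 0] by simp

lemma fstar_zero [simp]: "fstar \<B> g 0 = 0"
  using star_add[of 0 g 0] by simp

lemma fmult_sum_left:
  assumes "\<And>i. i \<in> I \<Longrightarrow> f i \<in> fibre \<B> g" "b \<in> fibre \<B> h"
  shows "fmult \<B> g h (\<Sum>i\<in>I. f i) b = (\<Sum>i\<in>I. fmult \<B> g h (f i) b)"
proof (cases "finite I")
  case True
  then show ?thesis using assms
    by (induction I) (auto simp: mult_add_left fibre_sum)
qed (use assms in simp)

lemma fmult_sum_right:
  assumes "\<And>i. i \<in> I \<Longrightarrow> f i \<in> fibre \<B> h" "a \<in> fibre \<B> g"
  shows "fmult \<B> g h a (\<Sum>i\<in>I. f i) = (\<Sum>i\<in>I. fmult \<B> g h a (f i))"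
proof (cases "finite I")
  case True
  then show ?thesis using assms
    by (induction I) (auto simp: mult_add_right fibre_sum)
qed (use assms in simp)

lemma fstar_sum:
  assumes "\<And>i. i \<in> I \<Longrightarrow> f i \<in> fibre \<B> g"
  shows "fstar \<B> g (\<Sum>i\<in>I. f i) = (\<Sum>i\<in>I. fstar \<B> g (f i))"
proof (cases "finite I")
  case True
  then show ?thesis using assms by (induction I) (auto simp: star_add fibre_sum)
qed simp

lemma fmult_closed': "\<lbrakk>a \<in> fibre \<B> g; b \<in> fibre \<B> (- g + k)\<rbrakk> \<Longrightarrow> fmult \<B> g (- g + k) a b \<in> fibre \<B> k"
  using mult_closed[of a g b "- g + k"] by simp

lemma Sec_fibre: "f \<in> Sec \<Longrightarrow> f g \<in> fibre \<B> g"
  by (simp add: section_algebra_carrier)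

lemma Sec_finite: "f \<in> Sec \<Longrightarrow> finite {g. f g \<noteq> 0}"
  by (simp add: section_algebra_carrier)

lemma Sec_I: "\<lbrakk>\<And>g. f g \<in> fibre \<B> g; finite F; \<And>g. g \<notin> F \<Longrightarrow> f g = 0\<rbrakk> \<Longrightarrow> f \<in> Sec"
  unfolding section_algebra_carrier by (auto intro: rev_finite_subset)

lemma section_mult_eq:
  assumes f: "f \<in> Sec" and h: "h \<in> Sec" and S: "finite S" "{g. f g \<noteq> 0} \<subseteq> S"
  shows "alg_mult (section_algebra \<B>) f h k = (\<Sum>g\<in>S. fmult \<B> g (- g + k) (f g) (h (- g + k)))"
  unfolding section_algebra_mult
proof (rule sum.mono_neutral_left[OF S])
  show "\<forall>g\<in>S - {g. f g \<noteq> 0}. fmult \<B> g (- g + k) (f g) (h (- g + k)) = 0"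
    using Sec_fibre[OF h] by auto
qed

lemma section_mult_support:
  assumes f: "f \<in> Sec" and h: "h \<in> Sec"
    and k: "k \<notin> (\<lambda>(g, m). g + m) ` ({g. f g \<noteq> 0} \<times> {g. h g \<noteq> 0})"
  shows "alg_mult (section_algebra \<B>) f h k = 0"
  unfolding section_algebra_mult
proof (rule sum.neutral, rule ballI)
  fix g assume g: "g \<in> {g. f g \<noteq> 0}"
  have "h (- g + k) = 0"
  proof (rule ccontr)
    assume "h (- g + k) \<noteq> 0"
    then have "g + (- g + k) \<in> (\<lambda>(g, m). g + m) ` ({g. f g \<noteq> 0} \<times> {g. h g \<noteq> 0})" using g by force
    then show False using k by simp
  qed
  then show "fmult \<B> g (- g + k) (f g) (h (- g + k)) = 0" using Sec_fibre[OF f] by simp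
qed

lemma section_mult_closed:
  assumes f: "f \<in> Sec" and h: "h \<in> Sec"
  shows "alg_mult (section_algebra \<B>) f h \<in> Sec"
proof (rule Sec_I)
  show "alg_mult (section_algebra \<B>) f h g \<in> fibre \<B> g" for g
    unfolding section_algebra_mult using Sec_fibre[OF f] Sec_fibre[OF h]
    by (intro fibre_sum fmult_closed')
  show "finite ((\<lambda>(g, m). g + m) ` ({g. f g \<noteq> 0} \<times> {g. h g \<noteq> 0}))"
    using Sec_finite[OF f] Sec_finite[OF h] by blast
qed (rule section_mult_support[OF f h])

lemma section_star_closed:
  assumes f: "f \<in> Sec"
  shows "alg_star (section_algebra \<B>) f \<in> Sec"
proof (rule Sec_I)
  show "alg_star (section_algebra \<B>) f g \<in> fibre \<B> g" for g
    using star_closed[OF Sec_fibre[OF f], of "- g"] by simp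
  show "finite (uminus ` {g. f g \<noteq> 0})" using Sec_finite[OF f] by blast
  show "alg_star (section_algebra \<B>) f g = 0" if "g \<notin> uminus ` {g. f g \<noteq> 0}" for g
  proof -
    have "f (- g) = 0" using that by (metis (mono_tags) imageI mem_Collect_eq minus_minus)
    then show ?thesis by simp
  qed
qed

lemma section_mult_assoc:
  assumes f: "f \<in> Sec" and h: "h \<in> Sec" and j: "j \<in> Sec"
  shows "alg_mult (section_algebra \<B>) (alg_mult (section_algebra \<B>) f h) j =
    alg_mult (section_algebra \<B>) f (alg_mult (section_algebra \<B>) h j)"
proof
  fix k
  let ?F = "{g. f g \<noteq> 0}" and ?H = "{g. h g \<noteq> 0}"
  define L where "L = (\<lambda>(g, m). g + m) ` (?F \<times> ?H)"
  have fin: "finite ?F" "finite ?H" "finite L"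
    unfolding L_def using Sec_finite[OF f] Sec_finite[OF h] by auto
  have supp: "{g. alg_mult (section_algebra \<B>) f h g \<noteq> 0} \<subseteq> L"
    using section_mult_support[OF f h] unfolding L_def by blast
  note fib = Sec_fibre[OF f] Sec_fibre[OF h] Sec_fibre[OF j]
  have "alg_mult (section_algebra \<B>) (alg_mult (section_algebra \<B>) f h) j k =
      (\<Sum>l\<in>L. fmult \<B> l (- l + k) (\<Sum>g\<in>?F. fmult \<B> g (- g + l) (f g) (h (- g + l))) (j (- l + k)))"
    unfolding section_mult_eq[OF section_mult_closed[OF f h] j fin(3) supp]
    by (simp only: section_algebra_mult)
  also have "\<dots> = (\<Sum>l\<in>L. \<Sum>g\<in>?F. fmult \<B> l (- l + k) (fmult \<B> g (- g + l) (f g) (h (- g + l))) (j (- l + k)))"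
    by (intro sum.cong refl fmult_sum_left fmult_closed' fib)
  also have "\<dots> = (\<Sum>g\<in>?F. \<Sum>l\<in>L. fmult \<B> l (- l + k) (fmult \<B> g (- g + l) (f g) (h (- g + l))) (j (- l + k)))"
    by (rule sum.swap)
  also have "\<dots> = (\<Sum>g\<in>?F. \<Sum>m\<in>?H. fmult \<B> g (- g + k) (f g) (fmult \<B> m (- m + (- g + k)) (h m) (j (- m + (- g + k)))))"
  proof (rule sum.cong[OF refl])
    fix g assume g: "g \<in> ?F"
    have "(\<Sum>l\<in>L. fmult \<B> l (- l + k) (fmult \<B> g (- g + l) (f g) (h (- g + l))) (j (- l + k))) =
        (\<Sum>l\<in>(+) g ` ?H. fmult \<B> l (- l + k) (fmult \<B> g (- g + l) (f g) (h (- g + l))) (j (- l + k)))"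
    proof (rule sum.mono_neutral_right[OF fin(3)])
      show "(+) g ` ?H \<subseteq> L" unfolding L_def using g by force
      show "\<forall>l\<in>L - (+) g ` ?H. fmult \<B> l (- l + k) (fmult \<B> g (- g + l) (f g) (h (- g + l))) (j (- l + k)) = 0"
      proof
        fix l assume "l \<in> L - (+) g ` ?H"
        then have "h (- g + l) = 0" by (metis (mono_tags) DiffD2 add_minus_cancel imageI mem_Collect_eq)
        then show "fmult \<B> l (- l + k) (fmult \<B> g (- g + l) (f g) (h (- g + l))) (j (- l + k)) = 0"
          using fib by simp
      qed
    qed
    also have "\<dots> = (\<Sum>m\<in>?H. fmult \<B> (g + m) (- (g + m) + k) (fmult \<B> g m (f g) (h m)) (j (- (g + m) + k)))"
      by (subst sum.reindex) (auto simp: inj_on_def)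
    also have "\<dots> = (\<Sum>m\<in>?H. fmult \<B> g (- g + k) (f g) (fmult \<B> m (- m + (- g + k)) (h m) (j (- m + (- g + k)))))"
    proof (rule sum.cong[OF refl])
      fix m
      have e: "- (g + m) + k = - m + (- g + k)" by (simp only: minus_add add.assoc)
      show "fmult \<B> (g + m) (- (g + m) + k) (fmult \<B> g m (f g) (h m)) (j (- (g + m) + k)) =
          fmult \<B> g (- g + k) (f g) (fmult \<B> m (- m + (- g + k)) (h m) (j (- m + (- g + k))))"
        unfolding e mult_assoc[OF fib] by simp
    qed
    finally show "(\<Sum>l\<in>L. fmult \<B> l (- l + k) (fmult \<B> g (- g + l) (f g) (h (- g + l))) (j (- l + k))) =
        (\<Sum>m\<in>?H. fmult \<B> g (- g + k) (f g) (fmult \<B> m (- m + (- g + k)) (h m) (j (- m + (- g + k)))))" .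
  qed
  also have "\<dots> = (\<Sum>g\<in>?F. fmult \<B> g (- g + k) (f g) (alg_mult (section_algebra \<B>) h j (- g + k)))"
    unfolding section_algebra_mult
    by (intro sum.cong refl fmult_sum_right[symmetric] fmult_closed' fib)
  also have "\<dots> = alg_mult (section_algebra \<B>) f (alg_mult (section_algebra \<B>) h j) k"
    unfolding section_algebra_mult[of \<B> f] ..
  finally show "alg_mult (section_algebra \<B>) (alg_mult (section_algebra \<B>) f h) j k =
    alg_mult (section_algebra \<B>) f (alg_mult (section_algebra \<B>) h j) k" .
qed

lemma section_star_mult:
  assumes f: "f \<in> Sec" and h: "h \<in> Sec"
  shows "alg_star (section_algebra \<B>) (alg_mult (section_algebra \<B>) f h) =
    alg_mult (section_algebra \<B>) (alg_star (section_algebra \<B>) h) (alg_star (section_algebra \<B>) f)"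
proof
  fix k
  let ?F = "{g. f g \<noteq> 0}" and ?fs = "alg_star (section_algebra \<B>) f" and ?hs = "alg_star (section_algebra \<B>) h"
  note fib = Sec_fibre[OF f] Sec_fibre[OF h]
  note sfib = Sec_fibre[OF section_star_closed[OF f]] Sec_fibre[OF section_star_closed[OF h]]
  define L where "L = {g. ?hs g \<noteq> 0} \<union> (+) k ` ?F"
  have L: "finite L" "{g. ?hs g \<noteq> 0} \<subseteq> L"
    unfolding L_def using Sec_finite[OF section_star_closed[OF h]] Sec_finite[OF f] by blast+
  have "alg_star (section_algebra \<B>) (alg_mult (section_algebra \<B>) f h) k =
      (\<Sum>g\<in>?F. fstar \<B> (- k) (fmult \<B> g (- g + - k) (f g) (h (- g + - k))))"
    unfolding section_algebra_simps section_algebra_mult by (intro fstar_sum fmult_closed' fib)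
  also have "\<dots> = (\<Sum>g\<in>?F. fmult \<B> (k + g) (- (k + g) + k) (?hs (k + g)) (?fs (- (k + g) + k)))"
  proof (rule sum.cong[OF refl])
    fix g
    have e: "- (- g + - k) = k + g" "- (k + g) = - g + - k" "- (k + g) + k = - g"
      by (simp_all add: minus_add add.assoc del: add_uminus_conv_diff)
    have "fstar \<B> (- k) (fmult \<B> g (- g + - k) (f g) (h (- g + - k))) =
        fstar \<B> (g + (- g + - k)) (fmult \<B> g (- g + - k) (f g) (h (- g + - k)))"
      by (simp only: add_minus_cancel)
    also have "\<dots> = fmult \<B> (- (- g + - k)) (- g) (fstar \<B> (- g + - k) (h (- g + - k))) (fstar \<B> g (f g))"
      by (rule star_mult[OF fib])
    also have "\<dots> = fmult \<B> (k + g) (- (k + g) + k) (?hs (k + g)) (?fs (- (k + g) + k))"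
      unfolding e(1,3) unfolding section_algebra_simps minus_minus unfolding e(2) ..
    finally show "fstar \<B> (- k) (fmult \<B> g (- g + - k) (f g) (h (- g + - k))) =
      fmult \<B> (k + g) (- (k + g) + k) (?hs (k + g)) (?fs (- (k + g) + k))" .
  qed
  also have "\<dots> = (\<Sum>l\<in>(+) k ` ?F. fmult \<B> l (- l + k) (?hs l) (?fs (- l + k)))"
    by (subst sum.reindex) (auto simp: inj_on_def simp del: section_algebra_simps)
  also have "\<dots> = (\<Sum>l\<in>L. fmult \<B> l (- l + k) (?hs l) (?fs (- l + k)))"
  proof (rule sum.mono_neutral_left[OF L(1)])
    show "(+) k ` ?F \<subseteq> L" unfolding L_def by blast
    show "\<forall>l\<in>L - (+) k ` ?F. fmult \<B> l (- l + k) (?hs l) (?fs (- l + k)) = 0"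
    proof
      fix l assume "l \<in> L - (+) k ` ?F"
      then have "f (- k + l) = 0" by (metis (mono_tags) DiffD2 add_minus_cancel imageI mem_Collect_eq)
      moreover have "- (- l + k) = - k + l" by (simp add: minus_add del: add_uminus_conv_diff)
      ultimately have "?fs (- l + k) = 0" unfolding section_algebra_simps by simp
      then show "fmult \<B> l (- l + k) (?hs l) (?fs (- l + k)) = 0"
        using fmult_zero_right[OF sfib(2)] by metis
    qed
  qed
  also have "\<dots> = alg_mult (section_algebra \<B>) ?hs ?fs k"
    by (rule section_mult_eq[OF section_star_closed[OF h] section_star_closed[OF f] L, symmetric])
  finally show "alg_star (section_algebra \<B>) (alg_mult (section_algebra \<B>) f h) k =
    alg_mult (section_algebra \<B>) ?hs ?fs k" .
qed

lemma section_add_closed: "f \<in> Sec \<Longrightarrow> h \<in> Sec \<Longrightarrow> (\<lambda>g. f g + h g) \<in> Sec"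
  by (rule Sec_I[of _ "{g. f g \<noteq> 0} \<union> {g. h g \<noteq> 0}"]) (auto simp: Sec_fibre Sec_finite)

lemma section_scale_closed: "f \<in> Sec \<Longrightarrow> (\<lambda>g. smul \<B> (c g) (f g)) \<in> Sec"
  by (rule Sec_I[of _ "{g. f g \<noteq> 0}"]) (auto simp: Sec_fibre Sec_finite)

lemma star_alg_section: "star_alg (section_algebra \<B>)"
proof
  let ?S = "section_algebra \<B>"
  fix x y z and c d :: complex
  show "\<zero>\<^bsub>?S\<^esub> \<in> Sec" by (simp add: section_algebra_carrier)
  assume x: "x \<in> Sec"
  note fx = Sec_fibre[OF x]
  show "c \<odot>\<^bsub>?S\<^esub> x \<in> Sec" using section_scale_closed[OF x, of "\<lambda>_. c"] by simp
  show "x\<dagger>\<^bsub>?S\<^esub> \<in> Sec" by (rule section_star_closed[OF x])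
  show "x \<oplus>\<^bsub>?S\<^esub> \<zero>\<^bsub>?S\<^esub> = x" "0 \<odot>\<^bsub>?S\<^esub> x = \<zero>\<^bsub>?S\<^esub>" "1 \<odot>\<^bsub>?S\<^esub> x = x"
    "c \<odot>\<^bsub>?S\<^esub> d \<odot>\<^bsub>?S\<^esub> x = (c * d) \<odot>\<^bsub>?S\<^esub> x"
    "(c + d) \<odot>\<^bsub>?S\<^esub> x = c \<odot>\<^bsub>?S\<^esub> x \<oplus>\<^bsub>?S\<^esub> d \<odot>\<^bsub>?S\<^esub> x"
    "(c \<odot>\<^bsub>?S\<^esub> x)\<dagger>\<^bsub>?S\<^esub> = cnj c \<odot>\<^bsub>?S\<^esub> x\<dagger>\<^bsub>?S\<^esub>"
    using fx by (auto simp: V.scale_left_distrib star_smul)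
  show "x\<dagger>\<^bsub>?S\<^esub>\<dagger>\<^bsub>?S\<^esub> = x" using star_star[OF fx] by (simp add: fun_eq_iff)
  assume y: "y \<in> Sec"
  note fy = Sec_fibre[OF y]
  show "x \<oplus>\<^bsub>?S\<^esub> y \<in> Sec" using section_add_closed[OF x y] by simp
  show "x \<otimes>\<^bsub>?S\<^esub> y \<in> Sec" by (rule section_mult_closed[OF x y])
  show "x \<oplus>\<^bsub>?S\<^esub> y = y \<oplus>\<^bsub>?S\<^esub> x" "c \<odot>\<^bsub>?S\<^esub> (x \<oplus>\<^bsub>?S\<^esub> y) = c \<odot>\<^bsub>?S\<^esub> x \<oplus>\<^bsub>?S\<^esub> c \<odot>\<^bsub>?S\<^esub> y"
    "(x \<oplus>\<^bsub>?S\<^esub> y)\<dagger>\<^bsub>?S\<^esub> = x\<dagger>\<^bsub>?S\<^esub> \<oplus>\<^bsub>?S\<^esub> y\<dagger>\<^bsub>?S\<^esub>"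
    using fx fy by (auto simp: V.scale_right_distrib star_add add.commute)
  show "(x \<otimes>\<^bsub>?S\<^esub> y)\<dagger>\<^bsub>?S\<^esub> = y\<dagger>\<^bsub>?S\<^esub> \<otimes>\<^bsub>?S\<^esub> x\<dagger>\<^bsub>?S\<^esub>"
    by (rule section_star_mult[OF x y])
  show "(c \<odot>\<^bsub>?S\<^esub> x) \<otimes>\<^bsub>?S\<^esub> y = c \<odot>\<^bsub>?S\<^esub> (x \<otimes>\<^bsub>?S\<^esub> y)"
  proof
    fix k
    have cx: "c \<odot>\<^bsub>?S\<^esub> x \<in> Sec" using section_scale_closed[OF x, of "\<lambda>_. c"] by simp
    have "((c \<odot>\<^bsub>?S\<^esub> x) \<otimes>\<^bsub>?S\<^esub> y) k =
        (\<Sum>g | x g \<noteq> 0. fmult \<B> g (- g + k) ((c \<odot>\<^bsub>?S\<^esub> x) g) (y (- g + k)))"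
      by (rule section_mult_eq[OF cx y]) (use Sec_finite[OF x] in auto)
    also have "\<dots> = (c \<odot>\<^bsub>?S\<^esub> (x \<otimes>\<^bsub>?S\<^esub> y)) k"
      by (simp add: section_algebra_mult V.scale_sum_right mult_smul_left[OF fx fy])
    finally show "((c \<odot>\<^bsub>?S\<^esub> x) \<otimes>\<^bsub>?S\<^esub> y) k = (c \<odot>\<^bsub>?S\<^esub> (x \<otimes>\<^bsub>?S\<^esub> y)) k" .
  qed
  show "x \<otimes>\<^bsub>?S\<^esub> (c \<odot>\<^bsub>?S\<^esub> y) = c \<odot>\<^bsub>?S\<^esub> (x \<otimes>\<^bsub>?S\<^esub> y)"
    by (simp add: section_algebra_mult V.scale_sum_right mult_smul_right[OF fx fy] fun_eq_iff)
  assume z: "z \<in> Sec"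
  note fz = Sec_fibre[OF z]
  show "x \<oplus>\<^bsub>?S\<^esub> y \<oplus>\<^bsub>?S\<^esub> z = x \<oplus>\<^bsub>?S\<^esub> (y \<oplus>\<^bsub>?S\<^esub> z)" by (simp add: add.assoc)
  show "x \<otimes>\<^bsub>?S\<^esub> y \<otimes>\<^bsub>?S\<^esub> z = x \<otimes>\<^bsub>?S\<^esub> (y \<otimes>\<^bsub>?S\<^esub> z)" by (rule section_mult_assoc[OF x y z])
  show "x \<otimes>\<^bsub>?S\<^esub> (y \<oplus>\<^bsub>?S\<^esub> z) = x \<otimes>\<^bsub>?S\<^esub> y \<oplus>\<^bsub>?S\<^esub> x \<otimes>\<^bsub>?S\<^esub> z"
    by (simp add: section_algebra_mult sum.distrib mult_add_right[OF fx fy fz] fun_eq_iff)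
  show "(x \<oplus>\<^bsub>?S\<^esub> y) \<otimes>\<^bsub>?S\<^esub> z = x \<otimes>\<^bsub>?S\<^esub> z \<oplus>\<^bsub>?S\<^esub> y \<otimes>\<^bsub>?S\<^esub> z"
  proof
    fix k
    let ?U = "{g. x g \<noteq> 0} \<union> {g. y g \<noteq> 0}"
    have xy: "x \<oplus>\<^bsub>?S\<^esub> y \<in> Sec" using section_add_closed[OF x y] by simp
    have fin: "finite ?U" using Sec_finite[OF x] Sec_finite[OF y] by blast
    have "((x \<oplus>\<^bsub>?S\<^esub> y) \<otimes>\<^bsub>?S\<^esub> z) k =
        (\<Sum>g\<in>?U. fmult \<B> g (- g + k) ((x \<oplus>\<^bsub>?S\<^esub> y) g) (z (- g + k)))"
      by (rule section_mult_eq[OF xy z fin]) auto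
    also have "\<dots> = (\<Sum>g\<in>?U. fmult \<B> g (- g + k) (x g) (z (- g + k))) +
        (\<Sum>g\<in>?U. fmult \<B> g (- g + k) (y g) (z (- g + k)))"
      by (simp add: mult_add_left[OF fx fy fz] sum.distrib)
    also have "(\<Sum>g\<in>?U. fmult \<B> g (- g + k) (x g) (z (- g + k))) = (x \<otimes>\<^bsub>?S\<^esub> z) k"
      by (rule section_mult_eq[OF x z fin, symmetric]) auto
    also have "(\<Sum>g\<in>?U. fmult \<B> g (- g + k) (y g) (z (- g + k))) = (y \<otimes>\<^bsub>?S\<^esub> z) k"
      by (rule section_mult_eq[OF y z fin, symmetric]) auto
    finally show "((x \<oplus>\<^bsub>?S\<^esub> y) \<otimes>\<^bsub>?S\<^esub> z) k = (x \<otimes>\<^bsub>?S\<^esub> z \<oplus>\<^bsub>?S\<^esub> y \<otimes>\<^bsub>?S\<^esub> z) k" by simp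
  qed
qed

sublocale S: star_alg "section_algebra \<B>"
  by (rule star_alg_section)

subsection \<open>The unit fibre\<close>

text \<open>The fibre over the neutral element is a C*-algebra in its own right.\<close>

definition unit_algebra :: "'b star_algebra" where
  "unit_algebra = \<lparr>alg_carrier = fibre \<B> 0, alg_zero = 0, alg_add = (+), alg_scale = smul \<B>,
     alg_mult = fmult \<B> 0 0, alg_star = fstar \<B> 0\<rparr>"

lemma unit_algebra_simps [simp]:
  "alg_carrier unit_algebra = fibre \<B> 0" "alg_zero unit_algebra = 0" "alg_add unit_algebra = (+)"
  "alg_scale unit_algebra = smul \<B>" "alg_mult unit_algebra = fmult \<B> 0 0" "alg_star unit_algebra = fstar \<B> 0"
  by (simp_all add: unit_algebra_def)

lemma fnorm_nonneg: "a \<in> fibre \<B> g \<Longrightarrow> 0 \<le> fnorm \<B> g a"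
  using norm_triangle[of a g "smul \<B> (-1) a"] norm_smul[of a g "-1"] norm_eq_0_iff[of 0 g] fibre_smul[of a g "-1"]
  by simp

lemma star_alg_unit: "star_alg unit_algebra"
proof
  fix x y z and c d :: complex
  assume x: "x \<in> alg_carrier unit_algebra"
  show "x\<dagger>\<^bsub>unit_algebra\<^esub> \<in> alg_carrier unit_algebra" using star_closed[of x 0] x by simp
  show "(c \<odot>\<^bsub>unit_algebra\<^esub> x)\<dagger>\<^bsub>unit_algebra\<^esub> = cnj c \<odot>\<^bsub>unit_algebra\<^esub> x\<dagger>\<^bsub>unit_algebra\<^esub>"
    using star_smul[of x 0 c] x by simp
  show "x\<dagger>\<^bsub>unit_algebra\<^esub>\<dagger>\<^bsub>unit_algebra\<^esub> = x" using star_star[of x 0] x by simp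
  assume y: "y \<in> alg_carrier unit_algebra"
  show "x \<otimes>\<^bsub>unit_algebra\<^esub> y \<in> alg_carrier unit_algebra" using mult_closed[of x 0 y 0] x y by simp
  show "(c \<odot>\<^bsub>unit_algebra\<^esub> x) \<otimes>\<^bsub>unit_algebra\<^esub> y = c \<odot>\<^bsub>unit_algebra\<^esub> (x \<otimes>\<^bsub>unit_algebra\<^esub> y)"
    using mult_smul_left[of x 0 y 0 c] x y by simp
  show "x \<otimes>\<^bsub>unit_algebra\<^esub> (c \<odot>\<^bsub>unit_algebra\<^esub> y) = c \<odot>\<^bsub>unit_algebra\<^esub> (x \<otimes>\<^bsub>unit_algebra\<^esub> y)"
    using mult_smul_right[of x 0 y 0 c] x y by simp
  show "(x \<oplus>\<^bsub>unit_algebra\<^esub> y)\<dagger>\<^bsub>unit_algebra\<^esub> = x\<dagger>\<^bsub>unit_algebra\<^esub> \<oplus>\<^bsub>unit_algebra\<^esub> y\<dagger>\<^bsub>unit_algebra\<^esub>"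
    using star_add[of x 0 y] x y by simp
  show "(x \<otimes>\<^bsub>unit_algebra\<^esub> y)\<dagger>\<^bsub>unit_algebra\<^esub> = y\<dagger>\<^bsub>unit_algebra\<^esub> \<otimes>\<^bsub>unit_algebra\<^esub> x\<dagger>\<^bsub>unit_algebra\<^esub>"
    using star_mult[of x 0 y 0] x y by simp
  assume z: "z \<in> alg_carrier unit_algebra"
  show "x \<otimes>\<^bsub>unit_algebra\<^esub> y \<otimes>\<^bsub>unit_algebra\<^esub> z = x \<otimes>\<^bsub>unit_algebra\<^esub> (y \<otimes>\<^bsub>unit_algebra\<^esub> z)"
    using mult_assoc[of x 0 y 0 z 0] x y z by simp
  show "(x \<oplus>\<^bsub>unit_algebra\<^esub> y) \<otimes>\<^bsub>unit_algebra\<^esub> z =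
      x \<otimes>\<^bsub>unit_algebra\<^esub> z \<oplus>\<^bsub>unit_algebra\<^esub> y \<otimes>\<^bsub>unit_algebra\<^esub> z"
    using mult_add_left[of x 0 y z 0] x y z by simp
  show "x \<otimes>\<^bsub>unit_algebra\<^esub> (y \<oplus>\<^bsub>unit_algebra\<^esub> z) =
      x \<otimes>\<^bsub>unit_algebra\<^esub> y \<oplus>\<^bsub>unit_algebra\<^esub> x \<otimes>\<^bsub>unit_algebra\<^esub> z"
    using mult_add_right[of x 0 y 0 z] x y z by simp
qed (auto simp: V.scale_left_distrib V.scale_right_distrib add_ac)

lemma unit_diff [simp]: "x \<ominus>\<^bsub>unit_algebra\<^esub> y = x - y"
  by (simp add: alg_diff_def)

sublocale U: cstar_seminormed unit_algebra "fnorm \<B> 0"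
proof (intro cstar_seminormed.intro star_alg_unit cstar_seminormed_axioms.intro)
  show "cstar_seminorm unit_algebra (fnorm \<B> 0)"
    unfolding cstar_seminorm_def
    using fnorm_nonneg[of _ 0] norm_triangle[of _ 0] norm_smul[of _ 0] norm_mult[of _ 0 _ 0] cstar_identity[of _ 0]
    by auto
qed

sublocale U: cstar_alg unit_algebra "fnorm \<B> 0"
proof
  fix x assume "x \<in> alg_carrier unit_algebra" "fnorm \<B> 0 x = 0"
  then show "x = \<zero>\<^bsub>unit_algebra\<^esub>" using norm_eq_0_iff by simp
next
  fix X assume "\<And>n. X n \<in> alg_carrier unit_algebra" "U.is_cauchy X"
  then show "\<exists>l\<in>alg_carrier unit_algebra. U.conv X l"
    using complete[of X 0] unfolding U.is_cauchy_def U.conv_def by simp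
qed

subsection \<open>The maximal C*-norm\<close>

lemma single_closed: "a \<in> fibre \<B> g \<Longrightarrow> single g a \<in> Sec"
  by (rule Sec_I[of _ "{g}"]) (auto simp: single_def)

lemma single_mult:
  assumes a: "a \<in> fibre \<B> g" and b: "b \<in> fibre \<B> h"
  shows "single g a \<otimes>\<^bsub>section_algebra \<B>\<^esub> single h b = single (g + h) (fmult \<B> g h a b)"
proof
  fix k
  have "(single g a \<otimes>\<^bsub>section_algebra \<B>\<^esub> single h b) k =
      (\<Sum>l\<in>{g}. fmult \<B> l (- l + k) (single g a l) (single h b (- l + k)))"
    using a b by (intro section_mult_eq single_closed) (auto simp: single_def)
  also have "\<dots> = single (g + h) (fmult \<B> g h a b) k"
  proof (cases "k = g + h")
    case False
    then have "- g + k \<noteq> h" by auto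
    then show ?thesis using False a by (simp add: single_def)
  qed (simp add: single_def)
  finally show "(single g a \<otimes>\<^bsub>section_algebra \<B>\<^esub> single h b) k = single (g + h) (fmult \<B> g h a b) k" .
qed

lemma single_star: "(single g a)\<dagger>\<^bsub>section_algebra \<B>\<^esub> = single (- g) (fstar \<B> g a)"
  by (auto simp: single_def fun_eq_iff)

lemma unit_hom: "star_hom unit_algebra (section_algebra \<B>) (single 0)"
  unfolding star_hom_def
proof (intro conjI ballI allI)
  fix x y c assume x: "x \<in> alg_carrier unit_algebra"
  show "single 0 x \<in> Sec" using x by (intro single_closed) simp
  show "single 0 (x\<dagger>\<^bsub>unit_algebra\<^esub>) = (single 0 x)\<dagger>\<^bsub>section_algebra \<B>\<^esub>" by (simp only: single_star) simp
  show "single 0 (c \<odot>\<^bsub>unit_algebra\<^esub> x) = c \<odot>\<^bsub>section_algebra \<B>\<^esub> single 0 x"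
    by (auto simp: single_def fun_eq_iff)
  assume y: "y \<in> alg_carrier unit_algebra"
  show "single 0 (x \<oplus>\<^bsub>unit_algebra\<^esub> y) = single 0 x \<oplus>\<^bsub>section_algebra \<B>\<^esub> single 0 y"
    by (auto simp: single_def fun_eq_iff)
  show "single 0 (x \<otimes>\<^bsub>unit_algebra\<^esub> y) = single 0 x \<otimes>\<^bsub>section_algebra \<B>\<^esub> single 0 y"
    using single_mult[of x 0 y 0] x y by simp
qed

lemma section_induct [consumes 1, case_names zero add]:
  assumes f: "f \<in> Sec" and zero: "P (\<lambda>g. 0)"
    and add: "\<And>f g a. \<lbrakk>f \<in> Sec; f g = 0; a \<in> fibre \<B> g; P f\<rbrakk> \<Longrightarrow> P (f \<oplus>\<^bsub>section_algebra \<B>\<^esub> single g a)"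
  shows "P f"
proof -
  have "finite {g. f g \<noteq> 0}" using Sec_finite[OF f] .
  moreover have "P f" if "finite F" "f \<in> Sec" "{g. f g \<noteq> 0} = F" for F f
    using that
  proof (induction F arbitrary: f rule: finite_induct)
    case empty
    then have "f = (\<lambda>g. 0)" by auto
    then show ?case using zero by simp
  next
    case (insert g F)
    define h where "h = f(g := 0)"
    have fg: "f g \<in> fibre \<B> g" using insert.prems Sec_fibre by blast
    have h: "h \<in> Sec"
      by (rule Sec_I[of _ F]) (use insert Sec_fibre[OF insert.prems(1)] in \<open>auto simp: h_def\<close>)
    have "P h" using insert by (intro insert.IH[OF h]) (auto simp: h_def)
    then have "P (h \<oplus>\<^bsub>section_algebra \<B>\<^esub> single g (f g))" using h fg by (intro add) (auto simp: h_def)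
    moreover have "h \<oplus>\<^bsub>section_algebra \<B>\<^esub> single g (f g) = f"
      by (auto simp: h_def single_def fun_eq_iff)
    ultimately show ?case by simp
  qed
  ultimately show ?thesis using f by blast
qed

text \<open>Every C*-seminorm on the section algebra is bounded by the fibre norms: on the unit fibre by automatic
  contractivity, on the other fibres by \<open>\<parallel>a\<parallel>\<^sup>2 = \<parallel>a\<^sup>* a\<parallel>\<close>. So the maximal C*-norm is finite.\<close>

lemma cstar_seminorm_single:
  assumes p: "cstar_seminorm (section_algebra \<B>) p" and a: "a \<in> fibre \<B> g"
  shows "p (single g a) \<le> fnorm \<B> g a"
proof -
  interpret cstar_hom unit_algebra "fnorm \<B> 0" "section_algebra \<B>" p "single 0"
    by (intro cstar_hom.intro cstar_seminormed.intro cstar_seminormed_axioms.intro cstar_hom_axioms.intro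
        star_alg_section U.cstar_alg_axioms p unit_hom)
  define b where "b = fmult \<B> (- g) g (fstar \<B> g a) a"
  have b: "b \<in> fibre \<B> 0" unfolding b_def using mult_closed[OF star_closed[OF a] a] by simp
  have "(p (single g a))\<^sup>2 = p ((single g a)\<dagger>\<^bsub>section_algebra \<B>\<^esub> \<otimes>\<^bsub>section_algebra \<B>\<^esub> single g a)"
    using D.p_star_mult[OF single_closed[OF a]] by simp
  also have "(single g a)\<dagger>\<^bsub>section_algebra \<B>\<^esub> \<otimes>\<^bsub>section_algebra \<B>\<^esub> single g a = single 0 b"
    unfolding single_star single_mult[OF star_closed[OF a] a] b_def by simp
  also have "p (single 0 b) \<le> fnorm \<B> 0 b" using contractive[of b] b by simp
  also have "\<dots> = (fnorm \<B> g a)\<^sup>2" unfolding b_def by (rule cstar_identity[OF a])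
  finally show ?thesis using fnorm_nonneg[OF a] by (intro power2_le_imp_le[of "p (single g a)"])
qed

lemma cstar_seminorm_bounded:
  assumes f: "f \<in> Sec"
  shows "\<exists>M. \<forall>p. cstar_seminorm (section_algebra \<B>) p \<longrightarrow> p f \<le> M"
  using f
proof (induction rule: section_induct)
  case zero
  show ?case
  proof (intro exI allI impI)
    fix p assume "cstar_seminorm (section_algebra \<B>) p"
    then interpret cstar_seminormed "section_algebra \<B>" p
      by (intro cstar_seminormed.intro star_alg_section cstar_seminormed_axioms.intro)
    show "p (\<lambda>g. 0) \<le> 0" using p_zero by simp
  qed
next
  case (add f g a)
  then obtain M where M: "\<And>p. cstar_seminorm (section_algebra \<B>) p \<Longrightarrow> p f \<le> M" by blast
  show ?case
  proof (intro exI allI impI)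
    fix p assume p: "cstar_seminorm (section_algebra \<B>) p"
    then interpret cstar_seminormed "section_algebra \<B>" p
      by (intro cstar_seminormed.intro star_alg_section cstar_seminormed_axioms.intro)
    show "p (f \<oplus>\<^bsub>section_algebra \<B>\<^esub> single g a) \<le> M + fnorm \<B> g a"
      using p_add[OF add(1) single_closed[OF add(3)]] M[OF p] cstar_seminorm_single[OF p add(3)] by linarith
  qed
qed

abbreviation mx :: "('g \<Rightarrow> 'b) \<Rightarrow> real" where
  "mx \<equiv> max_cstar_norm (section_star_algebra \<B>)"

lemma max_norm_upper:
  assumes "cstar_seminorm (section_algebra \<B>) p" "f \<in> Sec"
  shows "p f \<le> mx f"
  unfolding max_cstar_norm_def cstar_seminorm_section
  using assms cstar_seminorm_bounded[OF assms(2)] by (intro cSUP_upper) (auto intro: bdd_aboveI2)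

lemma max_norm_least:
  assumes "\<And>p. cstar_seminorm (section_algebra \<B>) p \<Longrightarrow> p f \<le> M"
  shows "mx f \<le> M"
  unfolding max_cstar_norm_def cstar_seminorm_section
proof (rule cSUP_least)
  have "cstar_seminorm (section_algebra \<B>) (\<lambda>_. 0)" by (simp add: cstar_seminorm_def)
  then show "{p. cstar_seminorm (section_algebra \<B>) p} \<noteq> {}" by blast
qed (use assms in simp)

lemma max_norm_cstar: "cstar_seminorm (section_algebra \<B>) mx"
proof -
  let ?S = "section_algebra \<B>"
  have sn: "cstar_seminormed ?S p" if "cstar_seminorm ?S p" for p
    using that by (intro cstar_seminormed.intro star_alg_section cstar_seminormed_axioms.intro)
  have zero: "cstar_seminorm ?S (\<lambda>_. 0)" by (simp add: cstar_seminorm_def)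
  have nonneg: "0 \<le> mx x" if "x \<in> Sec" for x using max_norm_upper[OF zero that] .
  have scale_le: "mx (c \<odot>\<^bsub>?S\<^esub> x) \<le> cmod c * mx x" if x: "x \<in> Sec" for x c
  proof (rule max_norm_least)
    fix p assume p: "cstar_seminorm ?S p"
    show "p (c \<odot>\<^bsub>?S\<^esub> x) \<le> cmod c * mx x"
      using cstar_seminormed.p_scale[OF sn[OF p] x, of c] max_norm_upper[OF p x]
      by (simp only:) (intro mult_left_mono, auto)
  qed
  show ?thesis
    unfolding cstar_seminorm_def
  proof (intro conjI ballI allI)
    fix x assume x: "x \<in> Sec"
    show "0 \<le> mx x" by (rule nonneg[OF x])
    show "mx (c \<odot>\<^bsub>?S\<^esub> x) = cmod c * mx x" for c
    proof (cases "c = 0")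
      case True
      then show ?thesis
        using scale_le[OF x, of c] nonneg[OF S.scale_closed[OF x, of c]] by simp
    next
      case False
      have "mx ((1 / c) \<odot>\<^bsub>?S\<^esub> c \<odot>\<^bsub>?S\<^esub> x) \<le> cmod (1 / c) * mx (c \<odot>\<^bsub>?S\<^esub> x)"
        by (rule scale_le[OF S.scale_closed[OF x]])
      moreover have "(1 / c) \<odot>\<^bsub>?S\<^esub> c \<odot>\<^bsub>?S\<^esub> x = x"
        unfolding S.scale_scale[OF x] using False S.scale_one[OF x] by simp
      ultimately have "cmod c * mx x \<le> mx (c \<odot>\<^bsub>?S\<^esub> x)"
        using False by (simp add: norm_divide field_simps)
      then show ?thesis using scale_le[OF x, of c] by simp
    qed
    show "mx (x\<dagger>\<^bsub>?S\<^esub> \<otimes>\<^bsub>?S\<^esub> x) = (mx x)\<^sup>2"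
    proof (rule antisym)
      show "mx (x\<dagger>\<^bsub>?S\<^esub> \<otimes>\<^bsub>?S\<^esub> x) \<le> (mx x)\<^sup>2"
      proof (rule max_norm_least)
        fix p assume p: "cstar_seminorm ?S p"
        show "p (x\<dagger>\<^bsub>?S\<^esub> \<otimes>\<^bsub>?S\<^esub> x) \<le> (mx x)\<^sup>2"
          unfolding cstar_seminormed.p_star_mult[OF sn[OF p] x]
          using max_norm_upper[OF p x] cstar_seminormed.p_nonneg[OF sn[OF p] x] by (rule power_mono)
      qed
      have xx: "x\<dagger>\<^bsub>?S\<^esub> \<otimes>\<^bsub>?S\<^esub> x \<in> Sec" by (intro S.mult_closed S.star_closed x)
      have "mx x \<le> sqrt (mx (x\<dagger>\<^bsub>?S\<^esub> \<otimes>\<^bsub>?S\<^esub> x))"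
      proof (rule max_norm_least)
        fix p assume p: "cstar_seminorm ?S p"
        have "(p x)\<^sup>2 \<le> mx (x\<dagger>\<^bsub>?S\<^esub> \<otimes>\<^bsub>?S\<^esub> x)"
          using max_norm_upper[OF p xx] unfolding cstar_seminormed.p_star_mult[OF sn[OF p] x] .
        then show "p x \<le> sqrt (mx (x\<dagger>\<^bsub>?S\<^esub> \<otimes>\<^bsub>?S\<^esub> x))" by (rule real_le_rsqrt)
      qed
      then have "(mx x)\<^sup>2 \<le> (sqrt (mx (x\<dagger>\<^bsub>?S\<^esub> \<otimes>\<^bsub>?S\<^esub> x)))\<^sup>2"
        using nonneg[OF x] by (rule power_mono)
      then show "(mx x)\<^sup>2 \<le> mx (x\<dagger>\<^bsub>?S\<^esub> \<otimes>\<^bsub>?S\<^esub> x)" using nonneg[OF xx] by simp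
    qed
    fix y assume y: "y \<in> Sec"
    show "mx (x \<oplus>\<^bsub>?S\<^esub> y) \<le> mx x + mx y"
    proof (rule max_norm_least)
      fix p assume p: "cstar_seminorm ?S p"
      show "p (x \<oplus>\<^bsub>?S\<^esub> y) \<le> mx x + mx y"
        using cstar_seminormed.p_add[OF sn[OF p] x y] max_norm_upper[OF p x] max_norm_upper[OF p y] by linarith
    qed
    show "mx (x \<otimes>\<^bsub>?S\<^esub> y) \<le> mx x * mx y"
    proof (rule max_norm_least)
      fix p assume p: "cstar_seminorm ?S p"
      have "p x * p y \<le> mx x * mx y"
        using max_norm_upper[OF p x] max_norm_upper[OF p y] nonneg[OF x] cstar_seminormed.p_nonneg[OF sn[OF p] y]
        by (rule mult_mono)
      then show "p (x \<otimes>\<^bsub>?S\<^esub> y) \<le> mx x * mx y"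
        using cstar_seminormed.p_mult[OF sn[OF p] x y] by linarith
    qed
  qed
qed

sublocale S: cstar_prenormed "section_algebra \<B>"
  by (intro cstar_prenormed.intro cstar_seminormed.intro cstar_seminormed_axioms.intro star_alg_section)
    (simp only: section_algebra_simps max_norm_cstar)

subsection \<open>The unit fibre inside the C*-algebra of the bundle\<close>

lemma fell_cstar_completion: "fell_cstar \<B> = completion (section_algebra \<B>)"
  by (rule fell_cstar_def)

abbreviation emb :: "('g \<Rightarrow> 'b) \<Rightarrow> (nat \<Rightarrow> 'g \<Rightarrow> 'b) set" where
  "emb \<equiv> completion_embed (section_algebra \<B>)"

lemma unit_fibre_eq: "unit_fibre \<B> = (\<lambda>a. emb (single 0 a)) ` fibre \<B> 0"
  unfolding unit_fibre_def single_def ..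

text \<open>This would be immediate if the maximal norm were known to extend the norm of the unit fibre. The proof
  uses instead that ranges of *-homomorphisms are closed.\<close>

lemma unit_fibre_closed:
  assumes "\<And>n. Y n \<in> unit_fibre \<B>" "l \<in> S.compl.C" "S.compl.conv Y l"
  shows "l \<in> unit_fibre \<B>"
proof -
  have "star_hom unit_algebra (completion (section_algebra \<B>)) (\<lambda>a. emb (single 0 a))"
    using unit_hom S.embed_hom unfolding star_hom_def by (simp del: section_algebra_simps)
  then interpret cstar_hom_complete unit_algebra "fnorm \<B> 0" "completion (section_algebra \<B>)"
      "alg_norm (completion (section_algebra \<B>))" "\<lambda>a. emb (single 0 a)"
    by (intro cstar_hom_complete.intro cstar_hom.intro cstar_hom_axioms.intro U.cstar_alg_axioms
        S.compl.cstar_alg_axioms S.compl.cstar_seminormed_axioms)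
  show ?thesis using range_closed[of Y l] assms by (simp add: unit_fibre_eq)
qed

end

section \<open>Characters of abelian groups\<close>

text \<open>Natural multiples in an additive group.\<close>

primrec nmul :: "nat \<Rightarrow> 'g::ab_group_add \<Rightarrow> 'g" where
  "nmul 0 h = 0"
| "nmul (Suc n) h = h + nmul n h"

lemma nmul_add: "nmul (m + n) h = nmul m h + nmul n h"
  by (induction m) (auto simp: add.assoc)

lemma nmul_mult: "nmul (m * n) h = nmul m (nmul n h)"
  by (induction m) (auto simp: nmul_add)

text \<open>The graph of a circle-valued homomorphism on a subgroup.\<close>

definition partial_character :: "('g::ab_group_add \<times> complex) set \<Rightarrow> bool" where
  "partial_character R \<longleftrightarrow> (0, 1) \<in> R \<and> (\<forall>a z. (a, z) \<in> R \<longrightarrow> cmod z = 1) \<and>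
     (\<forall>a z b w. (a, z) \<in> R \<longrightarrow> (b, w) \<in> R \<longrightarrow> (a - b, z / w) \<in> R) \<and>
     (\<forall>z. (0, z) \<in> R \<longrightarrow> z = 1)"

lemma partial_character_diff:
  "\<lbrakk>partial_character R; (a, z) \<in> R; (b, w) \<in> R\<rbrakk> \<Longrightarrow> (a - b, z / w) \<in> R"
  unfolding partial_character_def by blast

lemma partial_character_norm: "\<lbrakk>partial_character R; (a, z) \<in> R\<rbrakk> \<Longrightarrow> cmod z = 1"
  unfolding partial_character_def by blast

lemma partial_character_minus:
  assumes "partial_character R" "(a, z) \<in> R"
  shows "(- a, 1 / z) \<in> R"
  using partial_character_diff[OF assms(1) _ assms(2), of 0 1] assms(1)
  by (simp add: partial_character_def)

lemma partial_character_add: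
  assumes "partial_character R" "(a, z) \<in> R" "(b, w) \<in> R"
  shows "(a + b, z * w) \<in> R"
  using partial_character_diff[OF assms(1,2) partial_character_minus[OF assms(1,3)]] by simp

lemma partial_character_unique:
  assumes "partial_character R" "(a, z) \<in> R" "(a, w) \<in> R"
  shows "z = w"
proof -
  have "(0, z / w) \<in> R" using partial_character_diff[OF assms] by simp
  then have "z / w = 1" using assms(1) unfolding partial_character_def by blast
  then show ?thesis by (metis div_by_0 divide_eq_1_iff zero_neq_one)
qed

lemma partial_character_nmul:
  assumes "partial_character R" "(a, z) \<in> R"
  shows "(nmul k a, z ^ k) \<in> R"
proof (induction k)
  case 0
  show ?case using assms(1) by (simp add: partial_character_def)
next
  case (Suc k)
  from partial_character_add[OF assms(1,2) this] show ?case by simp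
qed

text \<open>The extended graph is generated by \<open>R\<close> and \<open>(h, w)\<close>. It is single-valued because \<open>w\<close> is compatible with
  the values of \<open>R\<close> at the multiples of \<open>h\<close>.\<close>

lemma partial_character_extend:
  assumes R: "partial_character R" and w: "cmod w = 1"
    and compat: "\<And>k v. (nmul k h, v) \<in> R \<Longrightarrow> v = w ^ k"
  shows "\<exists>R'. partial_character R' \<and> R \<subseteq> R' \<and> (h, w) \<in> R'"
proof -
  define R' where "R' = {(a + nmul m h - nmul n h, z * w ^ m / w ^ n) | a z m n. (a, z) \<in> R}"
  have w0: "w \<noteq> 0" using w by auto
  have RI: "(a + nmul m h - nmul n h, z * w ^ m / w ^ n) \<in> R'" if "(a, z) \<in> R" for a z m n
    unfolding R'_def using that by blast
  have RE: "\<exists>a z m n. (b = a + nmul m h - nmul n h \<and> v = z * w ^ m / w ^ n) \<and> (a, z) \<in> R"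
    if "(b, v) \<in> R'" for b v
    using that unfolding R'_def by (simp only: mem_Collect_eq prod.inject)
  have "partial_character R'"
    unfolding partial_character_def
  proof (intro conjI allI impI)
    show "(0, 1) \<in> R'" using RI[of 0 1 0 0] R by (simp add: partial_character_def)
    show "cmod z = 1" if "(a, z) \<in> R'" for a z
      using that partial_character_norm[OF R] w unfolding R'_def
      by (auto simp: norm_mult norm_divide norm_power)
    show "(a - b, z / v) \<in> R'" if az: "(a, z) \<in> R'" and bv: "(b, v) \<in> R'" for a z b v
    proof -
      obtain a1 z1 m1 n1 where 1: "a = a1 + nmul m1 h - nmul n1 h" "z = z1 * w ^ m1 / w ^ n1" "(a1, z1) \<in> R"
        using RE[OF az] by blast
      obtain a2 z2 m2 n2 where 2: "b = a2 + nmul m2 h - nmul n2 h" "v = z2 * w ^ m2 / w ^ n2" "(a2, z2) \<in> R"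
        using RE[OF bv] by blast
      have "a - b = (a1 - a2) + nmul (m1 + n2) h - nmul (n1 + m2) h"
        unfolding 1 2 nmul_add by (simp add: algebra_simps)
      moreover have "z / v = (z1 / z2) * w ^ (m1 + n2) / w ^ (n1 + m2)"
        unfolding 1 2 power_add by (simp add: field_simps)
      ultimately show ?thesis using RI[OF partial_character_diff[OF R 1(3) 2(3)]] by metis
    qed
    show "z = 1" if z: "(0, z) \<in> R'" for z
    proof -
      obtain a u m n where *: "0 = a + nmul m h - nmul n h" "z = u * w ^ m / w ^ n" "(a, u) \<in> R"
        using RE[OF z] by blast
      have u0: "u \<noteq> 0" using partial_character_norm[OF R *(3)] by auto
      show ?thesis
      proof (cases "n \<le> m")
        case True
        then have m: "m = n + (m - n)" by simp
        have "nmul (m - n) h = - a"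
          using *(1) nmul_add[of n "m - n" h] m by (simp add: algebra_simps eq_neg_iff_add_eq_0)
        then have "1 / u = w ^ (m - n)" using compat partial_character_minus[OF R *(3)] by metis
        moreover have "w ^ m = w ^ n * w ^ (m - n)" using m by (metis power_add)
        ultimately show ?thesis unfolding *(2) using u0 w0 by (simp add: field_simps)
      next
        case False
        then have n: "n = m + (n - m)" by simp
        have "nmul (n - m) h = a"
          using *(1) nmul_add[of m "n - m" h] n by (simp add: algebra_simps)
        then have "u = w ^ (n - m)" using compat *(3) by metis
        moreover have "w ^ n = w ^ m * w ^ (n - m)" using n by (metis power_add)
        ultimately show ?thesis unfolding *(2) using u0 w0 by (simp add: field_simps)
      qed
    qed
  qed
  moreover have "R \<subseteq> R'"
  proof
    fix x assume "x \<in> R"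
    then show "x \<in> R'" using RI[of "fst x" "snd x" 0 0] by simp
  qed
  moreover have "(h, w) \<in> R'"
    using RI[of 0 1 1 0] R by (simp add: partial_character_def)
  ultimately show ?thesis by blast
qed

lemma cis_root:
  assumes "cmod v = 1" "n > 0"
  shows "\<exists>w. cmod w = 1 \<and> w ^ n = v"
proof -
  have "cis (Arg v / real n) ^ n = cis (Arg v)" using assms by (simp add: Complex.DeMoivre)
  also have "\<dots> = v" using assms cis_Arg[of v] by (cases "v = 0") (auto simp: sgn_eq)
  finally show ?thesis by (intro exI[of _ "cis (Arg v / real n)"]) simp
qed

text \<open>A root of the value at the least positive multiple of \<open>h\<close> in the domain is compatible with the values at
  all other multiples of \<open>h\<close>.\<close>

lemma partial_character_compatible_value:
  assumes R: "partial_character R" and n: "n > 0" "(nmul n h, v) \<in> R"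
    and least: "\<And>k u. k > 0 \<Longrightarrow> (nmul k h, u) \<in> R \<Longrightarrow> n \<le> k"
    and w: "w ^ n = v" and k: "(nmul k h, u) \<in> R"
  shows "u = w ^ k"
proof -
  define q r where "q = k div n" and "r = k mod n"
  have kqr: "k = r + q * n" unfolding q_def r_def by simp
  have q: "(nmul (q * n) h, v ^ q) \<in> R"
    unfolding nmul_mult by (rule partial_character_nmul[OF R n(2)])
  have "(nmul r h, u / v ^ q) \<in> R"
    using partial_character_diff[OF R k q] unfolding kqr nmul_add by simp
  then have "r = 0" using least[of r] n(1) unfolding r_def
    by (metis gr0I mod_less_divisor not_le)
  then have "u = v ^ q" using partial_character_unique[OF R k] q kqr by simp
  then show ?thesis using w kqr \<open>r = 0\<close> by (metis add_0 mult.commute power_mult)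
qed

text \<open>The circle is divisible; therefore a partial character extends to any further element.\<close>

lemma partial_character_extend_ex:
  assumes R: "partial_character R"
  shows "\<exists>R' w. partial_character R' \<and> R \<subseteq> R' \<and> (h, w) \<in> R'"
proof (cases "\<exists>k>0. \<exists>u. (nmul k h, u) \<in> R")
  case True
  define n where "n = (LEAST k. k > 0 \<and> (\<exists>u. (nmul k h, u) \<in> R))"
  have n: "n > 0" "\<exists>u. (nmul n h, u) \<in> R" unfolding n_def using LeastI_ex[OF True] by auto
  have least: "n \<le> k" if "k > 0" "(nmul k h, u) \<in> R" for k u
    unfolding n_def using that by (intro Least_le) auto
  obtain v where v: "(nmul n h, v) \<in> R" using n by blast
  obtain w where w: "cmod w = 1" "w ^ n = v" using cis_root[OF partial_character_norm[OF R v] n(1)] by blast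
  have "u = w ^ k" if "(nmul k h, u) \<in> R" for k u
    by (rule partial_character_compatible_value[OF R n(1) v _ w(2) that]) (rule least)
  then show ?thesis using partial_character_extend[OF R w(1), of h] by blast
next
  case False
  have "u = 1 ^ k" if "(nmul k h, u) \<in> R" for k u
  proof -
    have "\<not> k > 0"
    proof
      assume "k > 0"
      with that have "\<exists>k>0. \<exists>u. (nmul k h, u) \<in> R" by (intro exI conjI)
      then show False using False by contradiction
    qed
    then have "k = 0" by simp
    then show ?thesis using that R by (simp add: partial_character_def)
  qed
  then show ?thesis using partial_character_extend[OF R, of 1 h] by auto
qed

text \<open>The first step of the extension, from the trivial subgroup to the one generated by \<open>g\<close>, leaves the
  freedom to choose a nontrivial value at \<open>g\<close>.\<close>

lemma partial_character_nontrivial: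
  fixes g :: "'g::ab_group_add"
  assumes g: "g \<noteq> 0"
  shows "\<exists>R w. partial_character R \<and> (g, w) \<in> R \<and> w \<noteq> 1"
proof -
  define R :: "('g \<times> complex) set" where "R = {(0, 1)}"
  have R: "partial_character R" unfolding R_def partial_character_def by auto
  show ?thesis
  proof (cases "\<exists>k>0. nmul k g = 0")
    case True
    define n where "n = (LEAST k. k > 0 \<and> nmul k g = 0)"
    have n: "n > 0" "nmul n g = 0" unfolding n_def using LeastI_ex[OF True] by auto
    have least: "n \<le> k" if "k > 0" "(nmul k g, u) \<in> R" for k u
      unfolding n_def using that by (intro Least_le) (auto simp: R_def)
    have "n \<noteq> 1" using n g by auto
    with n have n2: "n \<ge> 2" by simp
    define w where "w = cis (2 * pi / real n)"
    have "w ^ n = 1" unfolding w_def using n by (simp add: Complex.DeMoivre)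
    have "w \<noteq> 1"
    proof
      assume "w = 1"
      then have "cos (2 * pi / real n) = 1" unfolding w_def by (metis cis.simps(1) one_complex.simps(1))
      then obtain m :: int where "2 * pi / real n = real_of_int m * 2 * pi"
        using cos_one_2pi_int by blast
      then have "real_of_int m * real n = 1" using n by (simp add: field_simps)
      then have "m * int n = 1" by (metis of_int_1 of_int_eq_iff of_int_mult of_int_of_nat_eq)
      then have "int n dvd 1" by (metis dvd_triv_right)
      then show False using n2 by simp
    qed
    moreover have "(nmul n g, 1) \<in> R" using n by (simp add: R_def)
    moreover have "u = w ^ k" if "(nmul k g, u) \<in> R" for k u
      by (rule partial_character_compatible_value[OF R n(1) \<open>(nmul n g, 1) \<in> R\<close> _ \<open>w ^ n = 1\<close> that]) (rule least)
    ultimately show ?thesis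
      using partial_character_extend[OF R, of w g] by (auto simp: w_def)
  next
    case False
    have "u = (- 1) ^ k" if "(nmul k g, u) \<in> R" for k u
      using False that by (cases k) (auto simp: R_def)
    then have "\<exists>R'. partial_character R' \<and> R \<subseteq> R' \<and> (g, -1) \<in> R'"
      by (intro partial_character_extend[OF R]) auto
    then show ?thesis by (metis one_neq_neg_one)
  qed
qed

text \<open>Pontryagin duality in its weakest form: characters separate the points of a discrete abelian
  group. A maximal partial character has full domain.\<close>

theorem characters_separate_points:
  fixes g :: "'g::ab_group_add"
  assumes "g \<noteq> 0"
  obtains \<xi> where "\<xi> \<in> dual_group" "\<xi> g \<noteq> 1"
proof -
  obtain R0 w where R0: "partial_character R0" "(g, w) \<in> R0" "w \<noteq> 1"
    using partial_character_nontrivial[OF assms] by blast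
  define \<A> where "\<A> = {R. partial_character R \<and> R0 \<subseteq> R}"
  have "\<exists>M\<in>\<A>. \<forall>X\<in>\<A>. M \<subseteq> X \<longrightarrow> X = M"
  proof (rule subset_Zorn)
    fix \<C> assume "subset.chain \<A> \<C>"
    then have ch: "\<C> \<subseteq> \<A>" "\<And>X Y. X \<in> \<C> \<Longrightarrow> Y \<in> \<C> \<Longrightarrow> X \<subseteq> Y \<or> Y \<subseteq> X"
      unfolding subset.chain_def by auto
    show "\<exists>U\<in>\<A>. \<forall>X\<in>\<C>. X \<subseteq> U"
    proof (cases "\<C> = {}")
      case True
      then show ?thesis using R0 unfolding \<A>_def by blast
    next
      case False
      have pc: "partial_character X" "R0 \<subseteq> X" if "X \<in> \<C>" for X using that ch(1) unfolding \<A>_def by auto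
      have "partial_character (\<Union>\<C>)"
        unfolding partial_character_def
      proof (intro conjI allI impI)
        show "(0, 1) \<in> \<Union>\<C>" using False pc(1) unfolding partial_character_def by blast
        show "cmod z = 1" if "(a, z) \<in> \<Union>\<C>" for a z using that pc(1) partial_character_norm by blast
        show "z = 1" if "(0, z) \<in> \<Union>\<C>" for z using that pc(1) unfolding partial_character_def by blast
        show "(a - b, z / v) \<in> \<Union>\<C>" if az: "(a, z) \<in> \<Union>\<C>" and bv: "(b, v) \<in> \<Union>\<C>" for a z b v
        proof -
          obtain X Y where XY: "X \<in> \<C>" "(a, z) \<in> X" "Y \<in> \<C>" "(b, v) \<in> Y" using az bv by blast
          then obtain Z where "Z \<in> \<C>" "(a, z) \<in> Z" "(b, v) \<in> Z" using ch(2)[of X Y] by blast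
          then show ?thesis using partial_character_diff[OF pc(1)] by blast
        qed
      qed
      moreover have "R0 \<subseteq> \<Union>\<C>" using False pc(2) by blast
      ultimately show ?thesis unfolding \<A>_def by blast
    qed
  qed
  then obtain M where "M \<in> \<A>" and max: "\<forall>X\<in>\<A>. M \<subseteq> X \<longrightarrow> X = M" by blast
  then have M: "partial_character M" "R0 \<subseteq> M"
      "\<And>X. partial_character X \<Longrightarrow> R0 \<subseteq> X \<Longrightarrow> M \<subseteq> X \<Longrightarrow> X = M"
    unfolding \<A>_def by simp_all
  have total: "\<exists>z. (h, z) \<in> M" for h
  proof -
    obtain R' z where "partial_character R'" "M \<subseteq> R'" "(h, z) \<in> R'"
      using partial_character_extend_ex[OF M(1), of h] by blast
    then show ?thesis using M(2,3) by blast
  qed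
  define \<xi> where "\<xi> h = (SOME z. (h, z) \<in> M)" for h
  have \<xi>: "(h, \<xi> h) \<in> M" for h unfolding \<xi>_def using total by (rule someI_ex)
  have "\<xi> \<in> dual_group"
    unfolding dual_group_def
  proof (intro CollectI conjI allI)
    show "cmod (\<xi> h) = 1" for h using partial_character_norm[OF M(1) \<xi>] .
    show "\<xi> (h + k) = \<xi> h * \<xi> k" for h k
      using partial_character_unique[OF M(1) \<xi> partial_character_add[OF M(1) \<xi> \<xi>]] .
  qed
  moreover have "\<xi> g = w" using partial_character_unique[OF M(1) \<xi>] R0(2) M(2) by blast
  ultimately show ?thesis using that R0(3) by blast
qed

lemma dual_norm: "\<xi> \<in> dual_group \<Longrightarrow> cmod (\<xi> g) = 1"
  by (simp add: dual_group_def)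

lemma dual_add: "\<xi> \<in> dual_group \<Longrightarrow> \<xi> (g + h) = \<xi> g * \<xi> h"
  by (simp add: dual_group_def)

lemma dual_nonzero: "\<xi> \<in> dual_group \<Longrightarrow> \<xi> g \<noteq> 0"
  using dual_norm[of \<xi> g] by auto

lemma dual_zero: "\<xi> \<in> dual_group \<Longrightarrow> \<xi> 0 = 1"
  using dual_add[of \<xi> 0 0] dual_nonzero[of \<xi> 0] by simp

lemma dual_cnj: "\<xi> \<in> dual_group \<Longrightarrow> \<xi> g * cnj (\<xi> g) = 1"
  using complex_norm_square[of "\<xi> g"] by (simp add: dual_norm)

lemma dual_minus: "\<xi> \<in> dual_group \<Longrightarrow> \<xi> (- g) = cnj (\<xi> g)"
  using dual_add[of \<xi> "- g" g] dual_cnj[of \<xi> g]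
  by (metis add.left_inverse dual_nonzero dual_zero mult.commute mult_right_cancel)

lemma dual_diff: "\<xi> \<in> dual_group \<Longrightarrow> \<xi> (g - h) = \<xi> g * cnj (\<xi> h)"
  using dual_add[of \<xi> g "- h"] dual_minus[of \<xi> h] by simp

lemma dual_one: "(\<lambda>g. 1) \<in> dual_group"
  by (simp add: dual_group_def)

lemma dual_mult: "\<xi> \<in> dual_group \<Longrightarrow> \<psi> \<in> dual_group \<Longrightarrow> (\<lambda>g. \<xi> g * \<psi> g) \<in> dual_group"
  by (simp add: dual_group_def norm_mult)

lemma dual_power: "\<xi> \<in> dual_group \<Longrightarrow> (\<lambda>g. \<xi> g ^ n) \<in> dual_group"
  by (simp add: dual_group_def norm_power power_mult_distrib)

lemma dual_inverse: "\<xi> \<in> dual_group \<Longrightarrow> (\<lambda>g. cnj (\<xi> g)) \<in> dual_group"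
  by (simp add: dual_group_def)

text \<open>Total boundedness of the dual group in the topology of pointwise convergence.\<close>

lemma dual_finite_net:
  fixes F :: "'g::ab_group_add set"
  assumes F: "finite F" and \<delta>: "\<delta> > 0"
  obtains Z where "finite Z" "Z \<subseteq> dual_group"
    "\<And>\<xi>. \<xi> \<in> dual_group \<Longrightarrow> \<exists>z\<in>Z. \<forall>g\<in>F. cmod (\<xi> g - z g) < \<delta>"
proof -
  \<comment> \<open>Two characters whose values on \<open>F\<close> lie in the same squares of side \<open>\<delta>/2\<close> are close on \<open>F\<close>; one
    representative for each of the finitely many patterns of squares suffices.\<close>
  define \<eta> where "\<eta> = \<delta> / 2"
  have \<eta>: "\<eta> > 0" unfolding \<eta>_def using \<delta> by simp
  define \<Phi> where "\<Phi> \<xi> = (\<lambda>g\<in>F. (\<lfloor>Re (\<xi> g) / \<eta>\<rfloor>, \<lfloor>Im (\<xi> g) / \<eta>\<rfloor>))" for \<xi> :: "'g \<Rightarrow> complex"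
  define I where "I = {\<lfloor>- 1 / \<eta>\<rfloor>..\<lfloor>1 / \<eta>\<rfloor>}"
  have range: "\<lfloor>x / \<eta>\<rfloor> \<in> I" if "\<bar>x\<bar> \<le> 1" for x
    unfolding I_def using divide_right_mono[of "-1" x \<eta>] divide_right_mono[of x 1 \<eta>] that \<eta>
    by (auto simp: abs_le_iff intro!: floor_mono)
  have "\<Phi> ` dual_group \<subseteq> PiE F (\<lambda>_. I \<times> I)"
  proof
    fix t assume "t \<in> \<Phi> ` dual_group"
    then obtain \<xi> where \<xi>: "\<xi> \<in> dual_group" "t = \<Phi> \<xi>" by blast
    have "\<bar>Re (\<xi> g)\<bar> \<le> 1" "\<bar>Im (\<xi> g)\<bar> \<le> 1" for g
      using abs_Re_le_cmod[of "\<xi> g"] abs_Im_le_cmod[of "\<xi> g"] dual_norm[OF \<xi>(1)] by auto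
    then show "t \<in> PiE F (\<lambda>_. I \<times> I)" unfolding \<xi>(2) \<Phi>_def by (intro restrict_PiE_iff[THEN iffD2]) (auto intro: range)
  qed
  moreover have "finite (PiE F (\<lambda>_. I \<times> I))" using F by (intro finite_PiE) (auto simp: I_def)
  ultimately have fin: "finite (\<Phi> ` dual_group)" by (rule finite_subset)
  define rep where "rep t = (SOME \<xi>. \<xi> \<in> dual_group \<and> \<Phi> \<xi> = t)" for t
  have rep: "rep t \<in> dual_group" "\<Phi> (rep t) = t" if "t \<in> \<Phi> ` dual_group" for t
    using someI_ex[of "\<lambda>\<xi>. \<xi> \<in> dual_group \<and> \<Phi> \<xi> = t"] that unfolding rep_def by blast+
  show ?thesis
  proof (rule that[of "rep ` \<Phi> ` dual_group"])
    show "finite (rep ` \<Phi> ` dual_group)" using fin by blast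
    show "rep ` \<Phi> ` dual_group \<subseteq> dual_group" using rep by blast
    fix \<xi> :: "'g \<Rightarrow> complex" assume \<xi>: "\<xi> \<in> dual_group"
    have "cmod (\<xi> g - rep (\<Phi> \<xi>) g) < \<delta>" if g: "g \<in> F" for g
    proof -
      have "\<Phi> (rep (\<Phi> \<xi>)) g = \<Phi> \<xi> g" using rep(2) \<xi> by simp
      then have fl: "\<lfloor>Re (\<xi> g) / \<eta>\<rfloor> = \<lfloor>Re (rep (\<Phi> \<xi>) g) / \<eta>\<rfloor>" "\<lfloor>Im (\<xi> g) / \<eta>\<rfloor> = \<lfloor>Im (rep (\<Phi> \<xi>) g) / \<eta>\<rfloor>"
        using g unfolding \<Phi>_def by auto
      have close: "\<bar>x - y\<bar> < \<eta>" if "\<lfloor>x / \<eta>\<rfloor> = \<lfloor>y / \<eta>\<rfloor>" for x y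
      proof -
        have "\<bar>x / \<eta> - y / \<eta>\<bar> < 1" using that by linarith
        then show ?thesis using \<eta> by (simp add: field_simps diff_divide_distrib[symmetric])
      qed
      have "cmod (\<xi> g - rep (\<Phi> \<xi>) g) \<le> \<bar>Re (\<xi> g - rep (\<Phi> \<xi>) g)\<bar> + \<bar>Im (\<xi> g - rep (\<Phi> \<xi>) g)\<bar>"
        by (rule cmod_le)
      also have "\<dots> < \<eta> + \<eta>" using close[OF fl(1)] close[OF fl(2)] by simp
      finally show ?thesis unfolding \<eta>_def by simp
    qed
    then show "\<exists>z\<in>rep ` \<Phi> ` dual_group. \<forall>g\<in>F. cmod (\<xi> g - z g) < \<delta>" using \<xi> by blast
  qed
qed

section \<open>Positive definite functions\<close>

text \<open>The closed convex cone generated by the characters in the topology of pointwise convergence.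
  By Bochner's theorem it consists of all positive definite functions; its closure properties are
  enough here. Multipliers from this cone are integrals of the dual action against positive measures,
  and this description dispenses with Haar measure on the dual group.\<close>

inductive pos_def :: "('g::ab_group_add \<Rightarrow> complex) \<Rightarrow> bool" where
  char: "\<xi> \<in> dual_group \<Longrightarrow> pos_def \<xi>"
| add: "pos_def \<phi> \<Longrightarrow> pos_def \<psi> \<Longrightarrow> pos_def (\<lambda>g. \<phi> g + \<psi> g)"
| scale: "pos_def \<phi> \<Longrightarrow> c \<ge> 0 \<Longrightarrow> pos_def (\<lambda>g. complex_of_real c * \<phi> g)"
| lim: "\<forall>F \<epsilon>. finite F \<longrightarrow> \<epsilon> > 0 \<longrightarrow> (\<exists>\<phi>. pos_def \<phi> \<and> (\<forall>g\<in>F. cmod (\<phi> g - \<psi> g) < \<epsilon>)) \<Longrightarrow> pos_def \<psi>"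

lemma pos_def_limI:
  "(\<And>F \<epsilon>. finite F \<Longrightarrow> \<epsilon> > 0 \<Longrightarrow> \<exists>\<phi>. pos_def \<phi> \<and> (\<forall>g\<in>F. cmod (\<phi> g - \<psi> g) < \<epsilon>)) \<Longrightarrow> pos_def \<psi>"
  by (rule pos_def.lim) blast

lemma pos_def_one: "pos_def (\<lambda>g. 1)"
  by (rule pos_def.char[OF dual_one])

lemma pos_def_zero: "pos_def (\<lambda>g. 0)"
  using pos_def.scale[OF pos_def_one, of 0] by simp

lemma pos_def_sum:
  "finite I \<Longrightarrow> (\<And>i. i \<in> I \<Longrightarrow> pos_def (\<phi> i)) \<Longrightarrow> pos_def (\<lambda>g. \<Sum>i\<in>I. \<phi> i g)"
proof (induction I rule: finite_induct)
  case (insert i I)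
  then show ?case using pos_def.add[of "\<phi> i" "\<lambda>g. \<Sum>i\<in>I. \<phi> i g"] by simp
qed (simp add: pos_def_zero)

lemma pos_def_lim_mult:
  assumes lim: "\<forall>F \<epsilon>. finite F \<longrightarrow> \<epsilon> > 0 \<longrightarrow>
      (\<exists>\<phi>. (pos_def \<phi> \<and> pos_def (\<lambda>g. \<theta> g * \<phi> g)) \<and> (\<forall>g\<in>F. cmod (\<phi> g - \<psi> g) < \<epsilon>))"
  shows "pos_def (\<lambda>g. \<theta> g * \<psi> g)"
proof (rule pos_def_limI)
  fix F :: "'a set" and \<epsilon> :: real assume F: "finite F" and \<epsilon>: "\<epsilon> > 0"
  define B where "B = (\<Sum>g\<in>F. cmod (\<theta> g)) + 1"
  have B: "B > 0" unfolding B_def by (smt (verit) sum_nonneg norm_ge_zero)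
  have Bg: "cmod (\<theta> g) \<le> B" if "g \<in> F" for g
    unfolding B_def using member_le_sum[of g F "\<lambda>g. cmod (\<theta> g)"] that F by simp
  obtain \<phi> where \<phi>: "pos_def (\<lambda>g. \<theta> g * \<phi> g)" "\<And>g. g \<in> F \<Longrightarrow> cmod (\<phi> g - \<psi> g) < \<epsilon> / B"
    using lim F divide_pos_pos[OF \<epsilon> B] by meson
  have "cmod (\<theta> g * \<phi> g - \<theta> g * \<psi> g) < \<epsilon>" if g: "g \<in> F" for g
  proof -
    have "cmod (\<theta> g * \<phi> g - \<theta> g * \<psi> g) = cmod (\<theta> g) * cmod (\<phi> g - \<psi> g)"
      by (simp add: norm_mult flip: right_diff_distrib)
    also have "\<dots> \<le> B * cmod (\<phi> g - \<psi> g)" using Bg[OF g] by (intro mult_right_mono) auto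
    also have "\<dots> < B * (\<epsilon> / B)" using \<phi>(2)[OF g] B by (intro mult_strict_left_mono)
    finally show ?thesis using B by simp
  qed
  then show "\<exists>\<phi>. pos_def \<phi> \<and> (\<forall>g\<in>F. cmod (\<phi> g - \<theta> g * \<psi> g) < \<epsilon>)" using \<phi>(1) by blast
qed

lemma pos_def_mult:
  assumes "pos_def \<phi>" "pos_def \<psi>"
  shows "pos_def (\<lambda>g. \<psi> g * \<phi> g)"
  using assms(1)
proof (induction \<phi> rule: pos_def.induct)
  case (char \<xi>)
  have "pos_def (\<lambda>g. \<xi> g * \<psi> g)"
    using assms(2)
  proof (induction \<psi> rule: pos_def.induct)
    case (char \<psi>)
    then show ?case using dual_mult[OF \<open>\<xi> \<in> dual_group\<close>] by (intro pos_def.char)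
  next
    case (add \<phi> \<psi>)
    then show ?case using pos_def.add[of "\<lambda>g. \<xi> g * \<phi> g" "\<lambda>g. \<xi> g * \<psi> g"] by (simp add: distrib_left)
  next
    case (scale \<phi> c)
    then show ?case using pos_def.scale[of "\<lambda>g. \<xi> g * \<phi> g" c] by (simp add: mult.left_commute)
  next
    case (lim \<psi>)
    then show ?case by (rule pos_def_lim_mult)
  qed
  then show ?case by (simp add: mult.commute)
next
  case (add \<phi> \<phi>')
  then show ?case using pos_def.add[of "\<lambda>g. \<psi> g * \<phi> g" "\<lambda>g. \<psi> g * \<phi>' g"] by (simp add: distrib_left)
next
  case (scale \<phi> c)
  then show ?case using pos_def.scale[of "\<lambda>g. \<psi> g * \<phi> g" c] by (simp add: mult.left_commute)
next
  case (lim \<phi>)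
  then show ?case by (rule pos_def_lim_mult)
qed

lemma pos_def_prod:
  "finite I \<Longrightarrow> (\<And>i. i \<in> I \<Longrightarrow> pos_def (\<phi> i)) \<Longrightarrow> pos_def (\<lambda>g. \<Prod>i\<in>I. \<phi> i g)"
proof (induction I rule: finite_induct)
  case (insert i I)
  then show ?case using pos_def_mult[of "\<lambda>g. \<Prod>i\<in>I. \<phi> i g" "\<phi> i"] by simp
qed (simp add: pos_def_one)

text \<open>The indicator function of the kernel of a character is the limit of the averages of its
  powers. Products of these approximate the indicator function of the neutral element.\<close>

lemma pos_def_kernel:
  assumes \<xi>: "\<xi> \<in> dual_group"
  shows "pos_def (\<lambda>g. if \<xi> g = 1 then 1 else 0)"
proof (rule pos_def_limI)
  fix F :: "'a set" and \<epsilon> :: real assume F: "finite F" and \<epsilon>: "\<epsilon> > 0"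
  define avg where "avg N g = complex_of_real (1 / real (Suc N)) * (\<Sum>k<Suc N. \<xi> g ^ k)" for N g
  have avg: "pos_def (avg N)" for N
    unfolding avg_def by (intro pos_def.scale pos_def_sum pos_def.char dual_power \<xi>) auto
  have "\<forall>\<^sub>F N in sequentially. cmod (avg N g - (if \<xi> g = 1 then 1 else 0)) < \<epsilon>" for g
  proof (cases "\<xi> g = 1")
    case True
    have "avg N g = 1" for N
      unfolding avg_def True by (simp del: of_nat_Suc)
    then show ?thesis using True \<epsilon> by simp
  next
    case False
    have bound: "cmod (avg N g) \<le> 2 / cmod (\<xi> g - 1) * inverse (real (Suc N))" for N
    proof -
      have "cmod (\<xi> g ^ Suc N - 1) \<le> 2"
        using norm_triangle_ineq4[of "\<xi> g ^ Suc N" 1] dual_norm[OF \<xi>] by (simp add: norm_power norm_mult)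
      then have "cmod ((\<xi> g ^ Suc N - 1) / (\<xi> g - 1)) \<le> 2 / cmod (\<xi> g - 1)"
        unfolding norm_divide by (intro divide_right_mono) auto
      then have "inverse (real (Suc N)) * cmod ((\<xi> g ^ Suc N - 1) / (\<xi> g - 1)) \<le> inverse (real (Suc N)) * (2 / cmod (\<xi> g - 1))"
        by (intro mult_left_mono) auto
      then show ?thesis
        unfolding avg_def geometric_sum[OF False] norm_mult norm_of_real by (simp add: divide_inverse mult.commute)
    qed
    have "(\<lambda>N. 2 / cmod (\<xi> g - 1) * inverse (real (Suc N))) \<longlonglongrightarrow> 0"
      by (intro tendsto_mult_right_zero LIMSEQ_inverse_real_of_nat)
    then have "\<forall>\<^sub>F N in sequentially. 2 / cmod (\<xi> g - 1) * inverse (real (Suc N)) < \<epsilon>"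
      using \<epsilon> by (rule order_tendstoD)
    then show ?thesis using False bound by (auto elim!: eventually_mono intro: le_less_trans)
  qed
  then have "\<forall>\<^sub>F N in sequentially. \<forall>g\<in>F. cmod (avg N g - (if \<xi> g = 1 then 1 else 0)) < \<epsilon>"
    using F by (intro eventually_ball_finite) auto
  then obtain N where "\<forall>g\<in>F. cmod (avg N g - (if \<xi> g = 1 then 1 else 0)) < \<epsilon>"
    using eventually_happens'[OF sequentially_bot] by blast
  then show "\<exists>\<phi>. pos_def \<phi> \<and> (\<forall>g\<in>F. cmod (\<phi> g - (if \<xi> g = 1 then 1 else 0)) < \<epsilon>)"
    using avg by blast
qed

text \<open>The indicator function of a point.\<close>

definition delta :: "'g \<Rightarrow> 'g \<Rightarrow> complex" where
  "delta k g = (if g = k then 1 else 0)"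

lemma pos_def_delta: "pos_def (delta (0 :: 'g::ab_group_add))"
proof (rule pos_def_limI)
  fix F :: "'g set" and \<epsilon> :: real assume F: "finite F" and \<epsilon>: "\<epsilon> > 0"
  have "\<forall>g\<in>F - {0}. \<exists>\<xi>. \<xi> \<in> dual_group \<and> \<xi> g \<noteq> 1"
    using characters_separate_points by (metis DiffE insertCI)
  then obtain X where X: "\<And>g. g \<in> F - {0} \<Longrightarrow> X g \<in> dual_group \<and> X g g \<noteq> 1" by metis
  define \<phi> where "\<phi> = (\<lambda>h. \<Prod>g\<in>F - {0}. if X g h = 1 then 1 else (0 :: complex))"
  have "pos_def \<phi>" unfolding \<phi>_def using F X by (intro pos_def_prod pos_def_kernel) auto
  moreover have "\<phi> h = delta 0 h" if h: "h \<in> F" for h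
  proof (cases "h = 0")
    case True
    have "X g 0 = 1" if "g \<in> F - {0}" for g using X[OF that] dual_zero by blast
    then show ?thesis unfolding \<phi>_def delta_def using True by (intro trans[OF prod.neutral]) auto
  next
    case False
    then show ?thesis unfolding \<phi>_def delta_def using X h F
      by (auto intro!: prod_zero bexI[of _ h])
  qed
  ultimately show "\<exists>\<phi>. pos_def \<phi> \<and> (\<forall>g\<in>F. cmod (\<phi> g - delta 0 g) < \<epsilon>)"
    using \<epsilon> by (intro exI[of _ \<phi>]) auto
qed

text \<open>On a character this operation is multiplication by \<open>\<bar>\<Sum>k\<in>K. \<xi> k\<bar>\<^sup>2\<close>.\<close>

lemma pos_def_autocorrelation:
  fixes \<phi> :: "'g::ab_group_add \<Rightarrow> complex"
  assumes \<phi>: "pos_def \<phi>" and K: "finite K"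
  shows "pos_def (\<lambda>h. \<Sum>k\<in>K. \<Sum>l\<in>K. \<phi> (h + k - l))"
  using \<phi>
proof (induction \<phi> rule: pos_def.induct)
  case (char \<xi>)
  have "(\<Sum>k\<in>K. \<Sum>l\<in>K. \<xi> (h + k - l)) = complex_of_real ((cmod (\<Sum>k\<in>K. \<xi> k))\<^sup>2) * \<xi> h" for h
  proof -
    have "(\<Sum>k\<in>K. \<Sum>l\<in>K. \<xi> (h + k - l)) = (\<Sum>k\<in>K. \<Sum>l\<in>K. \<xi> h * (\<xi> k * cnj (\<xi> l)))"
      using char by (simp add: dual_diff dual_add mult.assoc)
    also have "\<dots> = \<xi> h * (\<Sum>k\<in>K. \<Sum>l\<in>K. \<xi> k * cnj (\<xi> l))"
      by (simp only: sum_distrib_left)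
    also have "(\<Sum>k\<in>K. \<Sum>l\<in>K. \<xi> k * cnj (\<xi> l)) = (\<Sum>k\<in>K. \<xi> k) * cnj (\<Sum>k\<in>K. \<xi> k)"
      by (simp only: sum_product cnj_sum)
    finally show ?thesis by (simp only: complex_norm_square) (simp only: mult.commute)
  qed
  then show ?case using pos_def.scale[OF pos_def.char[OF char], of "(cmod (\<Sum>k\<in>K. \<xi> k))\<^sup>2"] by simp
next
  case (add \<phi> \<psi>)
  then show ?case using pos_def.add[of "\<lambda>h. \<Sum>k\<in>K. \<Sum>l\<in>K. \<phi> (h + k - l)"] by (simp add: sum.distrib)
next
  case (scale \<phi> c)
  then show ?case using pos_def.scale[of "\<lambda>h. \<Sum>k\<in>K. \<Sum>l\<in>K. \<phi> (h + k - l)" c]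
    by (simp add: sum_distrib_left)
next
  case (lim \<psi>)
  show ?case
  proof (rule pos_def_limI)
    fix F :: "'g set" and \<epsilon> :: real assume F: "finite F" and \<epsilon>: "\<epsilon> > 0"
    define F' where "F' = (\<lambda>(h, k, l). h + k - l) ` (F \<times> K \<times> K)"
    define c where "c = real (card K) * real (card K) + 1"
    have c: "c > 0" unfolding c_def by (simp add: add_nonneg_pos)
    have "finite F'" unfolding F'_def using F K by blast
    then obtain \<phi> where \<phi>: "pos_def (\<lambda>h. \<Sum>k\<in>K. \<Sum>l\<in>K. \<phi> (h + k - l))"
        "\<And>g. g \<in> F' \<Longrightarrow> cmod (\<phi> g - \<psi> g) < \<epsilon> / c"
      using lim[rule_format, of F' "\<epsilon> / c"] divide_pos_pos[OF \<epsilon> c] by blast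
    have "cmod ((\<Sum>k\<in>K. \<Sum>l\<in>K. \<phi> (h + k - l)) - (\<Sum>k\<in>K. \<Sum>l\<in>K. \<psi> (h + k - l))) < \<epsilon>" if h: "h \<in> F" for h
    proof -
      have "cmod ((\<Sum>k\<in>K. \<Sum>l\<in>K. \<phi> (h + k - l)) - (\<Sum>k\<in>K. \<Sum>l\<in>K. \<psi> (h + k - l))) \<le>
          (\<Sum>k\<in>K. \<Sum>l\<in>K. cmod (\<phi> (h + k - l) - \<psi> (h + k - l)))"
        unfolding sum_subtractf[symmetric] by (intro order_trans[OF norm_sum] sum_mono norm_sum)
      also have "\<dots> \<le> (\<Sum>k\<in>K. \<Sum>l\<in>K. \<epsilon> / c)"
        using \<phi>(2) h unfolding F'_def by (intro sum_mono less_imp_le) force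
      also have "\<dots> = (c - 1) * (\<epsilon> / c)" unfolding c_def by simp
      also have "\<dots> < c * (\<epsilon> / c)" using \<epsilon> c by (intro mult_strict_right_mono) auto
      finally show ?thesis using c by simp
    qed
    then show "\<exists>\<phi>. pos_def \<phi> \<and> (\<forall>g\<in>F. cmod (\<phi> g - (\<Sum>k\<in>K. \<Sum>l\<in>K. \<psi> (g + k - l))) < \<epsilon>)"
      using \<phi>(1) by blast
  qed
qed

lemma polynomial_below_exponential:
  fixes r :: real
  assumes "r > 1"
  shows "\<exists>N. real (Suc N) ^ d < r ^ N"
proof -
  define c where "c = ln r"
  have c: "c > 0" unfolding c_def using assms by simp
  have lim: "filterlim (\<lambda>N. c * real (Suc N)) at_top sequentially"
    by (rule filterlim_tendsto_pos_mult_at_top[OF tendsto_const c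
        filterlim_compose[OF filterlim_real_sequentially filterlim_Suc]])
  have "(\<lambda>N. (c * real (Suc N)) ^ d / exp (c * real (Suc N))) \<longlonglongrightarrow> 0"
    by (rule filterlim_compose[OF tendsto_power_div_exp_0 lim])
  then have "\<forall>\<^sub>F N in sequentially. (c * real (Suc N)) ^ d / exp (c * real (Suc N)) < c ^ d / r"
    using c assms by (intro order_tendstoD(2)) auto
  then obtain N where N: "(c * real (Suc N)) ^ d / exp (c * real (Suc N)) < c ^ d / r"
    using eventually_happens'[OF sequentially_bot] by blast
  have "exp (c * real (Suc N)) = r ^ Suc N"
    using assms unfolding c_def by (metis exp_ln exp_of_nat2_mult less_trans zero_less_one)
  then have "c ^ d * real (Suc N) ^ d / (r ^ N * r) < c ^ d / r"
    using N by (simp add: power_mult_distrib mult.commute)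
  then have "real (Suc N) ^ d < r ^ N"
    using c assms by (simp add: divide_simps split: if_splits)
  then show ?thesis by blast
qed

text \<open>Finitely generated abelian groups have polynomial growth. Hence among the boxes
  \<open>K N = {\<Sum>f\<in>F. n\<^sub>f f | n\<^sub>f \<le> N}\<close> there is one that is almost invariant under translation by \<open>F\<close>.\<close>

lemma almost_invariant_set:
  fixes F :: "'g::ab_group_add set"
  assumes F: "finite F" and \<epsilon>: "\<epsilon> > 0"
  obtains K where "finite K" "K \<noteq> {}"
    "\<And>f. f \<in> F \<Longrightarrow> real (card {k \<in> K. f + k \<notin> K}) \<le> \<epsilon> * real (card K)"
proof -
  define box where "box N = (\<lambda>n. \<Sum>f\<in>F. nmul (n f) f) ` PiE F (\<lambda>_. {..N})" for N :: nat
  have fin: "finite (box N)" for N unfolding box_def using F by (intro finite_imageI finite_PiE) auto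
  have ne: "box N \<noteq> {}" for N unfolding box_def by (auto simp: PiE_eq_empty_iff)
  have card_pos: "card (box N) \<ge> 1" for N using fin ne by (simp add: Suc_leI card_gt_0_iff)
  have card_le: "real (card (box N)) \<le> real (Suc N) ^ card F" for N
  proof -
    have "card (box N) \<le> card (PiE F (\<lambda>_. {..N}))"
      unfolding box_def using F by (intro card_image_le finite_PiE) auto
    also have "\<dots> = Suc N ^ card F" using F by (simp add: card_PiE)
    finally show ?thesis by (metis of_nat_le_iff of_nat_power)
  qed
  have mono: "box N \<subseteq> box (Suc N)" for N
    unfolding box_def by (intro image_mono PiE_mono) auto
  have shift: "f + k \<in> box (Suc N)" if f: "f \<in> F" and k: "k \<in> box N" for f k N
  proof -
    obtain n where n: "n \<in> PiE F (\<lambda>_. {..N})" "k = (\<Sum>f\<in>F. nmul (n f) f)" using k unfolding box_def by blast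
    define n' where "n' = n(f := Suc (n f))"
    have "n' \<in> PiE F (\<lambda>_. {..Suc N})"
    proof (rule PiE_I)
      show "n' x \<in> {..Suc N}" if "x \<in> F" for x using PiE_mem[OF n(1) that] unfolding n'_def by auto
      show "n' x = undefined" if "x \<notin> F" for x using PiE_arb[OF n(1) that] f that unfolding n'_def by auto
    qed
    moreover have "(\<Sum>x\<in>F. nmul (n' x) x) = f + k"
    proof -
      have "(\<Sum>x\<in>F. nmul (n' x) x) = nmul (n' f) f + (\<Sum>x\<in>F - {f}. nmul (n' x) x)"
        using F f by (rule sum.remove)
      also have "(\<Sum>x\<in>F - {f}. nmul (n' x) x) = (\<Sum>x\<in>F - {f}. nmul (n x) x)"
        by (rule sum.cong) (auto simp: n'_def)
      also have "nmul (n' f) f + (\<Sum>x\<in>F - {f}. nmul (n x) x) = f + (\<Sum>x\<in>F. nmul (n x) x)"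
        unfolding sum.remove[OF F f, of "\<lambda>x. nmul (n x) x"] by (simp add: n'_def add.assoc)
      finally show ?thesis unfolding n(2) .
    qed
    ultimately show ?thesis unfolding box_def by (intro image_eqI[where x = n']) simp_all
  qed
  have "\<exists>N. real (card (box (Suc N))) \<le> (1 + \<epsilon>) * real (card (box N))"
  proof (rule ccontr)
    assume "\<not> ?thesis"
    then have gt: "(1 + \<epsilon>) * real (card (box N)) < real (card (box (Suc N)))" for N by (simp add: not_le)
    have "(1 + \<epsilon>) ^ N \<le> real (card (box N))" for N
    proof (induction N)
      case 0
      then show ?case using card_pos[of 0] by simp
    next
      case (Suc N)
      have "(1 + \<epsilon>) ^ Suc N \<le> (1 + \<epsilon>) * real (card (box N))"
        using Suc \<epsilon> by (simp add: mult_left_mono)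
      then show ?case using gt[of N] by linarith
    qed
    moreover obtain N where "real (Suc N) ^ card F < (1 + \<epsilon>) ^ N"
      using polynomial_below_exponential[of "1 + \<epsilon>"] \<epsilon> by auto
    ultimately show False using card_le[of N] by (smt (verit))
  qed
  then obtain N where N: "real (card (box (Suc N))) \<le> (1 + \<epsilon>) * real (card (box N))" by blast
  show ?thesis
  proof (rule that[of "box N"])
    fix f assume f: "f \<in> F"
    have "card {k \<in> box N. f + k \<notin> box N} = card ((+) f ` {k \<in> box N. f + k \<notin> box N})"
      by (simp add: card_image)
    also have "\<dots> \<le> card (box (Suc N) - box N)"
      using shift[OF f] fin by (intro card_mono) auto
    also have "\<dots> = card (box (Suc N)) - card (box N)" using mono fin by (intro card_Diff_subset)
    finally have "real (card {k \<in> box N. f + k \<notin> box N}) \<le> real (card (box (Suc N))) - real (card (box N))"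
      using card_mono[OF fin mono, of N] by linarith
    then show "real (card {k \<in> box N. f + k \<notin> box N}) \<le> \<epsilon> * real (card (box N))"
      using N by (simp add: distrib_right)
  qed (use fin ne in auto)
qed

text \<open>For an almost invariant set \<open>K\<close>, the function \<open>h \<mapsto> \<bar>{k \<in> K. h + k \<in> K}\<bar> / \<bar>K\<bar>\<close> is positive definite with
  finite support, and almost \<open>1\<close> on \<open>F\<close>.\<close>

lemma pos_def_approximate_unit:
  fixes F :: "'g::ab_group_add set"
  assumes F: "finite F" and \<epsilon>: "\<epsilon> > 0"
  obtains \<phi> where "pos_def \<phi>" "\<phi> 0 = 1" "finite {g. \<phi> g \<noteq> 0}" "\<And>g. g \<in> F \<Longrightarrow> cmod (\<phi> g - 1) < \<epsilon>"
proof -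
  obtain K where K: "finite K" "K \<noteq> {}"
      "\<And>f. f \<in> F \<Longrightarrow> real (card {k \<in> K. f + k \<notin> K}) \<le> (\<epsilon> / 2) * real (card K)"
    using almost_invariant_set[OF F half_gt_zero[OF \<epsilon>]] by blast
  define c where "c = real (card K)"
  have c: "c > 0" unfolding c_def using K by (simp add: card_gt_0_iff)
  define \<phi> where "\<phi> h = complex_of_real (1 / c) * (\<Sum>k\<in>K. \<Sum>l\<in>K. delta 0 (h + k - l))" for h
  have val: "\<phi> h = complex_of_real (real (card {k \<in> K. h + k \<in> K}) / c)" for h
  proof -
    have "(\<Sum>k\<in>K. \<Sum>l\<in>K. delta 0 (h + k - l)) = (\<Sum>k\<in>K. if h + k \<in> K then 1 else 0)"
    proof (rule sum.cong[OF refl])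
      fix k
      have "(\<Sum>l\<in>K. delta 0 (h + k - l)) = (\<Sum>l\<in>K. if h + k = l then 1 else 0)"
        by (rule sum.cong) (auto simp: delta_def)
      then show "(\<Sum>l\<in>K. delta 0 (h + k - l)) = (if h + k \<in> K then 1 else 0)" using K(1) by simp
    qed
    also have "\<dots> = of_nat (card {k \<in> K. h + k \<in> K})"
      using K(1) by (simp add: sum.If_cases Int_def)
    finally show ?thesis unfolding \<phi>_def by simp
  qed
  show ?thesis
  proof (rule that)
    show "pos_def \<phi>" unfolding \<phi>_def
      using c by (intro pos_def.scale pos_def_autocorrelation pos_def_delta K) auto
    show "\<phi> 0 = 1" unfolding val using c by (simp add: c_def)
    show "finite {g. \<phi> g \<noteq> 0}"
    proof (rule finite_subset)
      show "{g. \<phi> g \<noteq> 0} \<subseteq> (\<lambda>(l, k). l - k) ` (K \<times> K)"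
      proof
        fix g assume "g \<in> {g. \<phi> g \<noteq> 0}"
        then have "card {k \<in> K. g + k \<in> K} \<noteq> 0" unfolding val by auto
        then have "{k \<in> K. g + k \<in> K} \<noteq> {}" by (metis card.empty)
        then obtain k where "k \<in> K" "g + k \<in> K" by blast
        then show "g \<in> (\<lambda>(l, k). l - k) ` (K \<times> K)" by (intro image_eqI[of _ _ "(g + k, k)"]) auto
      qed
    qed (use K in blast)
    fix g assume g: "g \<in> F"
    have "card K = card {k \<in> K. g + k \<in> K} + card {k \<in> K. g + k \<notin> K}"
      using K(1) by (subst card_Un_disjoint[symmetric]) (auto intro: arg_cong[where f = card])
    then have "real (card {k \<in> K. g + k \<in> K}) / c - 1 = - real (card {k \<in> K. g + k \<notin> K}) / c"
      using c unfolding c_def by (simp add: field_simps)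
    moreover have "\<phi> g - 1 = complex_of_real (real (card {k \<in> K. g + k \<in> K}) / c - 1)"
      unfolding val by simp
    ultimately have "\<phi> g - 1 = complex_of_real (- real (card {k \<in> K. g + k \<notin> K}) / c)" by metis
    then have "cmod (\<phi> g - 1) = real (card {k \<in> K. g + k \<notin> K}) / c"
      using c by (simp only: norm_of_real) simp
    also have "\<dots> \<le> \<epsilon> / 2" using K(3)[OF g] c unfolding c_def by (simp add: divide_le_eq)
    finally show "cmod (\<phi> g - 1) < \<epsilon>" using \<epsilon> by simp
  qed
qed

section \<open>Multipliers and the dual action\<close>

text \<open>From here on the group of the bundle is commutative.\<close>

locale abelian_fell_bundle = fell_bundle \<B>
  for \<B> :: "('g::ab_group_add, 'b::ab_group_add) fell_data"
begin

abbreviation "CB \<equiv> completion (section_algebra \<B>)"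

abbreviation nrm where "nrm \<equiv> alg_norm CB"

abbreviation E where "E \<equiv> alg_carrier CB"

text \<open>Pointwise multiplication of sections by a complex function on the group, and its extension to the
  C*-algebra. The extension is meaningful only if the multiplication operator is bounded.\<close>

definition mul :: "('g \<Rightarrow> complex) \<Rightarrow> ('g \<Rightarrow> 'b) \<Rightarrow> 'g \<Rightarrow> 'b" where
  "mul \<phi> f = (\<lambda>g. smul \<B> (\<phi> g) (f g))"

definition T :: "('g \<Rightarrow> complex) \<Rightarrow> (nat \<Rightarrow> 'g \<Rightarrow> 'b) set \<Rightarrow> (nat \<Rightarrow> 'g \<Rightarrow> 'b) set" where
  "T \<phi> = completion_map (section_algebra \<B>) (mul \<phi>)"

lemma dual_action_T: "dual_action \<B> \<xi> = T \<xi>"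
  unfolding dual_action_def T_def mul_def ..

lemma mul_closed: "f \<in> Sec \<Longrightarrow> mul \<phi> f \<in> Sec"
  unfolding mul_def by (rule section_scale_closed)

lemma mul_diff_fun:
  "mul \<phi> f \<ominus>\<^bsub>section_algebra \<B>\<^esub> mul \<psi> f = mul (\<lambda>g. \<phi> g - \<psi> g) f"
  by (auto simp: alg_diff_def mul_def fun_eq_iff V.scale_left_diff_distrib)

lemma mx_le_sum:
  assumes f: "f \<in> Sec" and F: "finite F" "{g. f g \<noteq> 0} \<subseteq> F"
  shows "mx f \<le> (\<Sum>g\<in>F. fnorm \<B> g (f g))"
  using F f
proof (induction F arbitrary: f rule: finite_induct)
  case empty
  then have "f = (\<lambda>g. 0)" by auto
  then show ?case using S.p_zero by simp
next
  case (insert g F)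
  define h where "h = f(g := 0)"
  have fg: "f g \<in> fibre \<B> g" using insert.prems Sec_fibre by blast
  have h: "h \<in> Sec"
    by (rule Sec_I[of _ F]) (use insert Sec_fibre[OF insert.prems(2)] in \<open>auto simp: h_def\<close>)
  have fh: "f = h \<oplus>\<^bsub>section_algebra \<B>\<^esub> single g (f g)"
    by (auto simp: h_def single_def fun_eq_iff)
  have "mx f \<le> mx h + mx (single g (f g))"
    using S.p_add[OF h single_closed[OF fg]] fh by simp
  also have "mx h \<le> (\<Sum>k\<in>F. fnorm \<B> k (h k))"
    using insert.prems by (intro insert.IH h) (auto simp: h_def)
  also have "(\<Sum>k\<in>F. fnorm \<B> k (h k)) = (\<Sum>k\<in>F. fnorm \<B> k (f k))"
    using insert.hyps by (intro sum.cong) (auto simp: h_def)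
  also have "mx (single g (f g)) \<le> fnorm \<B> g (f g)"
    by (rule cstar_seminorm_single[OF max_norm_cstar fg])
  finally show ?case using insert.hyps by simp
qed

lemma mx_mul_le:
  assumes f: "f \<in> Sec" and "\<And>g. f g \<noteq> 0 \<Longrightarrow> cmod (\<phi> g) \<le> \<epsilon>"
  shows "mx (mul \<phi> f) \<le> \<epsilon> * (\<Sum>g | f g \<noteq> 0. fnorm \<B> g (f g))"
proof -
  have "mx (mul \<phi> f) \<le> (\<Sum>g | f g \<noteq> 0. fnorm \<B> g (mul \<phi> f g))"
    by (rule mx_le_sum[OF mul_closed[OF f] Sec_finite[OF f]]) (auto simp: mul_def)
  also have "\<dots> \<le> (\<Sum>g | f g \<noteq> 0. \<epsilon> * fnorm \<B> g (f g))"
    unfolding mul_def using assms Sec_fibre[OF f]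
    by (intro sum_mono) (auto simp: norm_smul intro!: mult_right_mono fnorm_nonneg)
  finally show ?thesis by (simp add: sum_distrib_left)
qed

lemma mul_add_section:
  "mul \<phi> (f \<oplus>\<^bsub>section_algebra \<B>\<^esub> h) = mul \<phi> f \<oplus>\<^bsub>section_algebra \<B>\<^esub> mul \<phi> h"
  by (simp add: mul_def V.scale_right_distrib)

lemma mul_scale_section: "mul \<phi> (c \<odot>\<^bsub>section_algebra \<B>\<^esub> f) = c \<odot>\<^bsub>section_algebra \<B>\<^esub> mul \<phi> f"
  by (simp add: mul_def mult.commute)

lemma mul_add_fun: "mul (\<lambda>g. \<phi> g + \<psi> g) f = mul \<phi> f \<oplus>\<^bsub>section_algebra \<B>\<^esub> mul \<psi> f"
  by (simp add: mul_def V.scale_left_distrib)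

lemma mul_scale_fun: "mul (\<lambda>g. c * \<phi> g) f = c \<odot>\<^bsub>section_algebra \<B>\<^esub> mul \<phi> f"
  by (simp add: mul_def)

lemma bounded_mulI:
  assumes "M \<ge> 0" "\<And>f. f \<in> Sec \<Longrightarrow> mx (mul \<phi> f) \<le> M * mx f"
  shows "S.bounded_op (mul \<phi>) M"
  unfolding S.bounded_op_def section_algebra_simps(5)
  by (intro conjI ballI allI assms mul_closed mul_add_section mul_scale_section)

lemma bounded_mulD: "S.bounded_op (mul \<phi>) M \<Longrightarrow> f \<in> Sec \<Longrightarrow> mx (mul \<phi> f) \<le> M * mx f"
  unfolding S.bounded_op_def by simp

lemma bounded_mul_nonneg: "S.bounded_op (mul \<phi>) M \<Longrightarrow> M \<ge> 0"
  unfolding S.bounded_op_def by simp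

lemma mx_nonneg: "f \<in> Sec \<Longrightarrow> 0 \<le> mx f"
  using S.p_nonneg by simp

lemma bounded_mul_add:
  assumes "S.bounded_op (mul \<phi>) M" "S.bounded_op (mul \<psi>) M'"
  shows "S.bounded_op (mul (\<lambda>g. \<phi> g + \<psi> g)) (M + M')"
proof (rule bounded_mulI)
  fix f assume f: "f \<in> Sec"
  have "mx (mul (\<lambda>g. \<phi> g + \<psi> g) f) \<le> mx (mul \<phi> f) + mx (mul \<psi> f)"
    unfolding mul_add_fun using S.p_add[OF mul_closed[OF f] mul_closed[OF f]] by simp
  then show "mx (mul (\<lambda>g. \<phi> g + \<psi> g) f) \<le> (M + M') * mx f"
    using bounded_mulD[OF assms(1) f] bounded_mulD[OF assms(2) f] by (simp add: distrib_right)
qed (use assms bounded_mul_nonneg in \<open>simp add: add_nonneg_nonneg\<close>)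

lemma bounded_mul_scale:
  assumes "S.bounded_op (mul \<phi>) M"
  shows "S.bounded_op (mul (\<lambda>g. c * \<phi> g)) (cmod c * M)"
proof (rule bounded_mulI)
  fix f assume f: "f \<in> Sec"
  have "mx (mul (\<lambda>g. c * \<phi> g) f) = cmod c * mx (mul \<phi> f)"
    unfolding mul_scale_fun using S.p_scale[OF mul_closed[OF f]] by simp
  then show "mx (mul (\<lambda>g. c * \<phi> g) f) \<le> cmod c * M * mx f"
    using bounded_mulD[OF assms f] by (simp add: mult.assoc mult_left_mono)
qed (use assms bounded_mul_nonneg in simp)

lemma T_closed: "S.bounded_op (mul \<phi>) M \<Longrightarrow> x \<in> E \<Longrightarrow> T \<phi> x \<in> E"
  unfolding T_def by (rule S.bounded_op_closed)

lemma T_cls: "S.bounded_op (mul \<phi>) M \<Longrightarrow> X \<in> S.CS \<Longrightarrow> T \<phi> (S.cls X) = S.cls (\<lambda>n. mul \<phi> (X n))"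
  unfolding T_def by (rule S.bounded_op_cls)

lemma T_emb: "S.bounded_op (mul \<phi>) M \<Longrightarrow> f \<in> Sec \<Longrightarrow> T \<phi> (emb f) = emb (mul \<phi> f)"
  unfolding T_def by (rule S.bounded_op_embed)

lemma T_norm: "S.bounded_op (mul \<phi>) M \<Longrightarrow> x \<in> E \<Longrightarrow> nrm (T \<phi> x) \<le> M * nrm x"
  unfolding T_def by (rule S.bounded_op_norm)

lemma T_diff: "S.bounded_op (mul \<phi>) M \<Longrightarrow> x \<in> E \<Longrightarrow> y \<in> E \<Longrightarrow>
    T \<phi> (x \<ominus>\<^bsub>CB\<^esub> y) = T \<phi> x \<ominus>\<^bsub>CB\<^esub> T \<phi> y"
  unfolding T_def by (rule S.bounded_op_diff)

lemma mul_CS: "S.bounded_op (mul \<phi>) M \<Longrightarrow> X \<in> S.CS \<Longrightarrow> (\<lambda>n. mul \<phi> (X n)) \<in> S.CS"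
  by (rule S.bounded_op_CS)

lemma T_add_fun:
  assumes \<phi>: "S.bounded_op (mul \<phi>) M" and \<psi>: "S.bounded_op (mul \<psi>) M'" and x: "x \<in> E"
  shows "T (\<lambda>g. \<phi> g + \<psi> g) x = T \<phi> x \<oplus>\<^bsub>CB\<^esub> T \<psi> x"
proof -
  obtain X where X: "X \<in> S.CS" "x = S.cls X" using x by (rule S.completion_cases)
  show ?thesis
    unfolding X(2) T_cls[OF \<phi> X(1)] T_cls[OF \<psi> X(1)] T_cls[OF bounded_mul_add[OF \<phi> \<psi>] X(1)]
      S.cls_add[OF mul_CS[OF \<phi> X(1)] mul_CS[OF \<psi> X(1)]] mul_add_fun ..
qed

lemma T_scale_fun:
  assumes \<phi>: "S.bounded_op (mul \<phi>) M" and x: "x \<in> E"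
  shows "T (\<lambda>g. c * \<phi> g) x = c \<odot>\<^bsub>CB\<^esub> T \<phi> x"
proof -
  obtain X where X: "X \<in> S.CS" "x = S.cls X" using x by (rule S.completion_cases)
  show ?thesis
    unfolding X(2) T_cls[OF \<phi> X(1)] T_cls[OF bounded_mul_scale[OF \<phi>] X(1)]
      S.cls_scale[OF mul_CS[OF \<phi> X(1)]] mul_scale_fun ..
qed

text \<open>Two bounded multipliers differ little on \<open>x\<close> if they differ little on the support
  of a section that approximates \<open>x\<close>.\<close>

lemma T_diff_bound:
  assumes \<phi>: "S.bounded_op (mul \<phi>) M" and \<psi>: "S.bounded_op (mul \<psi>) M'"
    and x: "x \<in> E" and y: "y \<in> Sec"
    and close: "\<And>g. y g \<noteq> 0 \<Longrightarrow> cmod (\<phi> g - \<psi> g) \<le> \<epsilon>"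
  shows "nrm (T \<phi> x \<ominus>\<^bsub>CB\<^esub> T \<psi> x) \<le>
    (M + M') * nrm (emb y \<ominus>\<^bsub>CB\<^esub> x) + \<epsilon> * (\<Sum>g | y g \<noteq> 0. fnorm \<B> g (y g))"
proof -
  have ey: "emb y \<in> E" using y by (rule S.embed_closed)
  note cl = T_closed[OF \<phi> x] T_closed[OF \<psi> x] T_closed[OF \<phi> ey] T_closed[OF \<psi> ey]
  have "nrm (T \<phi> x \<ominus>\<^bsub>CB\<^esub> T \<psi> x) \<le> nrm (T \<phi> x \<ominus>\<^bsub>CB\<^esub> T \<phi> (emb y))
      + nrm (T \<phi> (emb y) \<ominus>\<^bsub>CB\<^esub> T \<psi> x)"
    using cl by (intro S.compl.p_triangle)
  also have "nrm (T \<phi> (emb y) \<ominus>\<^bsub>CB\<^esub> T \<psi> x) \<le> nrm (T \<phi> (emb y) \<ominus>\<^bsub>CB\<^esub> T \<psi> (emb y))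
      + nrm (T \<psi> (emb y) \<ominus>\<^bsub>CB\<^esub> T \<psi> x)"
    using cl by (intro S.compl.p_triangle)
  also have "nrm (T \<psi> (emb y) \<ominus>\<^bsub>CB\<^esub> T \<psi> x) \<le> M' * nrm (emb y \<ominus>\<^bsub>CB\<^esub> x)"
    unfolding T_diff[OF \<psi> ey x, symmetric] using ey x by (intro T_norm[OF \<psi>] S.compl.diff_closed)
  also have "nrm (T \<phi> x \<ominus>\<^bsub>CB\<^esub> T \<phi> (emb y)) \<le> M * nrm (emb y \<ominus>\<^bsub>CB\<^esub> x)"
    unfolding T_diff[OF \<phi> x ey, symmetric] S.compl.p_diff_commute[OF ey x]
    using ey x by (intro T_norm[OF \<phi>] S.compl.diff_closed)
  also have "nrm (T \<phi> (emb y) \<ominus>\<^bsub>CB\<^esub> T \<psi> (emb y)) \<le> \<epsilon> * (\<Sum>g | y g \<noteq> 0. fnorm \<B> g (y g))"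
  proof -
    have "T \<phi> (emb y) \<ominus>\<^bsub>CB\<^esub> T \<psi> (emb y) = emb (mul (\<lambda>g. \<phi> g - \<psi> g) y)"
      unfolding T_emb[OF \<phi> y] T_emb[OF \<psi> y] S.embed_diff[OF mul_closed[OF y] mul_closed[OF y], symmetric]
        mul_diff_fun ..
    then show ?thesis
      using S.embed_norm[OF mul_closed[OF y], of "\<lambda>g. \<phi> g - \<psi> g"] mx_mul_le[OF y close] by simp
  qed
  finally show ?thesis by (simp add: distrib_right)
qed

text \<open>A character acts by a *-automorphism of the section algebra, which preserves the maximal norm.\<close>

lemma mul_char_mult:
  assumes \<xi>: "\<xi> \<in> dual_group" and f: "f \<in> Sec" and h: "h \<in> Sec"
  shows "mul \<xi> (f \<otimes>\<^bsub>section_algebra \<B>\<^esub> h) = mul \<xi> f \<otimes>\<^bsub>section_algebra \<B>\<^esub> mul \<xi> h"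
proof
  fix k
  note fib = Sec_fibre[OF f] Sec_fibre[OF h]
  have "(mul \<xi> f \<otimes>\<^bsub>section_algebra \<B>\<^esub> mul \<xi> h) k =
      (\<Sum>g | f g \<noteq> 0. fmult \<B> g (- g + k) (mul \<xi> f g) (mul \<xi> h (- g + k)))"
    by (rule section_mult_eq[OF mul_closed[OF f] mul_closed[OF h] Sec_finite[OF f]]) (auto simp: mul_def)
  also have "\<dots> = (\<Sum>g | f g \<noteq> 0. smul \<B> (\<xi> k) (fmult \<B> g (- g + k) (f g) (h (- g + k))))"
  proof (rule sum.cong[OF refl])
    fix g
    have "\<xi> g * \<xi> (- g + k) = \<xi> k" using dual_add[OF \<xi>, of g "- g + k"] by simp
    then show "fmult \<B> g (- g + k) (mul \<xi> f g) (mul \<xi> h (- g + k)) =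
        smul \<B> (\<xi> k) (fmult \<B> g (- g + k) (f g) (h (- g + k)))"
      unfolding mul_def using fib[of g] fib(2)[of "- g + k"]
      by (simp only: mult_smul_left[OF fib(1) fibre_smul[OF fib(2)]] mult_smul_right[OF fib] V.scale_scale)
  qed
  also have "\<dots> = mul \<xi> (f \<otimes>\<^bsub>section_algebra \<B>\<^esub> h) k"
    unfolding mul_def section_algebra_mult V.scale_sum_right ..
  finally show "mul \<xi> (f \<otimes>\<^bsub>section_algebra \<B>\<^esub> h) k = (mul \<xi> f \<otimes>\<^bsub>section_algebra \<B>\<^esub> mul \<xi> h) k" ..
qed

lemma mul_char_star:
  assumes \<xi>: "\<xi> \<in> dual_group" and f: "f \<in> Sec"
  shows "mul \<xi> (f\<dagger>\<^bsub>section_algebra \<B>\<^esub>) = (mul \<xi> f)\<dagger>\<^bsub>section_algebra \<B>\<^esub>"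
  using star_smul[OF Sec_fibre[OF f]] by (simp add: mul_def dual_minus[OF \<xi>])

lemma bounded_char:
  assumes \<xi>: "\<xi> \<in> dual_group"
  shows "S.bounded_op (mul \<xi>) 1"
proof (rule bounded_mulI)
  fix f assume f: "f \<in> Sec"
  have "mx (mul \<xi> f) \<le> mx f"
  proof (rule max_norm_least)
    fix p assume p: "cstar_seminorm (section_algebra \<B>) p"
    then interpret cstar_seminormed "section_algebra \<B>" p
      by (intro cstar_seminormed.intro star_alg_section cstar_seminormed_axioms.intro)
    have "cstar_seminorm (section_algebra \<B>) (\<lambda>f. p (mul \<xi> f))"
      unfolding cstar_seminorm_def
    proof (intro conjI ballI allI)
      fix x y c assume x: "x \<in> Sec"
      note mx = mul_closed[OF x, of \<xi>]
      show "0 \<le> p (mul \<xi> x)" by (rule p_nonneg[OF mx])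
      show "p (mul \<xi> (c \<odot>\<^bsub>section_algebra \<B>\<^esub> x)) = cmod c * p (mul \<xi> x)"
        unfolding mul_scale_section by (rule p_scale[OF mx])
      show "p (mul \<xi> (x\<dagger>\<^bsub>section_algebra \<B>\<^esub> \<otimes>\<^bsub>section_algebra \<B>\<^esub> x)) = (p (mul \<xi> x))\<^sup>2"
        unfolding mul_char_mult[OF \<xi> section_star_closed[OF x] x] mul_char_star[OF \<xi> x]
        by (rule p_star_mult[OF mx])
      assume y: "y \<in> Sec"
      note my = mul_closed[OF y, of \<xi>]
      show "p (mul \<xi> (x \<oplus>\<^bsub>section_algebra \<B>\<^esub> y)) \<le> p (mul \<xi> x) + p (mul \<xi> y)"
        unfolding mul_add_section by (rule p_add[OF mx my])
      show "p (mul \<xi> (x \<otimes>\<^bsub>section_algebra \<B>\<^esub> y)) \<le> p (mul \<xi> x) * p (mul \<xi> y)"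
        unfolding mul_char_mult[OF \<xi> x y] by (rule p_mult[OF mx my])
    qed
    then show "p (mul \<xi> f) \<le> mx f" using max_norm_upper[OF _ f] by blast
  qed
  then show "mx (mul \<xi> f) \<le> 1 * mx f" by simp
qed simp

lemma T_one: "x \<in> E \<Longrightarrow> T (\<lambda>g. 1) x = x"
proof -
  assume "x \<in> E"
  then obtain X where X: "X \<in> S.CS" "x = S.cls X" by (rule S.completion_cases)
  show ?thesis unfolding X(2) T_cls[OF bounded_char[OF dual_one] X(1)] by (simp add: mul_def)
qed

text \<open>A positive definite multiplier and all its translates have norm at most \<open>\<phi> 0\<close>.\<close>

lemma bounded_pos_def:
  assumes "pos_def \<phi>"
  shows "S.bounded_op (mul (\<lambda>g. \<phi> (g - k))) (Re (\<phi> 0))"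
  using assms
proof (induction \<phi> arbitrary: k rule: pos_def.induct)
  case (char \<xi>)
  have "(\<lambda>g. \<xi> (g - k)) = (\<lambda>g. cnj (\<xi> k) * \<xi> g)" using char by (simp add: dual_diff mult.commute)
  then show ?case
    using bounded_mul_scale[OF bounded_char[OF char], of "cnj (\<xi> k)"] dual_norm[OF char, of k] dual_zero[OF char]
    by simp
next
  case (add \<phi> \<psi>)
  then show ?case using bounded_mul_add[OF add.IH] by simp
next
  case (scale \<phi> c)
  then show ?case using bounded_mul_scale[OF scale.IH, of "complex_of_real c"] by simp
next
  case (lim \<psi>)
  show ?case
  proof (rule bounded_mulI)
    show "Re (\<psi> 0) \<ge> 0"
    proof (rule field_le_epsilon)
      fix \<epsilon> :: real assume "\<epsilon> > 0"
      then obtain \<phi> where "\<And>k. S.bounded_op (mul (\<lambda>g. \<phi> (g - k))) (Re (\<phi> 0))" "cmod (\<phi> 0 - \<psi> 0) < \<epsilon>"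
        using lim[rule_format, of "{0}" \<epsilon>] by auto
      then show "0 \<le> Re (\<psi> 0) + \<epsilon>"
        using bounded_mul_nonneg abs_Re_le_cmod[of "\<phi> 0 - \<psi> 0"] by fastforce
    qed
    fix f assume f: "f \<in> Sec"
    define s where "s = (\<Sum>g | f g \<noteq> 0. fnorm \<B> g (f g))"
    define c where "c = mx f + s + 1"
    have s: "s \<ge> 0" unfolding s_def using Sec_fibre[OF f] by (intro sum_nonneg fnorm_nonneg)
    have c: "c > 0" unfolding c_def using s mx_nonneg[OF f] by simp
    show "mx (mul (\<lambda>g. \<psi> (g - k)) f) \<le> Re (\<psi> 0) * mx f"
    proof (rule field_le_epsilon)
      fix \<epsilon> :: real assume \<epsilon>: "\<epsilon> > 0"
      define \<eta> where "\<eta> = \<epsilon> / c"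
      have \<eta>: "\<eta> > 0" unfolding \<eta>_def using \<epsilon> c by simp
      define F where "F = insert 0 ((\<lambda>g. g - k) ` {g. f g \<noteq> 0})"
      have "finite F" unfolding F_def using Sec_finite[OF f] by simp
      from lim[rule_format, OF this \<eta>]
      obtain \<phi> where \<phi>: "S.bounded_op (mul (\<lambda>g. \<phi> (g - k))) (Re (\<phi> 0))"
          "\<And>g. g \<in> F \<Longrightarrow> cmod (\<phi> g - \<psi> g) < \<eta>" by blast
      have "mx (mul (\<lambda>g. \<psi> (g - k)) f) \<le> mx (mul (\<lambda>g. \<phi> (g - k)) f)
          + mx (mul (\<lambda>g. \<psi> (g - k) - \<phi> (g - k)) f)"
        using S.p_le_diff[OF mul_closed[OF f, of "\<lambda>g. \<psi> (g - k)"] mul_closed[OF f, of "\<lambda>g. \<phi> (g - k)"]]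
        unfolding mul_diff_fun by simp
      also have "mx (mul (\<lambda>g. \<psi> (g - k) - \<phi> (g - k)) f) \<le> \<eta> * s"
        unfolding s_def
        using \<phi>(2) by (intro mx_mul_le[OF f]) (auto simp: F_def norm_minus_commute intro: less_imp_le)
      also have "mx (mul (\<lambda>g. \<phi> (g - k)) f) \<le> Re (\<phi> 0) * mx f" by (rule bounded_mulD[OF \<phi>(1) f])
      also have "\<dots> \<le> (Re (\<psi> 0) + \<eta>) * mx f"
      proof (rule mult_right_mono)
        show "Re (\<phi> 0) \<le> Re (\<psi> 0) + \<eta>"
          using \<phi>(2)[of 0] abs_Re_le_cmod[of "\<phi> 0 - \<psi> 0"] unfolding F_def by simp
      qed (rule mx_nonneg[OF f])
      also have "(Re (\<psi> 0) + \<eta>) * mx f + \<eta> * s = Re (\<psi> 0) * mx f + \<eta> * (mx f + s)"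
        by (simp add: algebra_simps)
      also have "\<eta> * (mx f + s) \<le> \<eta> * c" unfolding c_def using \<eta> by (intro mult_left_mono) auto
      also have "\<eta> * c = \<epsilon>" unfolding \<eta>_def using c by simp
      finally show "mx (mul (\<lambda>g. \<psi> (g - k)) f) \<le> Re (\<psi> 0) * mx f + \<epsilon>" by simp
    qed
  qed
qed

text \<open>Positive definite multipliers are limits of positive combinations of the dual action; so they preserve
  closed ideals that are invariant under the dual action.\<close>

lemma pos_def_preserves_ideal:
  assumes I: "closed_ideal CB I" and inv: "\<And>\<xi>. \<xi> \<in> dual_group \<Longrightarrow> T \<xi> ` I \<subseteq> I"
    and \<phi>: "pos_def \<phi>" and x: "x \<in> I"
  shows "T (\<lambda>g. \<phi> (g - k)) x \<in> I"
  using \<phi>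
proof (induction \<phi> arbitrary: k rule: pos_def.induct)
  case (char \<xi>)
  have "(\<lambda>g. \<xi> (g - k)) = (\<lambda>g. cnj (\<xi> k) * \<xi> g)" using char by (simp add: dual_diff mult.commute)
  then show ?case
    using T_scale_fun[OF bounded_char[OF char] S.compl.closed_ideal_subset[OF I x], of "cnj (\<xi> k)"]
      S.compl.closed_ideal_scale[OF I] inv[OF char] x by auto
next
  case (add \<phi> \<psi>)
  then show ?case
    using T_add_fun[OF bounded_pos_def[OF add.hyps(1)] bounded_pos_def[OF add.hyps(2)] S.compl.closed_ideal_subset[OF I x]]
      S.compl.closed_ideal_add[OF I] by simp
next
  case (scale \<phi> c)
  then show ?case
    using T_scale_fun[OF bounded_pos_def[OF scale.hyps(1)] S.compl.closed_ideal_subset[OF I x]]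
      S.compl.closed_ideal_scale[OF I] by simp
next
  case (lim \<psi>)
  have xE: "x \<in> E" by (rule S.compl.closed_ideal_subset[OF I x])
  have "pos_def \<psi>" using lim by (intro pos_def_limI) blast
  note b\<psi> = bounded_pos_def[OF this, of k]
  have r: "Re (\<psi> 0) \<ge> 0" by (rule bounded_mul_nonneg[OF b\<psi>])
  show ?case
  proof (rule S.compl.closed_ideal_approx[OF I T_closed[OF b\<psi> xE]])
    fix \<epsilon> :: real assume \<epsilon>: "\<epsilon> > 0"
    define \<eta> where "\<eta> = \<epsilon> / (2 * Re (\<psi> 0) + 3)"
    have \<eta>: "\<eta> > 0" unfolding \<eta>_def using \<epsilon> r by simp
    obtain y where y: "y \<in> Sec" "nrm (emb y \<ominus>\<^bsub>CB\<^esub> x) < \<eta>" using S.embed_dense[OF xE \<eta>] by blast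
    define s where "s = (\<Sum>g | y g \<noteq> 0. fnorm \<B> g (y g))"
    have s: "s \<ge> 0" unfolding s_def using Sec_fibre[OF y(1)] by (intro sum_nonneg fnorm_nonneg)
    define \<delta> where "\<delta> = min 1 (\<eta> / (s + 1))"
    have \<delta>: "\<delta> > 0" unfolding \<delta>_def using \<eta> s by simp
    define F where "F = insert 0 ((\<lambda>g. g - k) ` {g. y g \<noteq> 0})"
    have "finite F" unfolding F_def using Sec_finite[OF y(1)] by simp
    from lim[rule_format, OF this \<delta>]
    obtain \<phi> where \<phi>: "pos_def \<phi>" "T (\<lambda>g. \<phi> (g - k)) x \<in> I" "\<And>g. g \<in> F \<Longrightarrow> cmod (\<phi> g - \<psi> g) < \<delta>" by blast
    have "nrm (T (\<lambda>g. \<phi> (g - k)) x \<ominus>\<^bsub>CB\<^esub> T (\<lambda>g. \<psi> (g - k)) x) \<le>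
        (Re (\<phi> 0) + Re (\<psi> 0)) * nrm (emb y \<ominus>\<^bsub>CB\<^esub> x) + \<delta> * s"
      unfolding s_def using \<phi>(3)
      by (intro T_diff_bound[OF bounded_pos_def[OF \<phi>(1)] b\<psi> xE y(1)]) (auto simp: F_def intro: less_imp_le)
    also have "\<dots> \<le> (2 * Re (\<psi> 0) + 1) * \<eta> + \<eta>"
    proof (rule add_mono)
      have "Re (\<phi> 0) \<le> Re (\<psi> 0) + 1"
        using \<phi>(3)[of 0] abs_Re_le_cmod[of "\<phi> 0 - \<psi> 0"] unfolding F_def \<delta>_def
        by (simp, elim conjE, linarith)
      then show "(Re (\<phi> 0) + Re (\<psi> 0)) * nrm (emb y \<ominus>\<^bsub>CB\<^esub> x) \<le> (2 * Re (\<psi> 0) + 1) * \<eta>"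
        using r y S.compl.p_nonneg[OF S.compl.diff_closed[OF S.embed_closed[OF y(1)] xE]]
        by (intro mult_mono) auto
      have "\<delta> * s \<le> \<eta> / (s + 1) * (s + 1)"
        using s \<eta> unfolding \<delta>_def by (intro mult_mono) auto
      then show "\<delta> * s \<le> \<eta>" using s by simp
    qed
    also have "\<dots> < (2 * Re (\<psi> 0) + 3) * \<eta>" using \<eta> by (simp add: algebra_simps)
    also have "\<dots> = \<epsilon>" unfolding \<eta>_def using r by simp
    finally show "\<exists>y\<in>I. nrm (y \<ominus>\<^bsub>CB\<^esub> T (\<lambda>g. \<psi> (g - k)) x) < \<epsilon>" using \<phi>(2) by blast
  qed
qed

lemma delta_shift: "delta g = (\<lambda>h :: 'g. delta 0 (h - g))"
  by (auto simp: delta_def)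

text \<open>The projection onto the spectral subspace of \<open>g\<close>.\<close>

lemma bounded_delta: "S.bounded_op (mul (delta g)) 1"
proof -
  have "Re (delta 0 (0 :: 'g)) = 1" by (simp add: delta_def)
  then show ?thesis using bounded_pos_def[OF pos_def_delta, of g] unfolding delta_shift[of g] by simp
qed

lemma delta_preserves_ideal:
  assumes "closed_ideal CB I" "\<And>\<xi>. \<xi> \<in> dual_group \<Longrightarrow> T \<xi> ` I \<subseteq> I" "x \<in> I"
  shows "T (delta g) x \<in> I"
  using pos_def_preserves_ideal[OF assms(1,2) pos_def_delta assms(3), of g]
  unfolding delta_shift[of g, symmetric] .

lemma finite_multiplier_in_ideal:
  assumes J: "closed_ideal CB J" and x: "x \<in> E" and coeff: "\<And>g. T (delta g) x \<in> J"
    and \<phi>: "finite {g. \<phi> g \<noteq> 0}"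
  shows "T \<phi> x \<in> J"
proof -
  have "(\<exists>M. S.bounded_op (mul \<phi>) M) \<and> T \<phi> x \<in> J" if "finite F" "{g. \<phi> g \<noteq> 0} \<subseteq> F" for F \<phi>
    using that
  proof (induction F arbitrary: \<phi> rule: finite_induct)
    case empty
    then have \<phi>0: "\<phi> = (\<lambda>g. 0 * delta 0 g)" by auto
    have "T \<phi> x = 0 \<odot>\<^bsub>CB\<^esub> T (delta 0) x"
      unfolding \<phi>0 by (rule T_scale_fun[OF bounded_delta x])
    then show ?case
      using bounded_mul_scale[OF bounded_delta, of 0 0] S.compl.closed_ideal_scale[OF J coeff, of 0 0]
      unfolding \<phi>0 by auto
  next
    case (insert g F)
    define \<psi> where "\<psi> = \<phi>(g := 0)"
    have "{h. \<psi> h \<noteq> 0} \<subseteq> F" using insert.prems unfolding \<psi>_def by auto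
    from insert.IH[OF this] obtain M where M: "S.bounded_op (mul \<psi>) M" "T \<psi> x \<in> J" by blast
    have eq: "\<phi> = (\<lambda>h. \<psi> h + \<phi> g * delta g h)" unfolding \<psi>_def delta_def by auto
    have b: "S.bounded_op (mul (\<lambda>h. \<psi> h + \<phi> g * delta g h)) (M + cmod (\<phi> g) * 1)"
      by (rule bounded_mul_add[OF M(1) bounded_mul_scale[OF bounded_delta]])
    have "T (\<lambda>h. \<psi> h + \<phi> g * delta g h) x = T \<psi> x \<oplus>\<^bsub>CB\<^esub> \<phi> g \<odot>\<^bsub>CB\<^esub> T (delta g) x"
      unfolding T_add_fun[OF M(1) bounded_mul_scale[OF bounded_delta] x] T_scale_fun[OF bounded_delta x] ..
    also have "\<dots> \<in> J"
      by (intro S.compl.closed_ideal_add[OF J] M(2) S.compl.closed_ideal_scale[OF J] coeff)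
    finally show ?case using b eq[symmetric] by auto
  qed
  from this[OF \<phi> order_refl] show ?thesis by blast
qed

text \<open>Spectral synthesis: Fejer-type summation recovers \<open>x\<close> from its spectral components.\<close>

lemma coefficients_in_ideal:
  assumes J: "closed_ideal CB J" and x: "x \<in> E" and coeff: "\<And>g. T (delta g) x \<in> J"
  shows "x \<in> J"
proof (rule S.compl.closed_ideal_approx[OF J x])
  fix \<epsilon> :: real assume \<epsilon>: "\<epsilon> > 0"
  define \<eta> where "\<eta> = \<epsilon> / 4"
  have \<eta>: "\<eta> > 0" unfolding \<eta>_def using \<epsilon> by simp
  obtain y where y: "y \<in> Sec" "nrm (emb y \<ominus>\<^bsub>CB\<^esub> x) < \<eta>" using S.embed_dense[OF x \<eta>] by blast
  define s where "s = (\<Sum>g | y g \<noteq> 0. fnorm \<B> g (y g))"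
  have s: "s \<ge> 0" unfolding s_def using Sec_fibre[OF y(1)] by (intro sum_nonneg fnorm_nonneg)
  obtain \<phi> where \<phi>: "pos_def \<phi>" "\<phi> 0 = 1" "finite {g. \<phi> g \<noteq> 0}"
      "\<And>g. g \<in> {g. y g \<noteq> 0} \<Longrightarrow> cmod (\<phi> g - 1) < \<eta> / (s + 1)"
    using pos_def_approximate_unit[OF Sec_finite[OF y(1)], of "\<eta> / (s + 1)"] \<eta> s by auto
  have b: "S.bounded_op (mul \<phi>) 1" using bounded_pos_def[OF \<phi>(1), of 0] \<phi>(2) by simp
  have "nrm (T \<phi> x \<ominus>\<^bsub>CB\<^esub> T (\<lambda>g. 1) x) \<le> (1 + 1) * nrm (emb y \<ominus>\<^bsub>CB\<^esub> x) + \<eta> / (s + 1) * s"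
    unfolding s_def[symmetric] using \<phi>(4)
    by (intro T_diff_bound[OF b bounded_char[OF dual_one] x y(1), of "\<eta> / (s + 1)", folded s_def])
      (auto intro: less_imp_le)
  also have "\<dots> < 2 * \<eta> + 2 * \<eta>"
  proof (rule add_less_le_mono)
    have "\<eta> / (s + 1) * s \<le> \<eta> / (s + 1) * (s + 1)" using s \<eta> by (intro mult_left_mono) auto
    then show "\<eta> / (s + 1) * s \<le> 2 * \<eta>" using s \<eta> by simp
  qed (use y in simp)
  finally have "nrm (T \<phi> x \<ominus>\<^bsub>CB\<^esub> x) < \<epsilon>" unfolding T_one[OF x] \<eta>_def by simp
  moreover have "T \<phi> x \<in> J" by (rule finite_multiplier_in_ideal[OF J x coeff \<phi>(3)])
  ultimately show "\<exists>y\<in>J. nrm (y \<ominus>\<^bsub>CB\<^esub> x) < \<epsilon>" by blast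
qed

text \<open>A spectral component of degree \<open>g\<close> is a limit of sections supported at \<open>g\<close>, and the products \<open>a\<^sup>* a\<close> of these
  lie in the unit fibre.\<close>

lemma spectral_square_in_unit_fibre:
  assumes x: "x \<in> E"
  shows "(T (delta g) x)\<dagger>\<^bsub>CB\<^esub> \<otimes>\<^bsub>CB\<^esub> T (delta g) x \<in> unit_fibre \<B>"
proof -
  obtain X where X: "X \<in> S.CS" "x = S.cls X" using x by (rule S.completion_cases)
  have XS: "X n \<in> Sec" for n by (rule S.CS_closed[OF X(1)])
  define b where "b n = fmult \<B> (- g) g (fstar \<B> g (X n g)) (X n g)" for n
  have fib: "X n g \<in> fibre \<B> g" for n by (rule Sec_fibre[OF XS])
  have b: "b n \<in> fibre \<B> 0" for n
    unfolding b_def using mult_closed[OF star_closed[OF fib] fib] by simp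
  define Y where "Y n = mul (delta g) (X n)" for n
  have Y: "Y \<in> S.CS" unfolding Y_def by (rule mul_CS[OF bounded_delta X(1)])
  have Y_single: "Y n = single g (X n g)" for n
    unfolding Y_def mul_def single_def delta_def by auto
  have prod: "(Y n)\<dagger>\<^bsub>section_algebra \<B>\<^esub> \<otimes>\<^bsub>section_algebra \<B>\<^esub> Y n = single 0 (b n)" for n
    unfolding Y_single single_star single_mult[OF star_closed[OF fib] fib] b_def by simp
  define Z where "Z = (\<lambda>n. single (0 :: 'g) (b n))"
  have Z: "Z \<in> S.CS" using S.CS_mult[OF S.CS_star[OF Y] Y] unfolding prod Z_def .
  have eq: "(T (delta g) x)\<dagger>\<^bsub>CB\<^esub> \<otimes>\<^bsub>CB\<^esub> T (delta g) x = S.cls Z"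
    unfolding X(2) T_cls[OF bounded_delta X(1)] Y_def[symmetric]
    using Y by (simp only: S.cls_star S.cls_mult S.CS_star prod Z_def)
  show ?thesis
    unfolding eq
  proof (rule unit_fibre_closed[OF _ S.cls_closed[OF Z] S.cls_limit[OF Z]])
    show "emb (Z n) \<in> unit_fibre \<B>" for n unfolding unit_fibre_eq Z_def using b by blast
  qed
qed

text \<open>An ideal that is invariant under the dual action is determined by its intersection with the
  unit fibre.\<close>

theorem invariant_ideal_le:
  assumes I: "closed_ideal CB I" and inv: "\<And>\<xi>. \<xi> \<in> dual_group \<Longrightarrow> T \<xi> ` I \<subseteq> I"
    and J: "closed_ideal CB J" and le: "I \<inter> unit_fibre \<B> \<subseteq> J"
  shows "I \<subseteq> J"
proof
  fix x assume x: "x \<in> I"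
  then have xE: "x \<in> E" by (rule S.compl.closed_ideal_subset[OF I])
  show "x \<in> J"
  proof (rule coefficients_in_ideal[OF J xE])
    fix g
    define u where "u = T (delta g) x"
    have uI: "u \<in> I" unfolding u_def by (rule delta_preserves_ideal[OF I inv x])
    have uE: "u \<in> E" by (rule S.compl.closed_ideal_subset[OF I uI])
    have "u\<dagger>\<^bsub>CB\<^esub> \<otimes>\<^bsub>CB\<^esub> u \<in> unit_fibre \<B>"
      unfolding u_def by (rule spectral_square_in_unit_fibre[OF xE])
    moreover have "u\<dagger>\<^bsub>CB\<^esub> \<otimes>\<^bsub>CB\<^esub> u \<in> I"
      by (intro S.compl.closed_ideal_mult_left[OF I] S.compl.star_closed uE uI)
    ultimately have "u\<dagger>\<^bsub>CB\<^esub> \<otimes>\<^bsub>CB\<^esub> u \<in> J" using le by blast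
    then show "T (delta g) x \<in> J"
      unfolding u_def[symmetric] by (rule S.compl.star_mult_self_in_ideal[OF J uE])
  qed
qed

section \<open>Ideals under the dual action\<close>

lemma T_char_T:
  assumes "\<xi> \<in> dual_group" "\<psi> \<in> dual_group" "x \<in> E"
  shows "T \<xi> (T \<psi> x) = T (\<lambda>g. \<xi> g * \<psi> g) x"
proof -
  obtain X where X: "X \<in> S.CS" "x = S.cls X" using assms(3) by (rule S.completion_cases)
  have "mul \<xi> (mul \<psi> f) = mul (\<lambda>g. \<xi> g * \<psi> g) f" for f by (simp add: mul_def)
  then show ?thesis
    unfolding X(2) T_cls[OF bounded_char[OF assms(2)] X(1)]
      T_cls[OF bounded_char[OF assms(1)] mul_CS[OF bounded_char[OF assms(2)] X(1)]]
      T_cls[OF bounded_char[OF dual_mult[OF assms(1,2)]] X(1)] by simp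
qed

lemma T_char_inverse:
  assumes "\<xi> \<in> dual_group" "x \<in> E"
  shows "T \<xi> (T (\<lambda>g. cnj (\<xi> g)) x) = x" "T (\<lambda>g. cnj (\<xi> g)) (T \<xi> x) = x"
proof -
  have "(\<lambda>g. \<xi> g * cnj (\<xi> g)) = (\<lambda>g. 1)" "(\<lambda>g. cnj (\<xi> g) * \<xi> g) = (\<lambda>g. 1)"
    using dual_cnj[OF assms(1)] by (auto simp: mult.commute)
  then show "T \<xi> (T (\<lambda>g. cnj (\<xi> g)) x) = x" "T (\<lambda>g. cnj (\<xi> g)) (T \<xi> x) = x"
    using T_char_T[OF assms(1) dual_inverse[OF assms(1)] assms(2)]
      T_char_T[OF dual_inverse[OF assms(1)] assms(1,2)] T_one[OF assms(2)] by simp_all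
qed

lemma T_char_mult:
  assumes \<xi>: "\<xi> \<in> dual_group" and "x \<in> E" "y \<in> E"
  shows "T \<xi> (x \<otimes>\<^bsub>CB\<^esub> y) = T \<xi> x \<otimes>\<^bsub>CB\<^esub> T \<xi> y"
proof -
  obtain X where X: "X \<in> S.CS" "x = S.cls X" using assms(2) by (rule S.completion_cases)
  obtain Y where Y: "Y \<in> S.CS" "y = S.cls Y" using assms(3) by (rule S.completion_cases)
  note b = bounded_char[OF \<xi>]
  have "mul \<xi> (X n \<otimes>\<^bsub>section_algebra \<B>\<^esub> Y n) = mul \<xi> (X n) \<otimes>\<^bsub>section_algebra \<B>\<^esub> mul \<xi> (Y n)" for n
    by (intro mul_char_mult[OF \<xi>] S.CS_closed X Y)
  then show ?thesis
    unfolding X(2) Y(2) S.cls_mult[OF X(1) Y(1)] T_cls[OF b X(1)] T_cls[OF b Y(1)]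
      T_cls[OF b S.CS_mult[OF X(1) Y(1)]] S.cls_mult[OF mul_CS[OF b X(1)] mul_CS[OF b Y(1)]] by simp
qed

lemma T_image_iff:
  assumes \<xi>: "\<xi> \<in> dual_group" and I: "I \<subseteq> E"
  shows "x \<in> T \<xi> ` I \<longleftrightarrow> x \<in> E \<and> T (\<lambda>g. cnj (\<xi> g)) x \<in> I"
proof
  assume "x \<in> T \<xi> ` I"
  then obtain y where y: "y \<in> I" "x = T \<xi> y" by blast
  have yE: "y \<in> E" using y(1) I by blast
  show "x \<in> E \<and> T (\<lambda>g. cnj (\<xi> g)) x \<in> I"
    unfolding y(2) T_char_inverse(2)[OF \<xi> yE] using y(1) T_closed[OF bounded_char[OF \<xi>] yE] by blast
next
  assume "x \<in> E \<and> T (\<lambda>g. cnj (\<xi> g)) x \<in> I"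
  then show "x \<in> T \<xi> ` I" using T_char_inverse(1)[OF \<xi>, of x] by (metis imageI)
qed

lemma closed_ideal_subset': "closed_ideal CB I \<Longrightarrow> I \<subseteq> E"
  using S.compl.closed_ideal_subset by blast

lemma closed_ideal_T_image:
  assumes \<xi>: "\<xi> \<in> dual_group" and I: "closed_ideal CB I"
  shows "closed_ideal CB (T \<xi> ` I)"
proof -
  define \<psi> where "\<psi> = (\<lambda>g. cnj (\<xi> g))"
  have \<psi>: "\<psi> \<in> dual_group" unfolding \<psi>_def by (rule dual_inverse[OF \<xi>])
  note b = bounded_char[OF \<psi>]
  have iff: "x \<in> T \<xi> ` I \<longleftrightarrow> x \<in> E \<and> T \<psi> x \<in> I" for x
    unfolding \<psi>_def by (rule T_image_iff[OF \<xi> closed_ideal_subset'[OF I]])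
  have lin: "T \<psi> (x \<oplus>\<^bsub>CB\<^esub> y) = T \<psi> x \<oplus>\<^bsub>CB\<^esub> T \<psi> y" "T \<psi> (c \<odot>\<^bsub>CB\<^esub> x) = c \<odot>\<^bsub>CB\<^esub> T \<psi> x"
    if "x \<in> E" "y \<in> E" for x y c
    using S.bounded_op_add[OF b that] S.bounded_op_scale[OF b that(1)] unfolding T_def by auto
  show ?thesis
  proof (rule S.compl.closed_idealI)
    show "T \<xi> ` I \<subseteq> E" using iff by blast
    have "T \<psi> \<zero>\<^bsub>CB\<^esub> = \<zero>\<^bsub>CB\<^esub>"
      using lin(2)[of "\<zero>\<^bsub>CB\<^esub>" "\<zero>\<^bsub>CB\<^esub>" 0] T_closed[OF b S.compl.zero_closed] by simp
    then show "\<zero>\<^bsub>CB\<^esub> \<in> T \<xi> ` I" unfolding iff using S.compl.closed_ideal_zero[OF I] by simp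
    show "x \<oplus>\<^bsub>CB\<^esub> y \<in> T \<xi> ` I" if "x \<in> T \<xi> ` I" "y \<in> T \<xi> ` I" for x y
      using that unfolding iff using S.compl.closed_ideal_add[OF I] lin(1)[of x y] by simp
    show "c \<odot>\<^bsub>CB\<^esub> x \<in> T \<xi> ` I" if "x \<in> T \<xi> ` I" for x c
      using that unfolding iff using S.compl.closed_ideal_scale[OF I] lin(2)[of x x c] by simp
    show "a \<otimes>\<^bsub>CB\<^esub> x \<in> T \<xi> ` I" if "a \<in> E" "x \<in> T \<xi> ` I" for a x
      using that unfolding iff
      using S.compl.closed_ideal_mult_left[OF I T_closed[OF b that(1)], of "T \<psi> x"] T_char_mult[OF \<psi>, of a x]
      by simp
    show "x \<otimes>\<^bsub>CB\<^esub> a \<in> T \<xi> ` I" if "a \<in> E" "x \<in> T \<xi> ` I" for a x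
      using that unfolding iff
      using S.compl.closed_ideal_mult_right[OF I T_closed[OF b that(1)], of "T \<psi> x"] T_char_mult[OF \<psi>, of x a]
      by simp
    fix X l assume X: "\<And>n. X n \<in> T \<xi> ` I" and l: "l \<in> E" "S.compl.conv X l"
    have XE: "X n \<in> E" "T \<psi> (X n) \<in> I" for n using X iff by auto
    have "S.compl.conv (\<lambda>n. T \<psi> (X n)) (T \<psi> l)"
      unfolding T_def by (rule S.bounded_op_conv[OF b XE(1) l])
    then have "T \<psi> l \<in> I" by (rule S.compl.closed_ideal_closed[OF I XE(2) T_closed[OF b l(1)]])
    then show "l \<in> T \<xi> ` I" unfolding iff using l by blast
  qed
qed

lemma T_fixes_unit_fibre:
  assumes \<xi>: "\<xi> \<in> dual_group" and a: "a \<in> unit_fibre \<B>"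
  shows "T \<xi> a = a"
proof -
  obtain b where b: "b \<in> fibre \<B> 0" "a = emb (single 0 b)" using a unfolding unit_fibre_eq by blast
  have "mul \<xi> (single 0 b) = single 0 b"
    using dual_zero[OF \<xi>] by (auto simp: mul_def single_def fun_eq_iff)
  then show ?thesis unfolding b(2) T_emb[OF bounded_char[OF \<xi>] single_closed[OF b(1)]] by simp
qed

lemma unit_fibre_subset: "unit_fibre \<B> \<subseteq> E"
  unfolding unit_fibre_eq using S.embed_closed[OF single_closed] by blast

lemma unit_fibre_zero: "\<zero>\<^bsub>CB\<^esub> \<in> unit_fibre \<B>"
proof -
  have "single 0 0 = (\<lambda>g :: 'g. 0 :: 'b)" by (auto simp: single_def)
  then have "\<zero>\<^bsub>CB\<^esub> = emb (single 0 0)"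
    unfolding S.completion_zero S.completion_embed_cls by (simp only: section_algebra_simps)
  then show ?thesis unfolding unit_fibre_eq using fibre_zero by blast
qed

lemma T_image_unit_fibre:
  assumes \<xi>: "\<xi> \<in> dual_group" and I: "closed_ideal CB I"
  shows "T \<xi> ` I \<inter> unit_fibre \<B> = I \<inter> unit_fibre \<B>"
proof (rule set_eqI)
  fix a
  have "a \<in> T \<xi> ` I \<longleftrightarrow> a \<in> I" if a: "a \<in> unit_fibre \<B>"
    unfolding T_image_iff[OF \<xi> closed_ideal_subset'[OF I]] T_fixes_unit_fibre[OF dual_inverse[OF \<xi>] a]
    using a unit_fibre_subset by blast
  then show "a \<in> T \<xi> ` I \<inter> unit_fibre \<B> \<longleftrightarrow> a \<in> I \<inter> unit_fibre \<B>" by (simp only: Int_iff) metis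
qed

section \<open>Detection and separation of ideals by the unit fibre\<close>

theorem detects_imp_connes:
  assumes det: "detects_ideals CB (unit_fibre \<B>)" and \<xi>: "\<xi> \<in> dual_group"
    and I: "closed_ideal CB I" "I \<noteq> {\<zero>\<^bsub>CB\<^esub>}"
  shows "I \<inter> T \<xi> ` I \<noteq> {\<zero>\<^bsub>CB\<^esub>}"
proof -
  have "I \<inter> unit_fibre \<B> \<noteq> {\<zero>\<^bsub>CB\<^esub>}" using det I unfolding detects_ideals_def by blast
  then obtain a where a: "a \<in> I \<inter> unit_fibre \<B>" "a \<noteq> \<zero>\<^bsub>CB\<^esub>"
    using S.compl.closed_ideal_zero[OF I(1)] unit_fibre_zero by blast
  from a(1) have "a \<in> I \<inter> T \<xi> ` I" unfolding T_image_unit_fibre[OF \<xi> I(1), symmetric] using a(1) by simp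
  then show ?thesis using a(2) by (metis singletonD)
qed

text \<open>For the translates of \<open>J\<close> by characters close to \<open>1\<close>, a local unit gives a common nonzero element:
  a nonzero ideal \<open>J\<close> contains a nonzero ideal that stays inside all translates of \<open>J\<close> by
  characters close to \<open>1\<close>. By total boundedness of the dual group, finitely many translates of it
  control all translates of \<open>J\<close>.\<close>

lemma finitely_many_translates:
  assumes J: "closed_ideal CB J" "J \<noteq> {\<zero>\<^bsub>CB\<^esub>}"
  obtains J0 Z where "closed_ideal CB J0" "J0 \<noteq> {\<zero>\<^bsub>CB\<^esub>}" "finite Z" "Z \<subseteq> dual_group"
    "\<And>\<xi>. \<xi> \<in> dual_group \<Longrightarrow> \<exists>z\<in>Z. T z ` J0 \<subseteq> T \<xi> ` J"
proof -
  obtain x where x: "x \<in> J" "x \<noteq> \<zero>\<^bsub>CB\<^esub>" using J S.compl.closed_ideal_zero by blast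
  have xE: "x \<in> E" by (rule S.compl.closed_ideal_subset[OF J(1) x(1)])
  define a where "a = x\<dagger>\<^bsub>CB\<^esub> \<otimes>\<^bsub>CB\<^esub> x"
  have aJ: "a \<in> J" unfolding a_def by (intro S.compl.closed_ideal_mult_left[OF J(1)] S.compl.star_closed xE x)
  have a: "a \<in> E" "a\<dagger>\<^bsub>CB\<^esub> = a" unfolding a_def using xE by (auto simp: S.compl.star_mult)
  have "a \<noteq> \<zero>\<^bsub>CB\<^esub>"
    using S.compl.p_star_mult[OF xE] S.compl.p_definite[OF xE] x(2) unfolding a_def[symmetric] by auto
  then obtain w c where wc: "w \<in> E" "c \<in> E" "c \<noteq> \<zero>\<^bsub>CB\<^esub>" "w \<otimes>\<^bsub>CB\<^esub> a \<otimes>\<^bsub>CB\<^esub> c = c"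
    using S.compl.local_inverse[OF a] by metis
  define \<delta> where "\<delta> = 1 / (2 * (nrm w + 1))"
  have w0: "nrm w \<ge> 0" using wc by simp
  have \<delta>: "\<delta> > 0" unfolding \<delta>_def using w0 by simp
  have w\<delta>: "nrm w * \<delta> \<le> 1 / 2" unfolding \<delta>_def using w0 by (simp add: field_simps)
  \<comment> \<open>All ideals that come close to \<open>a\<close>; among them are \<open>J\<close> and its translates by characters near \<open>1\<close>.\<close>
  define \<F> where "\<F> = {K. closed_ideal CB K \<and> (\<exists>k\<in>K. nrm (a \<ominus>\<^bsub>CB\<^esub> k) < \<delta>)}"
  have "J \<in> \<F>" unfolding \<F>_def using J aJ a \<delta> by (auto intro!: bexI[of _ a])
  define J0 where "J0 = \<Inter>\<F>"
  have J0: "closed_ideal CB J0"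
    unfolding J0_def using \<open>J \<in> \<F>\<close> by (intro S.compl.closed_ideal_Inter) (auto simp: \<F>_def)
  have "c \<in> J0"
    unfolding J0_def
  proof
    fix K assume "K \<in> \<F>"
    then obtain k where K: "closed_ideal CB K" "k \<in> K" "nrm (a \<ominus>\<^bsub>CB\<^esub> k) < \<delta>" unfolding \<F>_def by blast
    have "nrm w * nrm (a \<ominus>\<^bsub>CB\<^esub> k) \<le> nrm w * \<delta>" using K(3) w0 by (intro mult_left_mono) auto
    then show "c \<in> K"
      using w\<delta> by (intro S.compl.local_unit_in_close_ideal[OF K(1) wc(1) a(1) wc(2,4) K(2)]) simp
  qed
  then have J0_ne: "J0 \<noteq> {\<zero>\<^bsub>CB\<^esub>}" using wc(3) by blast
  have "\<delta> / 4 > 0" using \<delta> by simp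
  then obtain y where y: "y \<in> Sec" "nrm (emb y \<ominus>\<^bsub>CB\<^esub> a) < \<delta> / 4" using S.embed_dense[OF a(1)] by blast
  define s where "s = (\<Sum>g | y g \<noteq> 0. fnorm \<B> g (y g))"
  have s: "s \<ge> 0" unfolding s_def using Sec_fibre[OF y(1)] by (intro sum_nonneg fnorm_nonneg)
  define \<eta> where "\<eta> = \<delta> / (4 * (s + 1))"
  have \<eta>: "\<eta> > 0" unfolding \<eta>_def using \<delta> s by simp
  have \<eta>s: "\<eta> * s \<le> \<delta> / 4"
  proof -
    have "\<eta> * s \<le> \<eta> * (s + 1)" using \<eta> by (intro mult_left_mono) auto
    also have "\<dots> = \<delta> / 4" unfolding \<eta>_def using s by (simp add: field_simps)
    finally show ?thesis .
  qed
  obtain Z where Z: "finite Z" "Z \<subseteq> dual_group"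
      "\<And>\<xi>. \<xi> \<in> dual_group \<Longrightarrow> \<exists>z\<in>Z. \<forall>g\<in>{g. y g \<noteq> 0}. cmod (\<xi> g - z g) < \<eta>"
    using dual_finite_net[OF Sec_finite[OF y(1)] \<eta>] by metis
  have "\<exists>z\<in>Z. T z ` J0 \<subseteq> T \<xi> ` J" if \<xi>: "\<xi> \<in> dual_group" for \<xi>
  proof -
    obtain z where z: "z \<in> Z" "\<And>g. y g \<noteq> 0 \<Longrightarrow> cmod (\<xi> g - z g) < \<eta>" using Z(3)[OF \<xi>] by blast
    have zd: "z \<in> dual_group" using z Z by blast
    define \<psi> where "\<psi> = (\<lambda>g. cnj (z g) * \<xi> g)"
    have \<psi>: "\<psi> \<in> dual_group" unfolding \<psi>_def by (intro dual_mult dual_inverse zd \<xi>)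
    have z\<psi>: "z g * \<psi> g = \<xi> g" for g
      unfolding \<psi>_def using dual_cnj[OF zd, of g] by (simp flip: mult.assoc)
    have close: "cmod (1 - \<psi> g) \<le> \<eta>" if "y g \<noteq> 0" for g
    proof -
      have "cmod (1 - \<psi> g) = cmod (z g) * cmod (1 - \<psi> g)" using dual_norm[OF zd] by simp
      also have "\<dots> = cmod (z g - \<xi> g)"
        unfolding Real_Vector_Spaces.norm_mult[symmetric] right_diff_distrib z\<psi> by simp
      also have "\<dots> \<le> \<eta>" using z(2)[OF that] by (simp add: norm_minus_commute)
      finally show ?thesis .
    qed
    have "nrm (T (\<lambda>g. 1) a \<ominus>\<^bsub>CB\<^esub> T \<psi> a) \<le> (1 + 1) * nrm (emb y \<ominus>\<^bsub>CB\<^esub> a) + \<eta> * s"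
      unfolding s_def
      by (rule T_diff_bound[OF bounded_char[OF dual_one] bounded_char[OF \<psi>] a(1) y(1) close])
    then have "nrm (a \<ominus>\<^bsub>CB\<^esub> T \<psi> a) < \<delta>"
      using y(2) \<eta>s \<delta> unfolding T_one[OF a(1)] one_add_one by linarith
    then have "T \<psi> ` J \<in> \<F>" unfolding \<F>_def using closed_ideal_T_image[OF \<psi> J(1)] aJ by blast
    then have "J0 \<subseteq> T \<psi> ` J" unfolding J0_def by blast
    then have "T z ` J0 \<subseteq> T z ` T \<psi> ` J" by blast
    also have "\<dots> \<subseteq> T \<xi> ` J"
      using T_char_T[OF zd \<psi>] closed_ideal_subset'[OF J(1)] by (auto simp: z\<psi> image_iff)
    finally show ?thesis using z(1) by blast
  qed
  then show ?thesis using that[OF J0 J0_ne Z(1,2)] by blast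
qed

text \<open>Applying the hypothesis once for each of the finitely many translates of \<open>J0\<close> produces a nonzero ideal
  inside the intersection \<open>J'\<close> of all translates of \<open>J\<close>. This intersection is invariant and meets the unit
  fibre trivially, hence is zero.\<close>

theorem connes_imp_detects:
  assumes connes: "\<And>\<xi> I. \<xi> \<in> dual_group \<Longrightarrow> closed_ideal CB I \<Longrightarrow> I \<noteq> {\<zero>\<^bsub>CB\<^esub>} \<Longrightarrow>
      I \<inter> T \<xi> ` I \<noteq> {\<zero>\<^bsub>CB\<^esub>}"
  shows "detects_ideals CB (unit_fibre \<B>)"
  unfolding detects_ideals_def
proof (intro allI impI, rule ccontr)
  fix J assume J: "closed_ideal CB J" "J \<inter> unit_fibre \<B> = {\<zero>\<^bsub>CB\<^esub>}" "J \<noteq> {\<zero>\<^bsub>CB\<^esub>}"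
  obtain J0 Z where J0: "closed_ideal CB J0" "J0 \<noteq> {\<zero>\<^bsub>CB\<^esub>}" and Z: "finite Z" "Z \<subseteq> dual_group"
    and cover: "\<And>\<xi>. \<xi> \<in> dual_group \<Longrightarrow> \<exists>z\<in>Z. T z ` J0 \<subseteq> T \<xi> ` J"
    using finitely_many_translates[OF J(1,3)] by metis
  have "\<exists>K. closed_ideal CB K \<and> K \<noteq> {\<zero>\<^bsub>CB\<^esub>} \<and> K \<subseteq> J0 \<and> (\<forall>z\<in>Z. K \<subseteq> T z ` J0)"
    using Z
  proof (induction Z rule: finite_induct)
    case empty
    then show ?case using J0 by blast
  next
    case (insert z Z)
    then obtain K where K: "closed_ideal CB K" "K \<noteq> {\<zero>\<^bsub>CB\<^esub>}" "K \<subseteq> J0" "\<forall>z\<in>Z. K \<subseteq> T z ` J0" by auto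
    have z: "z \<in> dual_group" using insert.prems by blast
    have "closed_ideal CB (\<Inter>{K, T z ` K})"
      using K(1) closed_ideal_T_image[OF z K(1)] by (intro S.compl.closed_ideal_Inter) auto
    moreover have "K \<inter> T z ` K \<noteq> {\<zero>\<^bsub>CB\<^esub>}" by (rule connes[OF z K(1,2)])
    moreover have "T z ` K \<subseteq> T z ` J0" using K(3) by blast
    ultimately show ?case using K(3,4) by (intro exI[of _ "K \<inter> T z ` K"]) auto
  qed
  then obtain K where K: "closed_ideal CB K" "K \<noteq> {\<zero>\<^bsub>CB\<^esub>}" "\<forall>z\<in>Z. K \<subseteq> T z ` J0" by auto
  define J' where "J' = (\<Inter>\<xi>\<in>dual_group. T \<xi> ` J)"
  have "K \<subseteq> T \<xi> ` J" if \<xi>: "\<xi> \<in> dual_group" for \<xi>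
  proof -
    obtain z where z: "z \<in> Z" "T z ` J0 \<subseteq> T \<xi> ` J" using cover[OF \<xi>] by (elim bexE)
    show ?thesis by (rule order_trans[OF bspec[OF K(3) z(1)] z(2)])
  qed
  then have "K \<subseteq> J'" unfolding J'_def by (rule INT_greatest)
  have ne: "dual_group \<noteq> ({} :: ('g \<Rightarrow> complex) set)" using dual_one by blast
  have J': "closed_ideal CB J'"
    unfolding J'_def using ne closed_ideal_T_image[OF _ J(1)] by (intro S.compl.closed_ideal_Inter) auto
  have iff: "v \<in> J' \<longleftrightarrow> v \<in> E \<and> (\<forall>\<xi>\<in>dual_group. T (\<lambda>g. cnj (\<xi> g)) v \<in> J)" for v
    unfolding J'_def using ne T_image_iff[OF _ closed_ideal_subset'[OF J(1)]] by auto
  have inv: "T \<psi> ` J' \<subseteq> J'" if \<psi>: "\<psi> \<in> dual_group" for \<psi>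
  proof
    fix u assume "u \<in> T \<psi> ` J'"
    then obtain v where v: "v \<in> J'" "u = T \<psi> v" by blast
    have vE: "v \<in> E" using v iff by blast
    show "u \<in> J'"
      unfolding iff
    proof (intro conjI ballI)
      show "u \<in> E" unfolding v(2) by (rule T_closed[OF bounded_char[OF \<psi>] vE])
      fix \<xi> :: "'g \<Rightarrow> complex" assume \<xi>: "\<xi> \<in> dual_group"
      have "T (\<lambda>g. cnj (\<xi> g)) u = T (\<lambda>g. cnj (\<xi> g * cnj (\<psi> g))) v"
        unfolding v(2) T_char_T[OF dual_inverse[OF \<xi>] \<psi> vE] by simp
      also have "\<dots> \<in> J"
      proof -
        have "\<forall>\<xi>\<in>dual_group. T (\<lambda>g. cnj (\<xi> g)) v \<in> J" using v(1) iff by simp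
        from bspec[OF this dual_mult[OF \<xi> dual_inverse[OF \<psi>]]] show ?thesis .
      qed
      finally show "T (\<lambda>g. cnj (\<xi> g)) u \<in> J" .
    qed
  qed
  have "J' \<subseteq> T (\<lambda>g. 1) ` J" unfolding J'_def using dual_one by blast
  also have "\<dots> \<subseteq> J" using T_one closed_ideal_subset'[OF J(1)] by auto
  finally have "J' \<inter> unit_fibre \<B> \<subseteq> {\<zero>\<^bsub>CB\<^esub>}" using J(2) by blast
  then have "J' \<subseteq> {\<zero>\<^bsub>CB\<^esub>}" by (intro invariant_ideal_le[OF J'] inv S.compl.closed_ideal_zero_set)
  then have "K = {\<zero>\<^bsub>CB\<^esub>}" using \<open>K \<subseteq> J'\<close> S.compl.closed_ideal_zero[OF K(1)] by blast
  then show False using K(2) by blast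
qed

theorem separates_imp_invariant:
  assumes sep: "separates_ideals CB (unit_fibre \<B>)" and \<xi>: "\<xi> \<in> dual_group" and I: "closed_ideal CB I"
  shows "T \<xi> ` I \<subseteq> I"
  using sep closed_ideal_T_image[OF \<xi> I] I T_image_unit_fibre[OF \<xi> I]
  unfolding separates_ideals_def by blast

theorem invariant_imp_separates:
  assumes "\<And>\<xi> I. \<xi> \<in> dual_group \<Longrightarrow> closed_ideal CB I \<Longrightarrow> T \<xi> ` I \<subseteq> I"
  shows "separates_ideals CB (unit_fibre \<B>)"
  unfolding separates_ideals_def
proof (intro allI impI)
  fix I J assume "closed_ideal CB I" "closed_ideal CB J" "I \<inter> unit_fibre \<B> = J \<inter> unit_fibre \<B>"
  then show "I = J" using invariant_ideal_le[of I J] invariant_ideal_le[of J I] assms by blast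
qed

end

theorem proposition9p5:
  fixes \<B> :: "('g::ab_group_add, 'b::ab_group_add) fell_data"
  assumes "fell_bundle \<B>"
  shows "(detects_ideals (fell_cstar \<B>) (unit_fibre \<B>) \<longleftrightarrow>
            connes_spectrum \<B> = dual_group) \<and>
         (separates_ideals (fell_cstar \<B>) (unit_fibre \<B>) \<longleftrightarrow>
            strong_connes_spectrum \<B> = dual_group)"
proof -
  interpret fell_bundle \<B> by (rule assms)
  interpret abelian_fell_bundle \<B> ..
  have connes: "connes_spectrum \<B> = dual_group \<longleftrightarrow>
      (\<forall>\<xi>\<in>dual_group. \<forall>I. closed_ideal CB I \<longrightarrow> I \<noteq> {\<zero>\<^bsub>CB\<^esub>} \<longrightarrow> I \<inter> T \<xi> ` I \<noteq> {\<zero>\<^bsub>CB\<^esub>})"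
    unfolding connes_spectrum_def fell_cstar_completion dual_action_T by blast
  have strong: "strong_connes_spectrum \<B> = dual_group \<longleftrightarrow>
      (\<forall>\<xi>\<in>dual_group. \<forall>I. closed_ideal CB I \<longrightarrow> T \<xi> ` I \<subseteq> I)"
    unfolding strong_connes_spectrum_def fell_cstar_completion dual_action_T by blast
  have "detects_ideals CB (unit_fibre \<B>) \<longleftrightarrow>
      (\<forall>\<xi>\<in>dual_group. \<forall>I. closed_ideal CB I \<longrightarrow> I \<noteq> {\<zero>\<^bsub>CB\<^esub>} \<longrightarrow> I \<inter> T \<xi> ` I \<noteq> {\<zero>\<^bsub>CB\<^esub>})"
    (is "?D \<longleftrightarrow> ?\<Gamma>")
  proof
    assume ?D
    then show ?\<Gamma> by (intro ballI allI impI detects_imp_connes)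
  next
    assume ?\<Gamma>
    then show ?D by (intro connes_imp_detects) (elim ballE allE impE, assumption+, simp)
  qed
  moreover have "separates_ideals CB (unit_fibre \<B>) \<longleftrightarrow>
      (\<forall>\<xi>\<in>dual_group. \<forall>I. closed_ideal CB I \<longrightarrow> T \<xi> ` I \<subseteq> I)" (is "?S \<longleftrightarrow> ?\<Gamma>'")
  proof
    assume ?S
    then show ?\<Gamma>' by (intro ballI allI impI separates_imp_invariant)
  next
    assume ?\<Gamma>'
    then show ?S by (intro invariant_imp_separates) blast
  qed
  ultimately show ?thesis unfolding connes strong fell_cstar_completion by blast
qed

end
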